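(* Over $\mathsf{RCA}_0$: if a quasi order $Q$ is $\mathsf{BQO}$, then so is $H_f(Q)$.
   Context: For a quasi order $Q$, $H_f(Q)$ is the set of terms generated by: each $q\in Q$ is an element (urelement), and each finite set $a$ of previously generated elements is an element (urelements and sets kept formally distinct). Its quasi order is defined recursively: $p\leq q$ iff $p\leq_Q q$ for $p,q\in Q$; $p\leq b$ (set $b$) iff $p\leq y$ for some $y\in b$; $a\leq q$ (set $a$) iff $x\leq q$ for all $x\in a$; $a\leq b$ (sets) iff for each $x\in a$ there is $y\in b$ with $x\leq y$. Finite subsets of $\mathbb N$ are identified with their increasing enumerations; $s\vartriangleleft t$ means there is an infinite $X\subseteq\mathbb N$ with $s$ an initial segment of $X$ and $t$ an initial segment of $X$ minus its least element. A block is a set $B$ of finite subsets of $\mathbb N$ whose base $\bigcup B$ is infinite, such that every infinite $X\subseteq\bigcup B$ has an initial segment in $B$ and no element of $B$ is a proper initial segment of another; a barrier is a block in which no element is a proper subset of another. $Q$ is $\mathsf{BQO}$ if for every barrier $B$ and every $f:B\to Q$ there are $s\vartriangleleft t$ in $B$ with $f(s)\leq_Q f(t)$. *)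

theory Defs
  imports Main
begin

text \<open>
  Structures for the two-sorted language of second-order arithmetic.  Numbers range over the whole
  type \<open>'a\<close>, sets of numbers over \<open>sets M\<close>, which need not contain every subset of \<open>'a\<close> (Henkin
  semantics).  Neither sort has to be standard, so a sentence is provable in a theory iff it holds
  in all such models of that theory (completeness theorem).
\<close>

record 'a l2_structure =
  nzero :: 'a  ("\<zero>\<index>")
  none :: 'a  ("\<one>\<index>")
  nadd :: "'a \<Rightarrow> 'a \<Rightarrow> 'a"  (infixl "\<oplus>\<index>" 65)
  nmult :: "'a \<Rightarrow> 'a \<Rightarrow> 'a"  (infixl "\<otimes>\<index>" 70)
  nless :: "'a \<Rightarrow> 'a \<Rightarrow> bool"  (infix "\<prec>\<index>" 50)
  sets :: "'a set set"

datatype tm = Var nat | Zero | One | Add tm tm | Mult tm tm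

text \<open>
  The \<open>\<Sigma>\<^sup>0\<^sub>0\<close> formulas, with number variables and free set variables named by natural numbers.
  The bound \<open>t\<close> in \<open>BAll x t \<phi>\<close> (for all \<open>x < t\<close>) is evaluated outside the scope of \<open>x\<close>.
\<close>

datatype bfm = Eq tm tm | Less tm tm | In tm nat | Neg bfm | Conj bfm bfm | BAll nat tm bfm

locale l2 =
  fixes M :: "'a l2_structure" (structure)
begin

primrec val :: "(nat \<Rightarrow> 'a) \<Rightarrow> tm \<Rightarrow> 'a" where
  "val e (Var x) = e x"
| "val e Zero = \<zero>"
| "val e One = \<one>"
| "val e (Add s t) = val e s \<oplus> val e t"
| "val e (Mult s t) = val e s \<otimes> val e t"

primrec sat :: "(nat \<Rightarrow> 'a set) \<Rightarrow> (nat \<Rightarrow> 'a) \<Rightarrow> bfm \<Rightarrow> bool" where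
  "sat E e (Eq s t) \<longleftrightarrow> val e s = val e t"
| "sat E e (Less s t) \<longleftrightarrow> val e s \<prec> val e t"
| "sat E e (In t X) \<longleftrightarrow> val e t \<in> E X"
| "sat E e (Neg \<phi>) \<longleftrightarrow> \<not> sat E e \<phi>"
| "sat E e (Conj \<phi> \<psi>) \<longleftrightarrow> sat E e \<phi> \<and> sat E e \<psi>"
| "sat E e (BAll x t \<phi>) \<longleftrightarrow> (\<forall>a. a \<prec> val e t \<longrightarrow> sat E (e(x := a)) \<phi>)"

text \<open>
  Predicates defined by a \<open>\<Sigma>\<^sup>0\<^sub>1\<close> or \<open>\<Pi>\<^sup>0\<^sub>1\<close> formula with number and set parameters from \<open>M\<close>.
  Variable 0 is the argument and variable 1 the unbounded quantified variable.
\<close>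

definition Sigma01 :: "('a \<Rightarrow> bool) \<Rightarrow> bool" where
  "Sigma01 P \<longleftrightarrow> (\<exists>\<theta> E e. range E \<subseteq> sets M \<and> (\<forall>n. P n \<longleftrightarrow> (\<exists>m. sat E (e(0 := n, 1 := m)) \<theta>)))"

definition Pi01 :: "('a \<Rightarrow> bool) \<Rightarrow> bool" where
  "Pi01 P \<longleftrightarrow> (\<exists>\<theta> E e. range E \<subseteq> sets M \<and> (\<forall>n. P n \<longleftrightarrow> (\<forall>m. sat E (e(0 := n, 1 := m)) \<theta>)))"

end

locale rca0 = l2 +
  assumes succ_neq_zero: "n \<oplus> \<one> \<noteq> \<zero>"
    and succ_inject: "m \<oplus> \<one> = n \<oplus> \<one> \<Longrightarrow> m = n"
    and add_zero: "m \<oplus> \<zero> = m"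
    and add_succ: "m \<oplus> (n \<oplus> \<one>) = (m \<oplus> n) \<oplus> \<one>"
    and mult_zero: "m \<otimes> \<zero> = \<zero>"
    and mult_succ: "m \<otimes> (n \<oplus> \<one>) = (m \<otimes> n) \<oplus> m"
    and not_less_zero: "\<not> m \<prec> \<zero>"
    and less_succ: "m \<prec> n \<oplus> \<one> \<longleftrightarrow> m \<prec> n \<or> m = n"
    and sets_nonempty: "sets M \<noteq> {}"
    and Sigma01_induction:
      "Sigma01 P \<Longrightarrow> P \<zero> \<Longrightarrow> (\<forall>n. P n \<longrightarrow> P (n \<oplus> \<one>)) \<Longrightarrow> P n"
    and Delta01_comprehension:
      "Sigma01 P \<Longrightarrow> Pi01 P \<Longrightarrow> {n. P n} \<in> sets M"

text \<open>
  The notions below are relativised to a structure: quantifiers range over numbers and over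
  \<open>sets M\<close> only.  Finite sets, functions and relations are coded inside the structure.
\<close>

context l2
begin

definition pair :: "'a \<Rightarrow> 'a \<Rightarrow> 'a" where
  "pair i j = (i \<oplus> j) \<otimes> (i \<oplus> j) \<oplus> i"

text \<open>
  The usual coding of finite sets: the triple \<open>(k, (m, n))\<close> codes the set of all \<open>i < k\<close> such
  that \<open>m(i + 1) + 1\<close> divides \<open>n\<close>; numbers that are not triples code the empty set.  To have
  exactly one code per finite set, only the least code is used.
\<close>

definition elts :: "'a \<Rightarrow> 'a set" where
  "elts c = {i. \<exists>k m n. c = pair k (pair m n) \<and> i \<prec> k \<and> (\<exists>j. n = (m \<otimes> (i \<oplus> \<one>) \<oplus> \<one>) \<otimes> j)}"

definition fincode :: "'a \<Rightarrow> bool" where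
  "fincode c \<longleftrightarrow> (\<forall>d. d \<prec> c \<longrightarrow> elts d \<noteq> elts c)"

definition infinite_class :: "'a set \<Rightarrow> bool" where
  "infinite_class X \<longleftrightarrow> (\<forall>m. \<exists>n\<in>X. m \<prec> n)"

definition init_seg :: "'a set \<Rightarrow> 'a set \<Rightarrow> bool" where
  "init_seg s X \<longleftrightarrow> s \<subseteq> X \<and> (\<forall>x\<in>X. \<forall>y\<in>s. x \<prec> y \<longrightarrow> x \<in> s)"

definition minus_least :: "'a set \<Rightarrow> 'a set" where
  "minus_least X = {x \<in> X. \<exists>y\<in>X. y \<prec> x}"

definition tri :: "'a \<Rightarrow> 'a \<Rightarrow> bool"  (infix "\<lhd>" 50) where
  "s \<lhd> t \<longleftrightarrow> (\<exists>X\<in>sets M. infinite_class X \<and> init_seg (elts s) X \<and> init_seg (elts t) (minus_least X))"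

text \<open>The base is treated as a definable class; it is not required to be one of the \<open>sets M\<close>.\<close>

definition base :: "'a set \<Rightarrow> 'a set" where
  "base B = (\<Union>s\<in>B. elts s)"

definition block :: "'a set \<Rightarrow> bool" where
  "block B \<longleftrightarrow> B \<in> sets M \<and> (\<forall>s\<in>B. fincode s) \<and> infinite_class (base B)
    \<and> (\<forall>X\<in>sets M. infinite_class X \<and> X \<subseteq> base B \<longrightarrow> (\<exists>s\<in>B. init_seg (elts s) X))
    \<and> (\<forall>s\<in>B. \<forall>t\<in>B. \<not> (init_seg (elts s) (elts t) \<and> elts s \<noteq> elts t))"

definition barrier :: "'a set \<Rightarrow> bool" where
  "barrier B \<longleftrightarrow> block B \<and> (\<forall>s\<in>B. \<forall>t\<in>B. \<not> elts s \<subset> elts t)"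

definition function_from_to :: "'a set \<Rightarrow> 'a set \<Rightarrow> 'a set \<Rightarrow> bool" where
  "function_from_to F A B \<longleftrightarrow> F \<in> sets M
    \<and> (\<forall>z\<in>F. \<exists>x\<in>A. \<exists>y\<in>B. z = pair x y)
    \<and> (\<forall>x\<in>A. \<exists>!y. pair x y \<in> F)"

definition quasi_order :: "'a set \<Rightarrow> 'a set \<Rightarrow> bool" where
  "quasi_order Q R \<longleftrightarrow> Q \<in> sets M \<and> R \<in> sets M
    \<and> (\<forall>z\<in>R. \<exists>x\<in>Q. \<exists>y\<in>Q. z = pair x y)
    \<and> (\<forall>x\<in>Q. pair x x \<in> R)
    \<and> (\<forall>x\<in>Q. \<forall>y\<in>Q. \<forall>z\<in>Q. pair x y \<in> R \<and> pair y z \<in> R \<longrightarrow> pair x z \<in> R)"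

definition bqo :: "'a set \<Rightarrow> 'a set \<Rightarrow> bool" where
  "bqo Q R \<longleftrightarrow> quasi_order Q R
    \<and> (\<forall>B\<in>sets M. \<forall>F\<in>sets M. barrier B \<and> function_from_to F B Q \<longrightarrow>
        (\<exists>s\<in>B. \<exists>t\<in>B. s \<lhd> t \<and> (\<exists>p q. pair s p \<in> F \<and> pair t q \<in> F \<and> pair p q \<in> R)))"

text \<open>Tags that keep urelements and hereditarily finite sets formally distinct.\<close>

definition ur :: "'a \<Rightarrow> 'a" where
  "ur q = pair \<zero> q"

definition st :: "'a \<Rightarrow> 'a" where
  "st c = pair \<one> c"

text \<open>
  \<open>is_Hf Q R H L\<close>: \<open>H\<close> is the set of (codes of) terms of \<open>H\<^sub>f(Q)\<close> and \<open>L\<close> is its quasi order,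
  where \<open>R\<close> is the quasi order of \<open>Q\<close>.  The elements of a coded set are smaller than its code, so
  the equivalence for \<open>H\<close> is a recursion on codes with exactly one solution, and so are the
  clauses for \<open>L\<close>.
\<close>

definition is_Hf :: "'a set \<Rightarrow> 'a set \<Rightarrow> 'a set \<Rightarrow> 'a set \<Rightarrow> bool" where
  "is_Hf Q R H L \<longleftrightarrow> H \<in> sets M \<and> L \<in> sets M
    \<and> (\<forall>x. x \<in> H \<longleftrightarrow> (\<exists>q\<in>Q. x = ur q) \<or> (\<exists>a. fincode a \<and> elts a \<subseteq> H \<and> x = st a))
    \<and> (\<forall>z\<in>L. \<exists>x\<in>H. \<exists>y\<in>H. z = pair x y)
    \<and> (\<forall>p\<in>Q. \<forall>q\<in>Q. pair (ur p) (ur q) \<in> L \<longleftrightarrow> pair p q \<in> R)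
    \<and> (\<forall>p\<in>Q. \<forall>b. st b \<in> H \<longrightarrow>
        (pair (ur p) (st b) \<in> L \<longleftrightarrow> (\<exists>y\<in>elts b. pair (ur p) y \<in> L)))
    \<and> (\<forall>a. \<forall>q\<in>Q. st a \<in> H \<longrightarrow>
        (pair (st a) (ur q) \<in> L \<longleftrightarrow> (\<forall>x\<in>elts a. pair x (ur q) \<in> L)))
    \<and> (\<forall>a b. st a \<in> H \<and> st b \<in> H \<longrightarrow>
        (pair (st a) (st b) \<in> L \<longleftrightarrow> (\<forall>x\<in>elts a. \<exists>y\<in>elts b. pair x y \<in> L)))"

end

end

theory Submission
  imports Defs
begin

text \<open>
  The proof is carried out inside an arbitrary model of \<open>RCA\<^sub>0\<close>, so recursion, finite sets and
  sequences are coded in the model, and every set and function has a \<open>\<Delta>\<^sup>0\<^sub>1\<close> definition.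

  Let \<open>f\<close> be a bad array on a barrier \<open>B\<close> with values in \<open>H\<^sub>f(Q)\<close>.  For \<open>s\<^sub>0 \<lhd> s\<^sub>1\<close> with
  \<open>\<not> f s\<^sub>0 \<le> f s\<^sub>1\<close>, the least element of \<open>f s\<^sub>0\<close> that is below no element of \<open>f s\<^sub>1\<close> (or \<open>f s\<^sub>0\<close> itself if it
  is a urelement) gives a new bad array, defined on the unions \<open>s\<^sub>0 \<union> s\<^sub>1\<close>.  Codes of elements are
  smaller than codes of sets, so after at least \<open>f s\<^sub>0\<close> rounds only urelements remain and further rounds
  change nothing.  The number of rounds may therefore be any larger number \<open>g (max s\<^sub>0)\<close>; taking for
  \<open>g m\<close> a monotone bound of all \<open>f s\<close> with \<open>max s \<le> m\<close>, the unions of \<open>g (max s\<^sub>0) + 1\<close> successive members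
  of \<open>B\<close> form a barrier, and the final urelements are a bad array with values in \<open>Q\<close>.
\<close>

section \<open>Definability\<close>

text \<open>The number of rounds may be nonstandard, so the arrays themselves are not iterated. All
  rounds are computed at once by primitive recursion on one coded sequence of values, a triangle in
  which the entry of round j at place i depends on the places i to i + j only.

  The obstacle is the choice of the length. A length read off from the value at the first member
  gives no control when one union is included in another. If it depends monotonically on the maximum
  of the first member alone, an included union has a first member that ends no earlier, so it
  consists of at least as many members, and the antichain property of \<open>B\<close> then forces
  equality.

  Two unions related by \<open>\<lhd>\<close> may now need different numbers of rounds. As
  urelements survive further rounds, the shorter descent is prolonged and both results are read off
  in the same round.

  The bound \<open>g\<close> rests on Sigma_1 collection, which comes from Sigma_1 induction, and on
  a recursive bound for the least codes of the subsets of an initial segment of the numbers. The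
  base of a barrier is only a definable class, so an infinite set has to be found inside it before
  chains can be built.\<close>

primrec ren_tm :: "(nat \<Rightarrow> nat) \<Rightarrow> tm \<Rightarrow> tm" where
  "ren_tm f (Var x) = Var (f x)"
| "ren_tm f Zero = Zero"
| "ren_tm f One = One"
| "ren_tm f (Add s t) = Add (ren_tm f s) (ren_tm f t)"
| "ren_tm f (Mult s t) = Mult (ren_tm f s) (ren_tm f t)"

primrec ren :: "(nat \<Rightarrow> nat) \<Rightarrow> (nat \<Rightarrow> nat) \<Rightarrow> bfm \<Rightarrow> bfm" where
  "ren f g (Eq s t) = Eq (ren_tm f s) (ren_tm f t)"
| "ren f g (Less s t) = Less (ren_tm f s) (ren_tm f t)"
| "ren f g (In t X) = In (ren_tm f t) (g X)"
| "ren f g (Neg \<phi>) = Neg (ren f g \<phi>)"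
| "ren f g (Conj \<phi> \<psi>) = Conj (ren f g \<phi>) (ren f g \<psi>)"
| "ren f g (BAll x t \<phi>) = BAll (f x) (ren_tm f t) (ren f g \<phi>)"

definition merge :: "(nat \<Rightarrow> 'b) \<Rightarrow> (nat \<Rightarrow> 'b) \<Rightarrow> nat \<Rightarrow> 'b" where
  "merge e p n = (if even n then e (n div 2) else p (n div 2))"

text \<open>Two formulas with parameter lists \<open>p\<close> and \<open>q\<close> are brought to
  the common list \<open>merge p q\<close>: even variables stay fixed, and parameter number k
  becomes number 2k under \<open>left\<close> and 2k + 1 under \<open>right\<close>.\<close>

definition left :: "nat \<Rightarrow> nat" where "left n = (if even n then n else 2 * n - 1)"
definition right :: "nat \<Rightarrow> nat" where "right n = (if even n then n else 2 * n + 1)"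

lemma inj_left: "inj left"
  by (rule inj_on_inverseI[where g = "\<lambda>n. if even n then n else (n + 1) div 2"])
    (auto simp: left_def elim!: oddE)

lemma inj_right: "inj right"
  by (rule inj_on_inverseI[where g = "\<lambda>n. if even n then n else n div 2"])
    (auto simp: right_def elim!: oddE)

lemma merge_left: "merge e (merge p q) \<circ> left = merge e p"
proof
  fix n show "(merge e (merge p q) \<circ> left) n = merge e p n"
  proof (cases "even n")
    case False
    then obtain k where "n = 2 * k + 1" by (rule oddE)
    then show ?thesis by (simp add: merge_def left_def)
  qed (simp add: merge_def left_def)
qed

lemma merge_right: "merge e (merge p q) \<circ> right = merge e q"
proof
  fix n show "(merge e (merge p q) \<circ> right) n = merge e q n"
  proof (cases "even n")
    case False
    then obtain k where "n = 2 * k + 1" by (rule oddE)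
    then show ?thesis by (simp add: merge_def right_def)
  qed (simp add: merge_def right_def)
qed

lemma merge_even: "merge E F \<circ> (\<lambda>n. 2 * n) = E"
  by (rule ext) (auto simp: merge_def)

lemma merge_odd: "merge E F \<circ> (\<lambda>n. Suc (2 * n)) = F"
  by (rule ext) (auto simp: merge_def)

context l2
begin

lemma val_ren: "val e (ren_tm f t) = val (e \<circ> f) t"
  by (induction t) auto

text \<open>Injectivity prevents capture: updating at \<open>f x\<close> may change only the value
  that is read for \<open>x\<close>.\<close>

lemma sat_ren: "inj f \<Longrightarrow> sat E e (ren f g \<phi>) \<longleftrightarrow> sat (E \<circ> g) (e \<circ> f) \<phi>"
proof (induction \<phi> arbitrary: e)
  case (BAll x t \<phi>)
  have "e(f x := a) \<circ> f = (e \<circ> f)(x := a)" for a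
    using BAll.prems by (auto simp: fun_eq_iff inj_eq)
  then show ?case using BAll by (simp add: val_ren del: o_apply)
qed (auto simp: val_ren)

text \<open>
  Definability is expressed semantically, for predicates and functions on environments
  \<open>e :: nat \<Rightarrow> 'a\<close>.  Binders follow de Bruijn: under a quantifier the bound variable is \<open>e 0\<close> and
  the outer environment is \<open>\<lambda>n. e (Suc n)\<close>, so that the introduction rules below are higher-order
  patterns.  In the formulas, even variables hold the environment and odd ones the parameters.
\<close>

definition Tm :: "((nat \<Rightarrow> 'a) \<Rightarrow> 'a) \<Rightarrow> bool" where
  "Tm t \<longleftrightarrow> (\<exists>\<tau> p. \<forall>e. t e = val (merge e p) \<tau>)"

definition D0 :: "((nat \<Rightarrow> 'a) \<Rightarrow> bool) \<Rightarrow> bool" where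
  "D0 A \<longleftrightarrow> (\<exists>\<theta> E p. range E \<subseteq> sets M \<and> (\<forall>e. A e \<longleftrightarrow> sat E (merge e p) \<theta>))"

lemma Tm_var: "Tm (\<lambda>e. e n)"
  unfolding Tm_def by (rule exI[of _ "Var (2 * n)"]) (simp add: merge_def)

lemma Tm_const: "Tm (\<lambda>e. c)"
  unfolding Tm_def by (rule exI[of _ "Var 1"], rule exI[of _ "\<lambda>_. c"]) (simp add: merge_def)

lemma Tm_Tm:
  assumes "Tm s" "Tm t"
  obtains \<sigma> \<tau> p where "\<And>e. s e = val (merge e p) \<sigma>" "\<And>e. t e = val (merge e p) \<tau>"
proof -
  obtain \<sigma> p \<tau> q where "\<forall>e. s e = val (merge e p) \<sigma>" "\<forall>e. t e = val (merge e q) \<tau>"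
    using assms unfolding Tm_def by blast
  then show thesis
    by (intro that[of "merge p q" "ren_tm left \<sigma>" "ren_tm right \<tau>"])
      (simp_all add: val_ren merge_left merge_right)
qed

lemma Tm_add: "Tm s \<Longrightarrow> Tm t \<Longrightarrow> Tm (\<lambda>e. s e \<oplus> t e)"
proof (erule (1) Tm_Tm)
  fix \<sigma> \<tau> p assume "\<And>e. s e = val (merge e p) \<sigma>" "\<And>e. t e = val (merge e p) \<tau>"
  then have "\<forall>e. s e \<oplus> t e = val (merge e p) (Add \<sigma> \<tau>)" by simp
  then show ?thesis unfolding Tm_def by blast
qed

lemma Tm_mult: "Tm s \<Longrightarrow> Tm t \<Longrightarrow> Tm (\<lambda>e. s e \<otimes> t e)"
proof (erule (1) Tm_Tm)
  fix \<sigma> \<tau> p assume "\<And>e. s e = val (merge e p) \<sigma>" "\<And>e. t e = val (merge e p) \<tau>"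
  then have "\<forall>e. s e \<otimes> t e = val (merge e p) (Mult \<sigma> \<tau>)" by simp
  then show ?thesis unfolding Tm_def by blast
qed

lemma Tm_D0:
  assumes "Tm t" "D0 A"
  obtains \<tau> \<theta> E p where "range E \<subseteq> sets M"
    "\<And>e. t e = val (merge e p) \<tau>" "\<And>e. A e \<longleftrightarrow> sat E (merge e p) \<theta>"
proof -
  obtain \<tau> p where "\<forall>e. t e = val (merge e p) \<tau>"
    using assms(1) unfolding Tm_def by blast
  moreover obtain \<theta> q E where "range E \<subseteq> sets M" "\<forall>e. A e \<longleftrightarrow> sat E (merge e q) \<theta>"
    using assms(2) unfolding D0_def by blast
  ultimately show thesis
    by (intro that[of E "merge p q" "ren_tm left \<tau>" "ren right id \<theta>"])
      (simp_all add: val_ren sat_ren inj_right merge_left merge_right)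
qed

lemma D0_neg: "D0 A \<Longrightarrow> D0 (\<lambda>e. \<not> A e)"
  unfolding D0_def by (elim exE, rule_tac x = "Neg \<theta>" in exI) auto

lemma D0_conj:
  assumes "D0 A" "D0 B" shows "D0 (\<lambda>e. A e \<and> B e)"
proof -
  obtain \<theta> E p where 1: "range E \<subseteq> sets M" "\<forall>e. A e \<longleftrightarrow> sat E (merge e p) \<theta>"
    using assms(1) unfolding D0_def by blast
  obtain \<phi> F q where 2: "range F \<subseteq> sets M" "\<forall>e. B e \<longleftrightarrow> sat F (merge e q) \<phi>"
    using assms(2) unfolding D0_def by blast
  let ?\<psi> = "Conj (ren left (\<lambda>n. 2 * n) \<theta>) (ren right (\<lambda>n. Suc (2 * n)) \<phi>)"
  have "range (merge E F) \<subseteq> sets M" using 1 2 by (auto simp: merge_def)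
  moreover have "\<forall>e. (A e \<and> B e) \<longleftrightarrow> sat (merge E F) (merge e (merge p q)) ?\<psi>"
    using 1 2 by (simp add: sat_ren inj_left inj_right merge_left merge_right merge_even merge_odd del: o_apply)
  ultimately show ?thesis unfolding D0_def by blast
qed

lemma D0_disj: "D0 A \<Longrightarrow> D0 B \<Longrightarrow> D0 (\<lambda>e. A e \<or> B e)"
  using D0_neg[OF D0_conj[OF D0_neg D0_neg]] by simp

lemma D0_imp: "D0 A \<Longrightarrow> D0 B \<Longrightarrow> D0 (\<lambda>e. A e \<longrightarrow> B e)"
  using D0_neg[OF D0_conj[OF _ D0_neg]] by simp

lemma D0_mem: "Tm t \<Longrightarrow> X \<in> sets M \<Longrightarrow> D0 (\<lambda>e. t e \<in> X)"
proof -
  assume "Tm t" and X: "X \<in> sets M"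
  then obtain \<tau> p where "\<forall>e. t e = val (merge e p) \<tau>" unfolding Tm_def by blast
  then show ?thesis unfolding D0_def using X
    by (intro exI[of _ "In \<tau> 0"] exI[of _ "\<lambda>_. X"] exI[of _ p]) auto
qed

lemma D0_ball:
  assumes "Tm t" "D0 (\<lambda>e. A (\<lambda>n. e (Suc n)) (e 0))"
  shows "D0 (\<lambda>e. \<forall>y. y \<prec> t e \<longrightarrow> A e y)"
proof -
  obtain \<tau> \<theta> E p where *: "range E \<subseteq> sets M" "\<And>e. t e = val (merge e p) \<tau>"
    "\<And>e. A (\<lambda>n. e (Suc n)) (e 0) \<longleftrightarrow> sat E (merge e p) \<theta>"
    using Tm_D0[OF assms] by metis
  \<comment> \<open>The bound variable, number 0 of the body, becomes variable 1 of the new formula.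
    The even variables move down by one environment place, and the odd ones move up by 2 to free
    variable 1. \<open>k\<close> does the latter for the bound; the dummy \<open>d\<close> fills the
    freed parameter place.\<close>
  define h where "h n = (if n = 0 then 1 else if even n then n - 2 else n + 2)" for n :: nat
  define k where "k n = (if even n then n else n + 2)" for n :: nat
  define d :: 'a where "d = undefined"
  have inj: "inj h"
    by (rule inj_on_inverseI[where g = "\<lambda>n. if n = 1 then 0 else if even n then n + 2 else n - 2"])
      (auto simp: h_def elim!: evenE, presburger)
  have 1: "merge e (case_nat c p) \<circ> k = merge e p" for e c
    by (rule ext) (auto simp: merge_def k_def)
  have 2: "(merge e (case_nat d p))(1 := y) \<circ> h = merge (case_nat y e) p" for e y
    by (rule ext) (auto simp: merge_def h_def elim!: evenE split: nat.splits)
  have "A e y \<longleftrightarrow> sat E (merge (case_nat y e) p) \<theta>" for e y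
    using *(3)[of "case_nat y e"] by simp
  then have "\<forall>e. (\<forall>y. y \<prec> t e \<longrightarrow> A e y) \<longleftrightarrow>
      sat E (merge e (case_nat d p)) (BAll 1 (ren_tm k \<tau>) (ren h id \<theta>))"
    by (simp add: val_ren sat_ren[OF inj] 1 2[unfolded One_nat_def] *(2))
  then show ?thesis unfolding D0_def using *(1) by blast
qed

lemma D0_bex:
  assumes "Tm t" "D0 (\<lambda>e. A (\<lambda>n. e (Suc n)) (e 0))"
  shows "D0 (\<lambda>e. \<exists>y. y \<prec> t e \<and> A e y)"
  using D0_neg[OF D0_ball[OF assms(1) D0_neg[OF assms(2)]]] by simp

lemma D0_Sigma01:
  assumes "D0 A" shows "Sigma01 (\<lambda>n. \<exists>m. A (case_nat n (case_nat m (\<lambda>_. d))))"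
proof -
  obtain \<theta> E p where *: "range E \<subseteq> sets M" "\<forall>e. A e \<longleftrightarrow> sat E (merge e p) \<theta>"
    using assms unfolding D0_def by blast
  \<comment> \<open>The second environment value sits in variable 2, but \<open>Sigma01\<close>
    quantifies variable 1, which holds the first parameter; the two are swapped.\<close>
  define h where "h n = (if n = 1 then 2 else if n = 2 then 1 else n)" for n :: nat
  have inj: "inj h" unfolding inj_def h_def by auto
  define e where "e k = (if k = 2 then p 0 else merge (\<lambda>_. d) p k)" for k
  have "e(0 := n, Suc 0 := m) \<circ> h = merge (case_nat n (case_nat m (\<lambda>_. d))) p" for n m
    by (rule ext) (auto simp: merge_def h_def e_def elim!: evenE split: nat.splits)
  then show ?thesis unfolding Sigma01_def using *
    by (intro exI[of _ "ren h id \<theta>"] exI[of _ E] exI[of _ e]) (simp add: sat_ren[OF inj])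
qed

end

context rca0
begin

lemma D0_eq: "Tm s \<Longrightarrow> Tm t \<Longrightarrow> D0 (\<lambda>e. s e = t e)"
proof (erule (1) Tm_Tm)
  fix \<sigma> \<tau> p assume "\<And>e. s e = val (merge e p) \<sigma>" "\<And>e. t e = val (merge e p) \<tau>"
  moreover obtain X where "X \<in> sets M" using sets_nonempty by blast
  ultimately show ?thesis unfolding D0_def
    by (intro exI[of _ "Eq \<sigma> \<tau>"] exI[of _ "\<lambda>_. X"] exI[of _ p]) auto
qed

lemma D0_less: "Tm s \<Longrightarrow> Tm t \<Longrightarrow> D0 (\<lambda>e. s e \<prec> t e)"
proof (erule (1) Tm_Tm)
  fix \<sigma> \<tau> p assume "\<And>e. s e = val (merge e p) \<sigma>" "\<And>e. t e = val (merge e p) \<tau>"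
  moreover obtain X where "X \<in> sets M" using sets_nonempty by blast
  ultimately show ?thesis unfolding D0_def
    by (intro exI[of _ "Less \<sigma> \<tau>"] exI[of _ "\<lambda>_. X"] exI[of _ p]) auto
qed

lemmas D0_intros = Tm_var Tm_const Tm_add Tm_mult D0_eq D0_less D0_mem D0_neg D0_conj D0_disj D0_imp
  D0_ball D0_bex

lemma D0_induct:
  assumes "D0 (\<lambda>e. P (e 0))" "P \<zero>" "\<And>n. P n \<Longrightarrow> P (n \<oplus> \<one>)"
  shows "P n"
  using Sigma01_induction[of P n] D0_Sigma01[OF assms(1), of undefined] assms(2,3) by simp

lemma D0_ex_induct:
  assumes "D0 (\<lambda>e. P (e 0) (e 1))" "\<exists>y. P \<zero> y" "\<And>n y. P n y \<Longrightarrow> \<exists>z. P (n \<oplus> \<one>) z"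
  shows "\<exists>y. P n y"
  using Sigma01_induction[of "\<lambda>n. \<exists>y. P n y" n] D0_Sigma01[OF assms(1), of undefined] assms(2,3)
  by auto


section \<open>Arithmetic\<close>

definition leq :: "'a \<Rightarrow> 'a \<Rightarrow> bool"  (infix "\<preceq>" 50) where
  "m \<preceq> n \<longleftrightarrow> m \<prec> n \<or> m = n"

text \<open>Truncated subtraction, an operation that \<open>linordered_semidom\<close> asks
  for.\<close>

definition minus :: "'a \<Rightarrow> 'a \<Rightarrow> 'a"  (infixl "\<ominus>" 65) where
  "m \<ominus> n = (if n \<preceq> m then THE z. m = n \<oplus> z else \<zero>)"

lemma zero_add: "\<zero> \<oplus> n = n"
  by (rule D0_induct[where P = "\<lambda>n. \<zero> \<oplus> n = n"])
    (intro D0_intros, simp_all add: add_zero add_succ)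

lemma succ_add: "(m \<oplus> \<one>) \<oplus> n = (m \<oplus> n) \<oplus> \<one>"
  by (rule D0_induct[where P = "\<lambda>n. (m \<oplus> \<one>) \<oplus> n = (m \<oplus> n) \<oplus> \<one>"])
    (intro D0_intros, simp_all add: add_zero add_succ)

lemma add_commutes: "m \<oplus> n = n \<oplus> m"
  by (rule D0_induct[where P = "\<lambda>n. m \<oplus> n = n \<oplus> m"])
    (intro D0_intros, simp_all add: add_zero add_succ zero_add succ_add)

lemma add_associates: "(m \<oplus> n) \<oplus> k = m \<oplus> (n \<oplus> k)"
  by (rule D0_induct[where P = "\<lambda>k. (m \<oplus> n) \<oplus> k = m \<oplus> (n \<oplus> k)"])
    (intro D0_intros, simp_all add: add_zero add_succ)

lemma add_left_commutes: "m \<oplus> (n \<oplus> k) = n \<oplus> (m \<oplus> k)"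
  by (metis add_associates add_commutes)

lemmas add_ac' = add_associates add_commutes add_left_commutes

lemma mult_one: "m \<otimes> \<one> = m"
  using mult_succ[of m \<zero>] by (simp add: mult_zero zero_add)

lemma zero_mult: "\<zero> \<otimes> n = \<zero>"
  by (rule D0_induct[where P = "\<lambda>n. \<zero> \<otimes> n = \<zero>"])
    (intro D0_intros, simp_all add: add_zero mult_zero mult_succ)

lemma distrib': "(m \<oplus> n) \<otimes> k = m \<otimes> k \<oplus> n \<otimes> k"
  by (rule D0_induct[where P = "\<lambda>k. (m \<oplus> n) \<otimes> k = m \<otimes> k \<oplus> n \<otimes> k"])
    (intro D0_intros, simp_all add: add_zero mult_zero mult_succ add_ac')

lemma one_mult: "\<one> \<otimes> n = n"
  by (rule D0_induct[where P = "\<lambda>n. \<one> \<otimes> n = n"])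
    (intro D0_intros, simp_all add: mult_zero mult_succ)

lemma mult_commutes: "m \<otimes> n = n \<otimes> m"
  by (rule D0_induct[where P = "\<lambda>n. m \<otimes> n = n \<otimes> m"])
    (intro D0_intros, simp_all add: mult_zero mult_succ zero_mult distrib' one_mult)

lemma left_distrib': "k \<otimes> (m \<oplus> n) = k \<otimes> m \<oplus> k \<otimes> n"
  using distrib'[of m n k] by (simp add: mult_commutes)

lemma mult_associates: "(m \<otimes> n) \<otimes> k = m \<otimes> (n \<otimes> k)"
  by (rule D0_induct[where P = "\<lambda>k. (m \<otimes> n) \<otimes> k = m \<otimes> (n \<otimes> k)"])
    (intro D0_intros, simp_all add: mult_zero mult_succ left_distrib' mult_one)

lemma add_cancel: "k \<oplus> m = k \<oplus> n \<longleftrightarrow> m = n"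
proof
  have "k \<oplus> m = k \<oplus> n \<longrightarrow> m = n"
    by (rule D0_induct[where P = "\<lambda>k. k \<oplus> m = k \<oplus> n \<longrightarrow> m = n"])
      (intro D0_intros, simp_all add: zero_add succ_add, metis succ_inject)
  then show "k \<oplus> m = k \<oplus> n \<Longrightarrow> m = n" by blast
qed simp

lemma zero_or_succ:
  obtains "n = \<zero>" | m where "n = m \<oplus> \<one>"
proof -
  have "\<exists>y. n = \<zero> \<or> n = y \<oplus> \<one>"
    by (rule D0_ex_induct[where P = "\<lambda>n y. n = \<zero> \<or> n = y \<oplus> \<one>"]) (intro D0_intros, auto)
  then show thesis using that by blast
qed

lemma less_add: "x \<prec> x \<oplus> (z \<oplus> \<one>)"
  by (rule D0_induct[where P = "\<lambda>z. x \<prec> x \<oplus> (z \<oplus> \<one>)"])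
    (intro D0_intros, simp_all add: zero_add less_succ add_succ)

lemma less_iff_add: "x \<prec> y \<longleftrightarrow> (\<exists>z. y = x \<oplus> (z \<oplus> \<one>))"
proof
  have "\<exists>z. x \<prec> y \<longrightarrow> y = x \<oplus> (z \<oplus> \<one>)"
  proof (rule D0_ex_induct[where P = "\<lambda>y z. x \<prec> y \<longrightarrow> y = x \<oplus> (z \<oplus> \<one>)"])
    fix n y assume *: "x \<prec> n \<longrightarrow> n = x \<oplus> (y \<oplus> \<one>)"
    show "\<exists>z. x \<prec> n \<oplus> \<one> \<longrightarrow> n \<oplus> \<one> = x \<oplus> (z \<oplus> \<one>)"
    proof (cases "x = n")
      case True
      then show ?thesis by (intro exI[of _ \<zero>]) (simp add: zero_add)
    next
      case False
      then show ?thesis using * by (intro exI[of _ "y \<oplus> \<one>"]) (simp add: less_succ add_succ)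
    qed
  qed (intro D0_intros, simp add: not_less_zero)
  then show "x \<prec> y \<Longrightarrow> \<exists>z. y = x \<oplus> (z \<oplus> \<one>)" by blast
qed (use less_add in auto)

lemma less_irreflexive: "\<not> x \<prec> x"
  by (metis less_iff_add add_cancel add_zero succ_neq_zero)

lemma less_transitive: "x \<prec> y \<Longrightarrow> y \<prec> z \<Longrightarrow> x \<prec> z"
  unfolding less_iff_add by (metis add_associates)

lemma leq_iff_add: "x \<preceq> y \<longleftrightarrow> (\<exists>z. y = x \<oplus> z)"
  unfolding leq_def less_iff_add by (metis add_zero zero_or_succ)

lemma less_total: "x \<prec> y \<or> x = y \<or> y \<prec> x"
proof (rule D0_induct[where P = "\<lambda>x. x \<prec> y \<or> x = y \<or> y \<prec> x"])
  show "\<zero> \<prec> y \<or> \<zero> = y \<or> y \<prec> \<zero>"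
    using leq_iff_add[of \<zero> y] zero_add[of y] unfolding leq_def by metis
next
  fix n assume "n \<prec> y \<or> n = y \<or> y \<prec> n"
  moreover have "n \<oplus> \<one> \<preceq> y" if "n \<prec> y"
    using that unfolding less_iff_add leq_iff_add by (metis add_ac'(1,2))
  ultimately show "n \<oplus> \<one> \<prec> y \<or> n \<oplus> \<one> = y \<or> y \<prec> n \<oplus> \<one>"
    unfolding less_succ leq_def by auto
qed (intro D0_intros)

lemma mult_less: "a \<prec> b \<Longrightarrow> \<zero> \<prec> c \<Longrightarrow> c \<otimes> a \<prec> c \<otimes> b"
proof -
  assume "a \<prec> b" "\<zero> \<prec> c"
  then obtain z w where "b = a \<oplus> (z \<oplus> \<one>)" "c = \<zero> \<oplus> (w \<oplus> \<one>)" unfolding less_iff_add by metis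
  then have "c \<otimes> b = c \<otimes> a \<oplus> ((c \<otimes> z \<oplus> w) \<oplus> \<one>)"
    by (metis mult_commutes distrib' mult_succ add_associates zero_add)
  then show ?thesis unfolding less_iff_add by blast
qed

lemma add_minus: "x \<oplus> y \<ominus> x = y"
  unfolding minus_def leq_iff_add by (auto simp: add_cancel)

text \<open>The numbers of the model thus inherit the library on ordered semirings and divisibility,
  under the prefix \<open>N\<close>.\<close>

sublocale N: linordered_semidom where one = "\<one>" and times = "(\<otimes>)" and plus = "(\<oplus>)" and zero = "\<zero>"
  and minus = "(\<ominus>)" and less_eq = "(\<preceq>)" and less = "(\<prec>)"
proof unfold_locales
  show "a \<ominus> b \<ominus> c = a \<ominus> (b \<oplus> c)" for a b c
  proof (cases "b \<oplus> c \<preceq> a")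
    case True
    then obtain d where "a = b \<oplus> (c \<oplus> d)" unfolding leq_iff_add by (metis add_associates)
    then show ?thesis by (metis add_minus add_associates)
  next
    case False
    then have 1: "\<not> c \<preceq> d" if "a = b \<oplus> d" for d
      using that unfolding leq_iff_add by (metis add_associates)
    show ?thesis
    proof (cases "b \<preceq> a")
      case True
      then obtain d where "a = b \<oplus> d" unfolding leq_iff_add by blast
      then show ?thesis using 1[of d] False by (simp add: add_minus) (simp add: minus_def)
    next
      case F2: False
      have "\<zero> \<ominus> c = \<zero>"
      proof (cases "c = \<zero>")
        case True
        then show ?thesis using add_minus[of \<zero> \<zero>] by (simp add: zero_add)
      next
        case False
        then show ?thesis unfolding minus_def leq_def by (simp add: not_less_zero)
      qed
      then show ?thesis using False F2 by (simp add: minus_def)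
    qed
  qed
  show "(x \<prec> y) = (x \<preceq> y \<and> \<not> y \<preceq> x)" for x y
    unfolding leq_def using less_irreflexive less_transitive by blast
  show "x \<preceq> x" for x by (simp add: leq_def)
  show "x \<preceq> y \<Longrightarrow> y \<preceq> z \<Longrightarrow> x \<preceq> z" for x y z
    unfolding leq_def using less_transitive by blast
  show "x \<preceq> y \<Longrightarrow> y \<preceq> x \<Longrightarrow> x = y" for x y
    unfolding leq_def using less_irreflexive less_transitive by blast
  show "x \<preceq> y \<or> y \<preceq> x" for x y
    unfolding leq_def using less_total by blast
  show "b \<preceq> a \<Longrightarrow> a \<ominus> b \<oplus> b = a" for a b
    unfolding leq_iff_add using add_minus add_commutes by metis
  show "\<zero> \<prec> \<one>" using less_succ[of \<zero> \<zero>] by (simp add: zero_add)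
  show "a \<otimes> (b \<oplus> c) = a \<otimes> b \<oplus> a \<otimes> c" for a b c
    by (rule left_distrib')
  show "a \<otimes> (b \<ominus> c) = a \<otimes> b \<ominus> a \<otimes> c" for a b c
  proof (cases "c \<preceq> b")
    case True
    then obtain d where "b = c \<oplus> d" unfolding leq_iff_add by blast
    then show ?thesis by (metis add_minus mult_commutes distrib')
  next
    case False
    then have bc: "b \<prec> c" using less_total unfolding leq_def by blast
    show ?thesis
    proof (cases "a = \<zero>")
      case True
      then show ?thesis using add_minus[of \<zero> \<zero>] by (simp add: zero_mult zero_add)
    next
      case F2: False
      then have "\<zero> \<prec> a" using less_total not_less_zero by blast
      then have "a \<otimes> b \<prec> a \<otimes> c" using bc by (rule mult_less[rotated])
      then have "\<not> a \<otimes> c \<preceq> a \<otimes> b"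
        unfolding leq_def using less_irreflexive less_transitive by metis
      then show ?thesis using False by (simp add: minus_def mult_zero)
    qed
  qed
  show "\<zero> \<noteq> \<one>" using succ_neq_zero[of \<zero>] by (simp add: zero_add)
  show "a \<otimes> b \<noteq> \<zero>" if "a \<noteq> \<zero>" "b \<noteq> \<zero>" for a b
    using mult_less[of \<zero> b a] that less_total not_less_zero mult_zero by metis
qed (unfold leq_iff_add, auto simp: add_cancel zero_mult mult_zero distrib' mult_one one_mult mult_less add_minus
      zero_add add_zero add_associates mult_associates simp del: ex_simps intro: mult_commutes add_commutes)

lemma less_succ_iff_leq: "m \<prec> n \<oplus> \<one> \<longleftrightarrow> m \<preceq> n"
  by (simp add: less_succ leq_def)

lemma succ_leq_iff_less: "m \<oplus> \<one> \<preceq> n \<longleftrightarrow> m \<prec> n"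
  by (metis N.not_less less_succ_iff_leq)


end

context l2
begin

section \<open>The class of \<open>\<Delta>\<^sup>0\<^sub>1\<close> predicates\<close>

text \<open>Variables in \<open>S\<close> are renamed and all others are frozen to the values
  \<open>c\<close>, which join the parameters: in \<open>merge c p\<close> the even places hold
  \<open>c\<close> and the odd ones the old parameters. Only the renamed variables have to stay
  distinct.\<close>

lemma D0_subst:
  assumes "D0 A" "inj_on f S" shows "D0 (\<lambda>e. A (\<lambda>n. if n \<in> S then e (f n) else c n))"
proof -
  obtain \<theta> E p where *: "range E \<subseteq> sets M" "\<forall>e. A e \<longleftrightarrow> sat E (merge e p) \<theta>"
    using assms unfolding D0_def by blast
  let ?f = "\<lambda>n. if even n \<and> n div 2 \<in> S then 2 * f (n div 2) else 2 * n + 1"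
  have inj: "inj ?f"
    by (rule inj_on_inverseI[where g = "\<lambda>n. if even n then 2 * inv_into S f (n div 2) else n div 2"])
      (auto simp: assms(2))
  have "merge e (merge c p) \<circ> ?f = merge (\<lambda>n. if n \<in> S then e (f n) else c n) p" for e
    by (rule ext) (auto simp: merge_def)
  then show ?thesis unfolding D0_def using *
    by (intro exI[of _ "ren ?f id \<theta>"] exI[of _ E] exI[of _ "merge c p"]) (simp add: sat_ren[OF inj])
qed

lemma D0_ren:
  assumes "D0 A" "inj f" "\<And>e. g e = (\<lambda>n. e (f n))" shows "D0 (\<lambda>e. A (g e))"
  using D0_subst[OF assms(1), of f UNIV] assms(2,3) by simp

definition S1 :: "((nat \<Rightarrow> 'a) \<Rightarrow> bool) \<Rightarrow> bool" where
  "S1 A \<longleftrightarrow> (\<exists>B. D0 B \<and> (\<forall>e. A e \<longleftrightarrow> (\<exists>y. B (case_nat y e))))"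

definition D1 :: "((nat \<Rightarrow> 'a) \<Rightarrow> bool) \<Rightarrow> bool" where
  "D1 A \<longleftrightarrow> S1 A \<and> S1 (\<lambda>e. \<not> A e)"

text \<open>A Sigma_1 graph suffices because \<open>f\<close> is total: both
  \<open>A e (f e)\<close> and its negation can be expressed by an existential quantifier over the
  value, so Delta_1 predicates are closed under substitution of \<open>f\<close>.\<close>

definition F1 :: "((nat \<Rightarrow> 'a) \<Rightarrow> 'a) \<Rightarrow> bool" where
  "F1 f \<longleftrightarrow> S1 (\<lambda>e. e 0 = f (\<lambda>n. e (Suc n)))"

lemma inj_rev: "inj (\<lambda>n :: nat. if n \<le> k then k - n else n)"
  by (rule inj_on_inverseI[where g = "\<lambda>n. if n \<le> k then k - n else n"]) auto

lemma S1E: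
  assumes "S1 A" obtains B where "D0 B" "\<And>e. A e \<longleftrightarrow> (\<exists>y. B (case_nat y e))"
  using assms unfolding S1_def by blast

lemma S1I: "D0 B \<Longrightarrow> (\<And>e. A e \<longleftrightarrow> (\<exists>y. B (case_nat y e))) \<Longrightarrow> S1 A"
  unfolding S1_def by blast

lemma case_nat_ext: "case_nat x f = (\<lambda>n. e (g n)) \<longleftrightarrow> x = e (g 0) \<and> f = (\<lambda>n. e (g (Suc n)))"
  by (auto simp: fun_eq_iff split: nat.splits)

lemma D0_S1: "D0 A \<Longrightarrow> S1 A"
  unfolding S1_def by (rule exI[of _ "\<lambda>e. A (\<lambda>n. e (Suc n))"]) (auto intro: D0_ren[of _ Suc])

lemma S1_subst:
  assumes "S1 A" "inj_on f S" shows "S1 (\<lambda>e. A (\<lambda>n. if n \<in> S then e (f n) else c n))"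
proof -
  obtain B where B: "D0 B" "\<And>e. A e \<longleftrightarrow> (\<exists>y. B (case_nat y e))" by (rule S1E[OF assms(1)], rule that)
  let ?f = "case_nat 0 (\<lambda>n. Suc (f n))"
  have "inj_on ?f {n. n = 0 \<or> n - 1 \<in> S}"
    by (intro inj_onI) (auto dest: inj_onD[OF assms(2)] split: nat.splits)
  note D0_subst[OF B(1) this, of "case_nat undefined c"]
  moreover have "case_nat y (\<lambda>n. if n \<in> S then e (f n) else c n) =
    (\<lambda>n. if n \<in> {n. n = 0 \<or> n - 1 \<in> S} then case_nat y e (?f n) else case_nat undefined c n)" for y e
    by (auto simp: fun_eq_iff split: nat.splits)
  ultimately show ?thesis unfolding S1_def B(2)
    by (intro exI[of _ "\<lambda>e. B (\<lambda>n. if n \<in> {n. n = 0 \<or> n - 1 \<in> S} then e (?f n) else case_nat undefined c n)"])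
      simp
qed

lemma S1_ren:
  assumes "S1 A" "inj f" "\<And>e. g e = (\<lambda>n. e (f n))" shows "S1 (\<lambda>e. A (g e))"
  using S1_subst[OF assms(1), of f UNIV] assms(2,3) by simp

lemma S1_Suc: "S1 A \<Longrightarrow> S1 (\<lambda>e. A (\<lambda>n. e (Suc n)))"
  by (rule S1_ren[of _ Suc]) auto

lemma S1_Suc1: "S1 (\<lambda>e. A (\<lambda>n. e (Suc n)) (e 0)) \<Longrightarrow> S1 (\<lambda>e. A (\<lambda>n. e (Suc (Suc n))) (e 0))"
  by (drule S1_ren[where f = "case_nat 0 (\<lambda>n. Suc (Suc n))" and g = "\<lambda>e. case_nat (e 0) (\<lambda>n. e (Suc (Suc n)))"])
    (auto simp: inj_def fun_eq_iff split: nat.splits)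

lemma S1_Sigma01: "S1 A \<Longrightarrow> Sigma01 (\<lambda>n. A (case_nat n c))"
proof -
  assume "S1 A"
  then obtain B where B: "D0 B" "\<And>e. A e \<longleftrightarrow> (\<exists>y. B (case_nat y e))" by (rule S1E, rule_tac that)
  let ?f = "\<lambda>n. 1 - n" 
  have "inj_on ?f {0, 1 :: nat}" by auto
  note D0_Sigma01[OF D0_subst[OF B(1) this, of "\<lambda>n. c (n - 2)"], of undefined]
  moreover have "(\<lambda>k. if k \<in> {0, 1} then case_nat n (case_nat m (\<lambda>_. undefined)) (?f k) else c (k - 2))
    = case_nat m (case_nat n c)" for n m
    by (auto simp: fun_eq_iff split: nat.splits)
  ultimately show ?thesis unfolding B(2) by (simp only:)
qed

lemma S1_disj:
  assumes "S1 A" "S1 B" shows "S1 (\<lambda>e. A e \<or> B e)"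
proof -
  obtain C where C: "D0 C" "\<And>e. A e \<longleftrightarrow> (\<exists>y. C (case_nat y e))" by (rule S1E[OF assms(1)], rule that)
  obtain D where D: "D0 D" "\<And>e. B e \<longleftrightarrow> (\<exists>y. D (case_nat y e))" by (rule S1E[OF assms(2)], rule that)
  show ?thesis by (rule S1I[OF D0_disj[OF C(1) D(1)]]) (auto simp: C(2) D(2))
qed

end

context rca0
begin

lemma less_sum1: "x \<prec> x \<oplus> y \<oplus> \<one>"
  by (simp add: less_succ_iff_leq leq_iff_add)

lemma less_sum2: "y \<prec> x \<oplus> y \<oplus> \<one>"
  using less_sum1[of y x] by (simp only: add_commutes[of x y])

text \<open>One number above both witnesses replaces the two unbounded quantifiers by one; the sum
  of the witnesses serves as this number.\<close>

lemma S1_conj: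
  assumes "S1 A" "S1 B" shows "S1 (\<lambda>e. A e \<and> B e)"
proof -
  obtain C where C: "D0 C" "\<And>e. A e \<longleftrightarrow> (\<exists>y. C (case_nat y e))" by (rule S1E[OF assms(1)], rule that)
  obtain D where D: "D0 D" "\<And>e. B e \<longleftrightarrow> (\<exists>y. D (case_nat y e))" by (rule S1E[OF assms(2)], rule that)
  let ?E = "\<lambda>e. \<exists>y. y \<prec> e 0 \<oplus> \<one> \<and> (\<exists>z. z \<prec> e 0 \<oplus> \<one> \<and>
    C (case_nat y (\<lambda>n. e (Suc n))) \<and> D (case_nat z (\<lambda>n. e (Suc n))))"
  have "D0 ?E"
    by (intro D0_intros D0_ren[OF C(1), of "case_nat 1 (\<lambda>n. n + 3)"]
        D0_ren[OF D(1), of "case_nat 0 (\<lambda>n. n + 3)"])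
      (auto simp: inj_def case_nat_ext numeral_3_eq_3 split: nat.splits)
  moreover have "(A e \<and> B e) \<longleftrightarrow> (\<exists>w. ?E (case_nat w e))" for e
  proof
    assume "A e \<and> B e"
    then obtain y z where "C (case_nat y e)" "D (case_nat z e)" unfolding C(2) D(2) by blast
    then show "\<exists>w. ?E (case_nat w e)"
      by (rule_tac exI[of _ "y \<oplus> z"], rule_tac exI[of _ y], intro conjI, rule_tac [2] exI[of _ z])
        (auto simp: less_sum1 less_sum2)
  qed (auto simp: C(2) D(2))
  ultimately show ?thesis unfolding S1_def by blast
qed

lemma S1_ex:
  assumes "S1 (\<lambda>e. A (\<lambda>n. e (Suc n)) (e 0))" shows "S1 (\<lambda>e. \<exists>x. A e x)"
proof -
  obtain B where B: "D0 B" "\<And>e. A (\<lambda>n. e (Suc n)) (e 0) \<longleftrightarrow> (\<exists>y. B (case_nat y e))"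
    by (rule S1E[OF assms], rule that)
  have A: "A e x \<longleftrightarrow> (\<exists>y. B (case_nat y (case_nat x e)))" for e x
    using B(2)[of "case_nat x e"] by simp
  let ?E = "\<lambda>e. \<exists>x. x \<prec> e 0 \<oplus> \<one> \<and> (\<exists>y. y \<prec> e 0 \<oplus> \<one> \<and>
    B (case_nat y (case_nat x (\<lambda>n. e (Suc n)))))"
  have "D0 ?E"
    by (intro D0_intros D0_ren[OF B(1), of "case_nat 0 (case_nat 1 (\<lambda>n. n + 3))"])
      (auto simp: inj_def case_nat_ext numeral_3_eq_3 split: nat.splits)
  moreover have "(\<exists>x. A e x) \<longleftrightarrow> (\<exists>w. ?E (case_nat w e))" for e
  proof
    assume "\<exists>x. A e x"
    then obtain x y where "B (case_nat y (case_nat x e))" unfolding A by blast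
    then show "\<exists>w. ?E (case_nat w e)"
      by (rule_tac exI[of _ "x \<oplus> y"], rule_tac exI[of _ x], intro conjI, rule_tac [2] exI[of _ y])
        (auto simp: less_sum1 less_sum2)
  qed (auto simp: A)
  ultimately show ?thesis unfolding S1_def by blast
qed

text \<open>Sigma_1 collection, derived from Sigma_1 induction. It is what closes Sigma_1 under
  bounded universal quantifiers.\<close>

lemma collection:
  assumes "S1 (\<lambda>e. A (\<lambda>n. e (Suc n)) (e 0))"
  obtains B where "D0 B" "\<And>t e. (\<forall>x. x \<prec> t \<longrightarrow> A e x) \<longleftrightarrow>
    (\<exists>w. \<forall>x. x \<prec> t \<longrightarrow> (\<exists>y. y \<prec> w \<and> B (case_nat y (case_nat x e))))"
proof -
  obtain B where B: "D0 B" "\<And>e. A (\<lambda>n. e (Suc n)) (e 0) \<longleftrightarrow> (\<exists>y. B (case_nat y e))"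
    by (rule S1E[OF assms], rule that)
  have A: "A e x \<longleftrightarrow> (\<exists>y. B (case_nat y (case_nat x e)))" for e x
    using B(2)[of "case_nat x e"] by simp
  have "(\<exists>w. \<forall>x. x \<prec> t \<longrightarrow> (\<exists>y. y \<prec> w \<and> B (case_nat y (case_nat x e))))"
    if *: "\<forall>x. x \<prec> t \<longrightarrow> A e x" for t e
  proof -
    \<comment> \<open>Only \<open>x\<close> below both \<open>k\<close> and \<open>t\<close> are
      considered, so the induction on \<open>k\<close> may run past \<open>t\<close> without a case
      of its own. The environment \<open>e\<close> is frozen.\<close>
    let ?C = "\<lambda>k w. \<forall>x. x \<prec> k \<longrightarrow> x \<prec> t \<longrightarrow> (\<exists>y. y \<prec> w \<and> B (case_nat y (case_nat x e)))"
    have "\<exists>w. ?C t w"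
    proof (rule D0_ex_induct[where P = ?C])
      have "(\<lambda>n. if n \<in> {0, 1} then e' (id n) else case_nat undefined (case_nat undefined e) n) =
          case_nat (e' 0) (case_nat (e' (Suc 0)) e)" for e'
        by (auto simp: fun_eq_iff split: nat.splits)
      then have "D0 (\<lambda>e'. B (case_nat (e' 0) (case_nat (e' (Suc 0)) e)))"
        using D0_subst[OF B(1) inj_on_id, of "{0, 1}" "case_nat undefined (case_nat undefined e)"]
        by (simp only:)
      then show "D0 (\<lambda>e. ?C (e 0) (e 1))" by (intro D0_intros)
    next
      fix n w assume w: "?C n w"
      show "\<exists>w. ?C (n \<oplus> \<one>) w"
      proof (cases "n \<prec> t")
        case True
        then obtain y where y: "B (case_nat y (case_nat n e))" using * A by blast
        show ?thesis
        proof (rule exI[of _ "w \<oplus> y \<oplus> \<one>"], intro allI impI)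
          fix x assume x: "x \<prec> n \<oplus> \<one>" "x \<prec> t"
          show "\<exists>z. z \<prec> w \<oplus> y \<oplus> \<one> \<and> B (case_nat z (case_nat x e))"
          proof (cases "x = n")
            case True
            then show ?thesis using y less_sum2 by blast
          next
            case False
            then obtain z where "z \<prec> w" "B (case_nat z (case_nat x e))" using w x by (auto simp: less_succ)
            then show ?thesis using less_sum1[of w y] by (intro exI[of _ z]) auto
          qed
        qed
      next
        case False
        then show ?thesis using w by (auto simp: less_succ)
      qed
    qed (auto simp: not_less_zero)
    then show ?thesis by blast
  qed
  then show thesis by (intro that[OF B(1)]) (auto simp: A)
qed

text \<open>The bound is a variable because formulas only admit terms as bounds; a bound given by a
  Sigma_1 function is substituted afterwards.\<close>

lemma S1_ball_var:
  assumes "S1 (\<lambda>e. A (\<lambda>n. e (Suc n)) (e 0))"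
  shows "S1 (\<lambda>e. \<forall>x. x \<prec> e k \<longrightarrow> A e x)"
proof -
  obtain B where B: "D0 B" "\<And>t e. (\<forall>x. x \<prec> t \<longrightarrow> A e x) \<longleftrightarrow>
    (\<exists>w. \<forall>x. x \<prec> t \<longrightarrow> (\<exists>y. y \<prec> w \<and> B (case_nat y (case_nat x e))))"
    by (rule collection[OF assms], rule that)
  let ?E = "\<lambda>e. \<forall>x. x \<prec> e (Suc k) \<longrightarrow> (\<exists>y. y \<prec> e 0 \<and> B (case_nat y (case_nat x (\<lambda>n. e (Suc n)))))"
  have "D0 ?E"
    by (intro D0_intros D0_ren[OF B(1), of "case_nat 0 (case_nat 1 (\<lambda>n. n + 3))"])
      (auto simp: inj_def case_nat_ext numeral_3_eq_3 split: nat.splits)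
  then show ?thesis unfolding S1_def B(2) by (intro exI[of _ ?E]) simp
qed

section \<open>Substitution of functions and closure of Delta_1\<close>

lemma S1_sub:
  assumes "S1 (\<lambda>e. A (\<lambda>n. e (Suc n)) (e 0))" "F1 f" shows "S1 (\<lambda>e. A e (f e))"
proof -
  have "S1 (\<lambda>e. \<exists>x. x = f e \<and> A e x)"
    by (intro S1_ex S1_conj assms(1) assms(2)[unfolded F1_def])
  then show ?thesis by simp
qed

lemma F1_Suc: "F1 f \<Longrightarrow> F1 (\<lambda>e. f (\<lambda>n. e (Suc n)))"
  unfolding F1_def by (rule S1_Suc1[where A = "\<lambda>e x. x = f e"])

lemma S1_comp1: "S1 (\<lambda>e. r (e 0)) \<Longrightarrow> F1 f \<Longrightarrow> S1 (\<lambda>e. r (f e))"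
  by (rule S1_sub[where A = "\<lambda>e x. r x"])

lemma S1_comp2:
  assumes "S1 (\<lambda>e. r (e 0) (e 1))" "F1 f" "F1 g" shows "S1 (\<lambda>e. r (f e) (g e))"
proof (rule S1_sub[where A = "\<lambda>e x. r x (g e)"])
  have "S1 (\<lambda>e. r (e 1) (e 0))"
    using S1_ren[OF assms(1) inj_rev[of 1] refl] by simp
  then show "S1 (\<lambda>e. r (e 0) (g (\<lambda>n. e (Suc n))))"
    by (intro S1_sub[where A = "\<lambda>e x. r (e 0) x"] F1_Suc assms) simp
qed fact

lemma S1_comp3:
  assumes "S1 (\<lambda>e. r (e 0) (e 1) (e 2))" "F1 f" "F1 g" "F1 h" shows "S1 (\<lambda>e. r (f e) (g e) (h e))"
proof (rule S1_sub[where A = "\<lambda>e x. r x (g e) (h e)"])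
  have "S1 (\<lambda>e. r (e 2) (e 1) (e 0))"
    using S1_ren[OF assms(1) inj_rev[of 2] refl] by simp
  then show "S1 (\<lambda>e. r (e 0) (g (\<lambda>n. e (Suc n))) (h (\<lambda>n. e (Suc n))))"
    by (intro S1_sub[where A = "\<lambda>e x. r (e 0) x (h (\<lambda>n. e (Suc n)))"]
        S1_sub[where A = "\<lambda>e x. r (e (Suc 0)) (e 0) x"] F1_Suc assms) (simp add: numeral_2_eq_2)
qed fact


lemma S1_comp4:
  assumes "S1 (\<lambda>e. r (e 0) (e 1) (e 2) (e 3))" "F1 f" "F1 g" "F1 h" "F1 k"
  shows "S1 (\<lambda>e. r (f e) (g e) (h e) (k e))"
proof (rule S1_sub[where A = "\<lambda>e x. r x (g e) (h e) (k e)"])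
  have "S1 (\<lambda>e. r (e 3) (e 2) (e 1) (e 0))"
    using S1_ren[OF assms(1) inj_rev[of 3] refl] by simp
  then show "S1 (\<lambda>e. r (e 0) (g (\<lambda>n. e (Suc n))) (h (\<lambda>n. e (Suc n))) (k (\<lambda>n. e (Suc n))))"
    by (intro S1_sub[where A = "\<lambda>e x. r (e 0) x (h (\<lambda>n. e (Suc n))) (k (\<lambda>n. e (Suc n)))"]
        S1_sub[where A = "\<lambda>e x. r (e (Suc 0)) (e 0) x (k (\<lambda>n. e (Suc (Suc n))))"]
        S1_sub[where A = "\<lambda>e x. r (e (Suc (Suc 0))) (e (Suc 0)) (e 0) x"] F1_Suc assms)
      (simp add: numeral_2_eq_2 numeral_3_eq_3)
qed fact

lemma F1I: "S1 (\<lambda>e. e 0 = f (\<lambda>n. e (Suc n))) \<Longrightarrow> F1 f"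
  by (simp add: F1_def)

lemma F1_var: "F1 (\<lambda>e. e n)"
  unfolding F1_def by (intro D0_S1 D0_intros)

lemma F1_const: "F1 (\<lambda>e. c)"
  unfolding F1_def by (intro D0_S1 D0_intros)

lemma F1_comp1:
  assumes "F1 (\<lambda>e. k (e 0))" "F1 f" shows "F1 (\<lambda>e. k (f e))"
proof (rule F1I, rule S1_comp2[where r = "\<lambda>z x. z = k x"])
  show "S1 (\<lambda>e. e 0 = k (e 1))"
    using assms(1) by (simp add: F1_def numeral_2_eq_2 numeral_3_eq_3)
qed (intro F1_var F1_Suc assms)+

lemma F1_comp2:
  assumes "F1 (\<lambda>e. k (e 0) (e 1))" "F1 f" "F1 g" shows "F1 (\<lambda>e. k (f e) (g e))"
proof (rule F1I, rule S1_comp3[where r = "\<lambda>z x y. z = k x y"])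
  show "S1 (\<lambda>e. e 0 = k (e 1) (e 2))"
    using assms(1) by (simp add: F1_def numeral_2_eq_2 numeral_3_eq_3)
qed (intro F1_var F1_Suc assms)+

lemma F1_comp3:
  assumes "F1 (\<lambda>e. k (e 0) (e 1) (e 2))" "F1 f" "F1 g" "F1 h" shows "F1 (\<lambda>e. k (f e) (g e) (h e))"
proof (rule F1I, rule S1_comp4[where r = "\<lambda>z x y u. z = k x y u"])
  show "S1 (\<lambda>e. e 0 = k (e 1) (e 2) (e 3))"
    using assms(1) by (simp add: F1_def numeral_2_eq_2 numeral_3_eq_3)
qed (intro F1_var F1_Suc assms)+

lemma F1_add: "F1 f \<Longrightarrow> F1 g \<Longrightarrow> F1 (\<lambda>e. f e \<oplus> g e)"
  by (rule F1_comp2[where k = "(\<oplus>)"]) (rule F1I, intro D0_S1 D0_intros)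

lemma F1_mult: "F1 f \<Longrightarrow> F1 g \<Longrightarrow> F1 (\<lambda>e. f e \<otimes> g e)"
  by (rule F1_comp2[where k = "(\<otimes>)"]) (rule F1I, intro D0_S1 D0_intros)

lemma D1_S1: "D1 A \<Longrightarrow> S1 A" and D1_S1_not: "D1 A \<Longrightarrow> S1 (\<lambda>e. \<not> A e)"
  by (simp_all add: D1_def)

lemma D0_D1: "D0 A \<Longrightarrow> D1 A"
  by (simp add: D1_def D0_S1 D0_neg)

lemma D1_sub: "D1 (\<lambda>e. A (\<lambda>n. e (Suc n)) (e 0)) \<Longrightarrow> F1 f \<Longrightarrow> D1 (\<lambda>e. A e (f e))"
  unfolding D1_def by (elim conjE, intro conjI, erule (1) S1_sub[where A = A], erule (1) S1_sub[where A = "\<lambda>e x. \<not> A e x"])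

lemma D1_Suc: "D1 A \<Longrightarrow> D1 (\<lambda>e. A (\<lambda>n. e (Suc n)))"
  unfolding D1_def by (elim conjE, intro conjI, erule S1_Suc[where A = A], erule S1_Suc[where A = "\<lambda>e. \<not> A e"])

lemma D1_Suc1: "D1 (\<lambda>e. A (\<lambda>n. e (Suc n)) (e 0)) \<Longrightarrow> D1 (\<lambda>e. A (\<lambda>n. e (Suc (Suc n))) (e 0))"
  unfolding D1_def by (elim conjE, intro conjI, erule S1_Suc1[where A = A], erule S1_Suc1[where A = "\<lambda>e x. \<not> A e x"])

lemma D1_comp1: "D1 (\<lambda>e. r (e 0)) \<Longrightarrow> F1 f \<Longrightarrow> D1 (\<lambda>e. r (f e))"
  unfolding D1_def by (elim conjE, intro conjI, erule (1) S1_comp1[where r = r], erule (1) S1_comp1[where r = "\<lambda>x. \<not> r x"])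

lemma D1_comp2: "D1 (\<lambda>e. r (e 0) (e 1)) \<Longrightarrow> F1 f \<Longrightarrow> F1 g \<Longrightarrow> D1 (\<lambda>e. r (f e) (g e))"
  unfolding D1_def by (elim conjE, intro conjI, erule (2) S1_comp2[where r = r], erule (2) S1_comp2[where r = "\<lambda>x y. \<not> r x y"])

lemma D1_comp3:
  "D1 (\<lambda>e. r (e 0) (e 1) (e 2)) \<Longrightarrow> F1 f \<Longrightarrow> F1 g \<Longrightarrow> F1 h \<Longrightarrow> D1 (\<lambda>e. r (f e) (g e) (h e))"
  unfolding D1_def by (elim conjE, intro conjI, erule (3) S1_comp3[where r = r], erule (3) S1_comp3[where r = "\<lambda>x y z. \<not> r x y z"])

lemma D1_eq: "F1 f \<Longrightarrow> F1 g \<Longrightarrow> D1 (\<lambda>e. f e = g e)"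
  by (rule D1_comp2[where r = "(=)"]) (intro D0_D1 D0_intros)

lemma D1_less: "F1 f \<Longrightarrow> F1 g \<Longrightarrow> D1 (\<lambda>e. f e \<prec> g e)"
  by (rule D1_comp2[where r = "(\<prec>)"]) (intro D0_D1 D0_intros)

lemma D1_mem: "F1 f \<Longrightarrow> X \<in> sets M \<Longrightarrow> D1 (\<lambda>e. f e \<in> X)"
  by (rule D1_comp1[where r = "\<lambda>x. x \<in> X"]) (intro D0_D1 D0_intros)

lemma D1_neg: "D1 A \<Longrightarrow> D1 (\<lambda>e. \<not> A e)"
  by (simp add: D1_def)

lemma D1_conj: "D1 A \<Longrightarrow> D1 B \<Longrightarrow> D1 (\<lambda>e. A e \<and> B e)"
  unfolding D1_def de_Morgan_conj by (elim conjE, intro conjI S1_conj S1_disj)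

lemma D1_disj: "D1 A \<Longrightarrow> D1 B \<Longrightarrow> D1 (\<lambda>e. A e \<or> B e)"
  unfolding D1_def de_Morgan_disj by (elim conjE, intro conjI S1_conj S1_disj)

lemma D1_imp: "D1 A \<Longrightarrow> D1 B \<Longrightarrow> D1 (\<lambda>e. A e \<longrightarrow> B e)"
  unfolding imp_conv_disj by (intro D1_disj D1_neg)

lemma D1_iff: "D1 A \<Longrightarrow> D1 B \<Longrightarrow> D1 (\<lambda>e. A e = B e)"
  unfolding iff_conv_conj_imp by (intro D1_conj D1_imp)

lemma D1_leq: "F1 f \<Longrightarrow> F1 g \<Longrightarrow> D1 (\<lambda>e. f e \<preceq> g e)"
  unfolding leq_def by (intro D1_disj D1_less D1_eq)

lemma D1_ball:
  assumes "F1 t" "D1 (\<lambda>e. A (\<lambda>n. e (Suc n)) (e 0))"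
  shows "D1 (\<lambda>e. \<forall>x. x \<prec> t e \<longrightarrow> A e x)"
proof (rule D1_sub[where A = "\<lambda>e t. \<forall>x. x \<prec> t \<longrightarrow> A e x"])
  have A: "D1 (\<lambda>e. A (\<lambda>n. e (Suc (Suc n))) (e 0))" by (rule D1_Suc1) fact
  have "S1 (\<lambda>e. \<exists>x. x \<prec> e 0 \<and> \<not> A (\<lambda>n. e (Suc n)) x)"
    by (intro S1_ex S1_conj D1_S1_not[OF A] D1_S1[OF D1_less] F1_var)
  moreover have "S1 (\<lambda>e. \<forall>x. x \<prec> e 0 \<longrightarrow> A (\<lambda>n. e (Suc n)) x)"
    by (intro S1_ball_var D1_S1[OF A])
  ultimately show "D1 (\<lambda>e. \<forall>x. x \<prec> e 0 \<longrightarrow> A (\<lambda>n. e (Suc n)) x)" by (simp add: D1_def)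
qed fact

lemma D1_bex: "F1 t \<Longrightarrow> D1 (\<lambda>e. A (\<lambda>n. e (Suc n)) (e 0)) \<Longrightarrow> D1 (\<lambda>e. \<exists>x. x \<prec> t e \<and> A e x)"
  using D1_neg[OF D1_ball[OF _ D1_neg]] by simp

lemma D1_if: "D1 A \<Longrightarrow> D1 B \<Longrightarrow> D1 C \<Longrightarrow> D1 (\<lambda>e. if A e then B e else C e)"
  unfolding if_bool_eq_conj by (intro D1_conj D1_imp D1_neg)

lemma F1_if: "D1 A \<Longrightarrow> F1 f \<Longrightarrow> F1 g \<Longrightarrow> F1 (\<lambda>e. if A e then f e else g e)"
proof (rule F1I)
  assume "D1 A" "F1 f" "F1 g"
  then have "D1 (\<lambda>e. if A (\<lambda>n. e (Suc n)) then e 0 = f (\<lambda>n. e (Suc n)) else e 0 = g (\<lambda>n. e (Suc n)))"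
    by (intro D1_if D1_Suc D1_eq F1_var F1_Suc)
  then show "S1 (\<lambda>e. e 0 = (if A (\<lambda>n. e (Suc n)) then f (\<lambda>n. e (Suc n)) else g (\<lambda>n. e (Suc n))))"
    by (rule back_subst[of S1, OF D1_S1]) auto
qed

text \<open>At a fixed environment only the first argument varies, which is the form that
  comprehension, coding and minimization need.\<close>

lemma D1_fix: "D1 A \<Longrightarrow> D1 (\<lambda>e. A (case_nat (e 0) c))"
proof -
  assume "D1 A"
  have *: "(\<lambda>n. if n \<in> {0} then e (id n) else case_nat undefined c n) = case_nat (e 0) c" for e
    by (auto simp: fun_eq_iff split: nat.splits)
  note S1_subst[OF D1_S1[OF \<open>D1 A\<close>] inj_on_id, of "{0}" "case_nat undefined c"]
    S1_subst[OF D1_S1_not[OF \<open>D1 A\<close>] inj_on_id, of "{0}" "case_nat undefined c"]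
  then show ?thesis unfolding D1_def * by (rule conjI)
qed

lemma D1_set: "D1 (\<lambda>e. P (e 0)) \<Longrightarrow> {n. P n} \<in> sets M"
proof (rule Delta01_comprehension)
  assume P: "D1 (\<lambda>e. P (e 0))"
  show "Sigma01 P" using S1_Sigma01[OF D1_S1[OF P], of undefined] by simp
  have "Sigma01 (\<lambda>n. \<not> P n)" using S1_Sigma01[OF D1_S1_not[OF P], of undefined] by simp
  then show "Pi01 P"
    unfolding Sigma01_def Pi01_def
  proof (elim exE conjE, intro exI conjI)
    fix \<theta> E e assume "range E \<subseteq> sets M" "\<forall>n. \<not> P n \<longleftrightarrow> (\<exists>m. sat E (e(0 := n, 1 := m)) \<theta>)"
    then show "\<forall>n. P n \<longleftrightarrow> (\<forall>m. sat E (e(0 := n, 1 := m)) (Neg \<theta>))" "range E \<subseteq> sets M" by auto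
  qed
qed

lemma S1_induct:
  assumes "S1 (\<lambda>e. P (e 0))" "P \<zero>" "\<And>n. P n \<Longrightarrow> P (n \<oplus> \<one>)"
  shows "P n"
  using Sigma01_induction[of P n] S1_Sigma01[OF assms(1), of undefined] assms(2,3) by simp

lemma D1_induct:
  assumes "D1 (\<lambda>e. P (e 0))" "P \<zero>" "\<And>n. P n \<Longrightarrow> P (n \<oplus> \<one>)"
  shows "P n"
  by (rule S1_induct[OF D1_S1]) fact+

lemma D1_less_induct:
  assumes "D1 (\<lambda>e. P (e 0))" and step: "\<And>n. (\<And>m. m \<prec> n \<Longrightarrow> P m) \<Longrightarrow> P n"
  shows "P n"
proof -
  have "\<forall>m. m \<prec> n \<longrightarrow> P m"
    by (rule D1_induct[where P = "\<lambda>n. \<forall>m. m \<prec> n \<longrightarrow> P m"])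
      (intro D1_ball F1_var D1_comp1[OF assms(1)], auto simp: not_less_zero less_succ intro: step)
  then show ?thesis by (auto intro: step)
qed

lemma D1_least:
  assumes "D1 (\<lambda>e. P (e 0))" "P n"
  obtains m where "P m" "\<And>k. k \<prec> m \<Longrightarrow> \<not> P k"
proof -
  have False if "\<And>m. P m \<Longrightarrow> \<exists>k. k \<prec> m \<and> P k"
    using D1_less_induct[OF D1_neg[OF assms(1)], of n] that assms(2) by blast
  then show thesis using that by blast
qed


section \<open>Coded finite sets\<close>

abbreviation dvds :: "'a \<Rightarrow> 'a \<Rightarrow> bool"  (infix "dvds" 50) where
  "m dvds n \<equiv> dvd.dvd (\<otimes>) m n"

section \<open>The pairing function\<close>

lemma leq_zero: "\<zero> \<preceq> x"
  by (simp add: leq_iff_add zero_add)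

lemma leq_square: "n \<preceq> n \<otimes> n"
proof (rule zero_or_succ[of n])
  fix m assume "n = m \<oplus> \<one>"
  then show ?thesis unfolding leq_iff_add by (simp only: mult_succ) (metis add_commutes)
qed (simp add: mult_zero)

lemma square_succ: "(s \<oplus> \<one>) \<otimes> (s \<oplus> \<one>) = s \<otimes> s \<oplus> s \<oplus> (s \<oplus> \<one>)"
  by (simp only: mult_succ distrib' one_mult)

lemma leq_pair: "i \<preceq> pair i j" "j \<preceq> pair i j"
proof -
  show "i \<preceq> pair i j" unfolding pair_def leq_iff_add by (metis add_commutes)
  have "j \<preceq> i \<oplus> j" unfolding leq_iff_add by (metis add_commutes)
  also have "\<dots> \<preceq> (i \<oplus> j) \<otimes> (i \<oplus> j)" by (rule leq_square)
  also have "\<dots> \<preceq> pair i j" unfolding pair_def leq_iff_add by blast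
  finally show "j \<preceq> pair i j" .
qed

text \<open>For s = i + j the code lies between s^2 and s^2 + s, hence below (s + 1)^2, so it
  determines s. Besides injectivity this provides the descent for recursion on pairs.\<close>

lemma pair_less: "i \<oplus> j \<prec> k \<oplus> l \<Longrightarrow> pair i j \<prec> pair k l"
proof -
  assume *: "i \<oplus> j \<prec> k \<oplus> l"
  let ?s = "i \<oplus> j"
  have "pair i j \<preceq> ?s \<otimes> ?s \<oplus> ?s"
    unfolding pair_def by (rule N.add_left_mono) (auto simp: leq_iff_add)
  also have "\<dots> \<prec> (?s \<oplus> \<one>) \<otimes> (?s \<oplus> \<one>)"
    unfolding less_iff_add square_succ by blast
  also have "\<dots> \<preceq> (k \<oplus> l) \<otimes> (k \<oplus> l)"
    using * by (intro N.mult_mono leq_zero) (simp_all only: succ_leq_iff_less)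
  also have "\<dots> \<preceq> pair k l" unfolding pair_def leq_iff_add by blast
  finally show ?thesis .
qed

lemma pair_inject: "pair i j = pair k l \<longleftrightarrow> i = k \<and> j = l"
proof
  assume *: "pair i j = pair k l"
  have "i \<oplus> j = k \<oplus> l"
    using pair_less[of i j k l] pair_less[of k l i j] * less_total less_irreflexive by metis
  moreover from this have "i = k" using * by (simp add: pair_def add_cancel)
  ultimately show "i = k \<and> j = l" by (simp add: add_cancel)
qed simp

lemma pair_less_left: "i \<prec> k \<Longrightarrow> pair i j \<prec> pair k j"
  by (rule pair_less) simp

lemma pair_less_right: "j \<prec> l \<Longrightarrow> pair i j \<prec> pair i l"
  by (rule pair_less) simp

lemma F1_pair: "F1 f \<Longrightarrow> F1 g \<Longrightarrow> F1 (\<lambda>e. pair (f e) (g e))"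
  unfolding pair_def by (intro F1_add F1_mult)

section \<open>Decidability of divisibility and of coded sets\<close>

lemma dvds_bounded: "d dvds n \<longleftrightarrow> (\<exists>q. q \<prec> n \<oplus> \<one> \<and> n = d \<otimes> q)"
proof
  assume "d dvds n"
  then obtain q where q: "n = d \<otimes> q" unfolding N.dvd_def by blast
  show "\<exists>q. q \<prec> n \<oplus> \<one> \<and> n = d \<otimes> q"
  proof (cases d rule: zero_or_succ)
    case 1
    then show ?thesis using q by (intro exI[of _ \<zero>]) (simp add: zero_mult mult_zero less_succ_iff_leq)
  next
    case (2 c)
    then have "q \<preceq> n" unfolding q leq_iff_add by (simp add: distrib' one_mult) (metis add_commutes)
    then show ?thesis using q by (auto simp: less_succ_iff_leq)
  qed
qed (auto simp: N.dvd_def)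

lemma D1_dvds: "F1 f \<Longrightarrow> F1 g \<Longrightarrow> D1 (\<lambda>e. f e dvds g e)"
  by (rule D1_comp2[where r = "\<lambda>x y. x dvds y"])
    (unfold dvds_bounded, intro D1_bex D1_eq F1_add F1_mult F1_var F1_const)

lemma elts_pair: "elts (pair k (pair m n)) = {i. i \<prec> k \<and> m \<otimes> (i \<oplus> \<one>) \<oplus> \<one> dvds n}"
  unfolding elts_def by (auto simp: pair_inject N.dvd_def)

lemma elts_bounded: "x \<in> elts c \<longleftrightarrow> (\<exists>k. k \<prec> c \<oplus> \<one> \<and> (\<exists>m. m \<prec> c \<oplus> \<one> \<and> (\<exists>n. n \<prec> c \<oplus> \<one> \<and>
    c = pair k (pair m n) \<and> x \<prec> k \<and> m \<otimes> (x \<oplus> \<one>) \<oplus> \<one> dvds n)))"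
proof
  assume "x \<in> elts c"
  then obtain k m n where *: "c = pair k (pair m n)" "x \<prec> k" "m \<otimes> (x \<oplus> \<one>) \<oplus> \<one> dvds n"
    unfolding elts_def N.dvd_def by blast
  have "k \<preceq> c" "m \<preceq> c" "n \<preceq> c"
    unfolding *(1) using leq_pair N.order_trans by metis+
  then show "\<exists>k. k \<prec> c \<oplus> \<one> \<and> (\<exists>m. m \<prec> c \<oplus> \<one> \<and> (\<exists>n. n \<prec> c \<oplus> \<one> \<and>
    c = pair k (pair m n) \<and> x \<prec> k \<and> m \<otimes> (x \<oplus> \<one>) \<oplus> \<one> dvds n))"
    unfolding less_succ_iff_leq using * by blast
qed (auto simp: elts_pair)

lemma D1_elts: "F1 f \<Longrightarrow> F1 g \<Longrightarrow> D1 (\<lambda>e. f e \<in> elts (g e))"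
  by (rule D1_comp2[where r = "\<lambda>x c. x \<in> elts c"])
    (unfold elts_bounded, intro D1_bex D1_conj D1_eq D1_less D1_dvds F1_pair F1_add F1_mult F1_var F1_const)

lemma elts_less: "x \<in> elts c \<Longrightarrow> x \<prec> c"
proof -
  assume "x \<in> elts c"
  then obtain k m n where "c = pair k (pair m n)" "x \<prec> k" unfolding elts_def by blast
  then show ?thesis using leq_pair(1)[of k "pair m n"] by order
qed

lemma elts_eq_bounded:
  "elts c = elts d \<longleftrightarrow> (\<forall>x. x \<prec> c \<longrightarrow> x \<in> elts c \<longrightarrow> x \<in> elts d) \<and> (\<forall>x. x \<prec> d \<longrightarrow> x \<in> elts d \<longrightarrow> x \<in> elts c)"
  using elts_less by blast

lemma D1_elts_eq: "F1 f \<Longrightarrow> F1 g \<Longrightarrow> D1 (\<lambda>e. elts (f e) = elts (g e))"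
  by (rule D1_comp2[where r = "\<lambda>c d. elts c = elts d"])
    (unfold elts_eq_bounded, intro D1_ball D1_conj D1_imp D1_elts F1_var)

lemma D1_ball_elts:
  assumes "F1 c" "D1 (\<lambda>e. A (\<lambda>n. e (Suc n)) (e 0))" shows "D1 (\<lambda>e. \<forall>x\<in>elts (c e). A e x)"
proof -
  have "(\<forall>x\<in>elts (c e). A e x) \<longleftrightarrow> (\<forall>x. x \<prec> c e \<longrightarrow> x \<in> elts (c e) \<longrightarrow> A e x)" for e
    using elts_less by blast
  then show ?thesis
    by (simp only:) (intro D1_ball D1_imp D1_elts assms F1_var F1_Suc[OF assms(1)])
qed

lemma D1_bex_elts:
  assumes "F1 c" "D1 (\<lambda>e. A (\<lambda>n. e (Suc n)) (e 0))" shows "D1 (\<lambda>e. \<exists>x\<in>elts (c e). A e x)"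
  using D1_neg[OF D1_ball_elts[OF assms(1) D1_neg[OF assms(2)]]] by simp

lemma D1_fincode: "F1 f \<Longrightarrow> D1 (\<lambda>e. fincode (f e))"
  by (rule D1_comp1[where r = fincode])
    (unfold fincode_def, intro D1_ball D1_neg D1_elts_eq F1_var)

text \<open>The number \<open>m\<close> stands in for the factorial in Goedel's beta function. Its
  existence is obtained by Sigma_1 induction, since primitive recursion is itself built on this
  coding.\<close>

lemma common_multiple: "\<exists>m. m \<noteq> \<zero> \<and> (\<forall>i. i \<prec> k \<longrightarrow> i \<oplus> \<one> dvds m)"
proof (rule S1_induct[where P = "\<lambda>k. \<exists>m. m \<noteq> \<zero> \<and> (\<forall>i. i \<prec> k \<longrightarrow> i \<oplus> \<one> dvds m)"])
  show "S1 (\<lambda>e. \<exists>m. m \<noteq> \<zero> \<and> (\<forall>i. i \<prec> e 0 \<longrightarrow> i \<oplus> \<one> dvds m))"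
    by (intro S1_ex D1_S1 D1_conj D1_neg D1_eq D1_ball D1_dvds F1_add F1_var F1_const)
next
  fix k assume "\<exists>m. m \<noteq> \<zero> \<and> (\<forall>i. i \<prec> k \<longrightarrow> i \<oplus> \<one> dvds m)"
  then obtain m where "m \<noteq> \<zero>" "\<forall>i. i \<prec> k \<longrightarrow> i \<oplus> \<one> dvds m" by blast
  then show "\<exists>m. m \<noteq> \<zero> \<and> (\<forall>i. i \<prec> k \<oplus> \<one> \<longrightarrow> i \<oplus> \<one> dvds m)"
    by (intro exI[of _ "m \<otimes> (k \<oplus> \<one>)"]) (auto simp: less_succ succ_neq_zero)
qed (auto simp: not_less_zero intro: exI[of _ \<one>])

text \<open>Coprimality without primes or Bezout. With a and b the moduli of i < j, (j + 1) a = (i +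
  1) b + (j - i), so a divides (j - i) n; the other order is symmetric. The difference divides
  \<open>m\<close>, hence a divides m (i + 1) n, and subtracting this from a n leaves n.\<close>

lemma coprime_moduli:
  assumes m: "\<And>i. i \<prec> k \<Longrightarrow> i \<oplus> \<one> dvds m" and ij: "i \<prec> k" "j \<prec> k" "i \<noteq> j"
    and dvd: "m \<otimes> (i \<oplus> \<one>) \<oplus> \<one> dvds n \<otimes> (m \<otimes> (j \<oplus> \<one>) \<oplus> \<one>)"
  shows "m \<otimes> (i \<oplus> \<one>) \<oplus> \<one> dvds n"
proof -
  define a b where "a = m \<otimes> (i \<oplus> \<one>) \<oplus> \<one>" and "b = m \<otimes> (j \<oplus> \<one>) \<oplus> \<one>"
  obtain g where g: "g \<prec> k" "a dvds (g \<oplus> \<one>) \<otimes> n"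
  proof (cases "i \<prec> j")
    case True
    then obtain g where g: "j = i \<oplus> (g \<oplus> \<one>)" unfolding less_iff_add by blast
    have "(x \<oplus> h) \<otimes> (m \<otimes> x \<oplus> \<one>) \<otimes> n = x \<otimes> (n \<otimes> (m \<otimes> (x \<oplus> h) \<oplus> \<one>)) \<oplus> h \<otimes> n" for x h
      by (simp add: algebra_simps)
    from this[of "i \<oplus> \<one>" "g \<oplus> \<one>"]
    have "(j \<oplus> \<one>) \<otimes> a \<otimes> n = (i \<oplus> \<one>) \<otimes> (n \<otimes> b) \<oplus> (g \<oplus> \<one>) \<otimes> n"
      unfolding a_def b_def g by (simp only: add_ac')
    moreover have "a dvds (j \<oplus> \<one>) \<otimes> a \<otimes> n" by simp
    moreover have "a dvds (i \<oplus> \<one>) \<otimes> (n \<otimes> b)" using dvd unfolding a_def b_def by (rule N.dvd_mult)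
    ultimately have "a dvds (g \<oplus> \<one>) \<otimes> n" using N.dvd_add_right_iff by metis
    moreover have "g \<preceq> j" unfolding g leq_iff_add by (metis add_ac')
    ultimately show thesis using that ij(2) by (meson N.le_less_trans)
  next
    case False
    then have "j \<prec> i" using ij(3) less_total by blast
    then obtain g where g: "i = j \<oplus> (g \<oplus> \<one>)" unfolding less_iff_add by blast
    have "(x \<oplus> h) \<otimes> (n \<otimes> (m \<otimes> x \<oplus> \<one>)) = x \<otimes> (m \<otimes> (x \<oplus> h) \<oplus> \<one>) \<otimes> n \<oplus> h \<otimes> n" for x h
      by (simp add: algebra_simps)
    from this[of "j \<oplus> \<one>" "g \<oplus> \<one>"]
    have "(i \<oplus> \<one>) \<otimes> (n \<otimes> b) = (j \<oplus> \<one>) \<otimes> a \<otimes> n \<oplus> (g \<oplus> \<one>) \<otimes> n"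
      unfolding a_def b_def g by (simp only: add_ac')
    moreover have "a dvds (j \<oplus> \<one>) \<otimes> a \<otimes> n" by simp
    moreover have "a dvds (i \<oplus> \<one>) \<otimes> (n \<otimes> b)" using dvd unfolding a_def b_def by (rule N.dvd_mult)
    ultimately have "a dvds (g \<oplus> \<one>) \<otimes> n" using N.dvd_add_right_iff by metis
    moreover have "g \<preceq> i" unfolding g leq_iff_add by (metis add_ac')
    ultimately show thesis using that ij(1) by (meson N.le_less_trans)
  qed
  obtain q where "m = (g \<oplus> \<one>) \<otimes> q" using m[OF g(1)] unfolding N.dvd_def by blast
  then have "m \<otimes> (i \<oplus> \<one>) \<otimes> n = (q \<otimes> (i \<oplus> \<one>)) \<otimes> ((g \<oplus> \<one>) \<otimes> n)" by (simp add: ac_simps)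
  then have "a dvds m \<otimes> (i \<oplus> \<one>) \<otimes> n" using N.dvd_mult[OF g(2)] by metis
  moreover have "a \<otimes> n = m \<otimes> (i \<oplus> \<one>) \<otimes> n \<oplus> n" unfolding a_def by (simp add: distrib' one_mult)
  moreover have "a dvds a \<otimes> n" by simp
  ultimately show ?thesis unfolding a_def[symmetric] using N.dvd_add_right_iff by metis
qed

text \<open>A nonzero \<open>m\<close> makes every modulus exceed one, so the number one can code
  the empty set.\<close>

lemma modulus_not_dvds_one: "m \<noteq> \<zero> \<Longrightarrow>\<not> m \<otimes> (i \<oplus> \<one>) \<oplus> \<one> dvds \<one>" (is "_ \<Longrightarrow> \<not> ?d dvds _")
proof
  assume m: "m \<noteq> \<zero>"
  assume "?d dvds \<one>"
  then obtain q where q: "\<one> = ?d \<otimes> q" unfolding N.dvd_def by blast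
  show False
  proof (cases q rule: zero_or_succ)
    case 1
    have "\<one> = \<zero>" using q unfolding 1 mult_zero .
    then show False by simp
  next
    case (2 r)
    have "\<one> = ?d \<otimes> r \<oplus> ?d" using q unfolding 2 mult_succ[of "?d" r] .
    then have "\<zero> \<oplus> \<one> = ?d \<otimes> r \<oplus> m \<otimes> (i \<oplus> \<one>) \<oplus> \<one>"
      unfolding zero_add add_associates .
    then have "\<zero> = ?d \<otimes> r \<oplus> m \<otimes> (i \<oplus> \<one>)" by (rule succ_inject)
    then have "m \<otimes> (i \<oplus> \<one>) \<preceq> \<zero>" by (metis leq_iff_add add_commutes)
    then have "m \<otimes> (i \<oplus> \<one>) = \<zero>" unfolding leq_def using not_less_zero by blast
    then show False using m N.no_zero_divisors succ_neq_zero by blast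
  qed
qed

text \<open>Starting from one, the modulus of each \<open>l\<close> satisfying \<open>A\<close> is
  multiplied in. Coprimality keeps the status of all other places below \<open>k\<close> unchanged;
  \<open>k\<close> and \<open>m\<close> stay fixed during the induction on \<open>l\<close>.\<close>

lemma finite_coding:
  assumes A: "D1 (\<lambda>e. A (e 0))"
  obtains c where "elts c = {i. i \<prec> k \<and> A i}"
proof -
  obtain m where m: "m \<noteq> \<zero>" "\<And>i. i \<prec> k \<Longrightarrow> i \<oplus> \<one> dvds m" using common_multiple by blast
  let ?d = "\<lambda>i. m \<otimes> (i \<oplus> \<one>) \<oplus> \<one>"
  have "\<exists>n. \<forall>i. i \<prec> k \<longrightarrow> (?d i dvds n \<longleftrightarrow> i \<prec> l \<and> A i)" if "l \<preceq> k" for l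
  proof -
    have "l \<preceq> k \<longrightarrow> (\<exists>n. \<forall>i. i \<prec> k \<longrightarrow> (?d i dvds n \<longleftrightarrow> i \<prec> l \<and> A i))"
    proof (rule S1_induct[where P = "\<lambda>l. l \<preceq> k \<longrightarrow> (\<exists>n. \<forall>i. i \<prec> k \<longrightarrow> (?d i dvds n \<longleftrightarrow> i \<prec> l \<and> A i))"])
      show "S1 (\<lambda>e. e 0 \<preceq> k \<longrightarrow> (\<exists>n. \<forall>i. i \<prec> k \<longrightarrow> (?d i dvds n \<longleftrightarrow> i \<prec> e 0 \<and> A i)))"
        unfolding imp_conv_disj[of "_ \<preceq> _"]
        by (intro S1_disj S1_ex D1_S1 D1_neg D1_leq D1_iff D1_conj D1_ball D1_dvds D1_less
            D1_comp1[OF A] F1_add F1_mult F1_var F1_const)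
    next
      have "\<not> ?d i dvds \<one>" for i by (rule modulus_not_dvds_one[OF m(1)])
      then show "\<zero> \<preceq> k \<longrightarrow> (\<exists>n. \<forall>i. i \<prec> k \<longrightarrow> (?d i dvds n \<longleftrightarrow> i \<prec> \<zero> \<and> A i))"
        by (intro impI exI[of _ \<one>]) (simp add: not_less_zero)
    next
      fix l assume IH: "l \<preceq> k \<longrightarrow> (\<exists>n. \<forall>i. i \<prec> k \<longrightarrow> (?d i dvds n \<longleftrightarrow> i \<prec> l \<and> A i))"
      show "l \<oplus> \<one> \<preceq> k \<longrightarrow> (\<exists>n. \<forall>i. i \<prec> k \<longrightarrow> (?d i dvds n \<longleftrightarrow> i \<prec> l \<oplus> \<one> \<and> A i))"
      proof
        assume "l \<oplus> \<one> \<preceq> k"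
        then have l: "l \<prec> k" by (simp add: succ_leq_iff_less)
        then obtain n where n: "\<And>i. i \<prec> k \<Longrightarrow> (?d i dvds n \<longleftrightarrow> i \<prec> l \<and> A i)"
          using IH by (auto simp: leq_def)
        show "\<exists>n. \<forall>i. i \<prec> k \<longrightarrow> (?d i dvds n \<longleftrightarrow> i \<prec> l \<oplus> \<one> \<and> A i)"
        proof (cases "A l")
          case True
          have "?d i dvds n \<otimes> ?d l \<longleftrightarrow> i \<prec> l \<oplus> \<one> \<and> A i" if i: "i \<prec> k" for i
          proof (cases "i = l")
            case False
            have "?d i dvds n \<otimes> ?d l \<longleftrightarrow> ?d i dvds n"
              using coprime_moduli[OF m(2) i l False] N.dvd_mult2[of "?d i" n "?d l"] by blast
            also have "\<dots> \<longleftrightarrow> i \<prec> l \<oplus> \<one> \<and> A i" unfolding n[OF i] less_succ using False by blast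
            finally show ?thesis .
          next
            case True
            then show ?thesis using \<open>A l\<close> by (simp add: less_succ)
          qed
          then show ?thesis by (intro exI[of _ "n \<otimes> ?d l"] allI impI)
        next
          case False
          have "?d i dvds n \<longleftrightarrow> i \<prec> l \<oplus> \<one> \<and> A i" if "i \<prec> k" for i
            unfolding n[OF that] less_succ using False by blast
          then show ?thesis by (intro exI[of _ n] allI impI)
        qed
      qed
    qed
    then show ?thesis using that by blast
  qed
  from this[of k] obtain n where "\<forall>i. i \<prec> k \<longrightarrow> (?d i dvds n \<longleftrightarrow> i \<prec> k \<and> A i)" by auto
  then have "elts (pair k (pair m n)) = {i. i \<prec> k \<and> A i}" unfolding elts_pair by blast
  then show thesis by (rule that)
qed


section \<open>Least codes\<close>

definition coded :: "'a set \<Rightarrow> bool" where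
  "coded A \<longleftrightarrow> (\<exists>c. elts c = A)"

definition cd :: "'a set \<Rightarrow> 'a" where
  "cd A = (THE c. fincode c \<and> elts c = A)"

lemma cd_unique: "fincode c \<Longrightarrow> cd (elts c) = c"
  unfolding cd_def fincode_def by (rule the_equality, blast) (metis less_total)

lemma coded_cd:
  assumes "coded A" shows "fincode (cd A)" "elts (cd A) = A"
proof -
  obtain c where "elts c = A" using assms unfolding coded_def by blast
  then obtain d where "elts d = A" "\<And>k. k \<prec> d \<Longrightarrow> \<not> elts k = A"
    using D1_least[of "\<lambda>c. elts c = A" c] D1_elts_eq[OF F1_var F1_const, of 0 c] by metis
  then have d: "fincode d" "elts d = A" unfolding fincode_def by auto
  then have "cd A = d" using cd_unique by blast
  then show "fincode (cd A)" "elts (cd A) = A" using d by auto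
qed

lemma cd_eq_iff: "coded A \<Longrightarrow> z = cd A \<longleftrightarrow> fincode z \<and> elts z = A"
  using coded_cd cd_unique by metis

lemma coded_Collect: "D1 (\<lambda>e. A (e 0)) \<Longrightarrow> coded {i. i \<prec> k \<and> A i}"
  unfolding coded_def by (rule finite_coding[of A k]) auto

lemma coded_subset: "X \<in> sets M \<Longrightarrow> A = {i. i \<prec> k \<and> i \<in> X} \<Longrightarrow> coded A"
  using coded_Collect[of "\<lambda>i. i \<in> X" k] D1_mem[OF F1_var] by simp

text \<open>Once the set is known to be coded, the description by \<open>THE\<close> can be replaced
  in the graph by "a least code with these elements", where all quantifiers are bounded.\<close>

lemma F1_cd:
  assumes f: "F1 f" and A: "D1 (\<lambda>e. A (\<lambda>n. e (Suc n)) (e 0))"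
  shows "F1 (\<lambda>e. cd {i. i \<prec> f e \<and> A e i})"
proof (rule F1I, rule D1_S1)
  have "coded {i. i \<prec> f e \<and> A e i}" for e
    using coded_Collect[of "A e" "f e"] D1_fix[OF A, of e] by simp
  then have *: "z = cd {i. i \<prec> f e \<and> A e i} \<longleftrightarrow> fincode z \<and>
     (\<forall>x\<in>elts z. x \<prec> f e \<and> A e x) \<and> (\<forall>x. x \<prec> f e \<longrightarrow> A e x \<longrightarrow> x \<in> elts z)" for e z
    unfolding cd_eq_iff[OF \<open>coded {i. i \<prec> f e \<and> A e i}\<close>] by blast
  note fS = F1_Suc[OF f]
  show "D1 (\<lambda>e. e 0 = cd {i. i \<prec> f (\<lambda>n. e (Suc n)) \<and> A (\<lambda>n. e (Suc n)) i})"
    unfolding * by (intro D1_conj D1_fincode D1_ball_elts D1_ball D1_imp D1_less D1_elts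
        D1_Suc1[of A, OF A] fS F1_Suc[OF fS] F1_var)
qed

section \<open>Minimization and primitive recursion\<close>

text \<open>Seen from outside, the order of the model need not be well-founded, so minimality is
  spelled out; a least element is guaranteed for Delta_1 predicates by \<open>D1_least\<close>. The
  default zero makes the search total.\<close>

definition bmu :: "'a \<Rightarrow> ('a \<Rightarrow> bool) \<Rightarrow> 'a" where
  "bmu b P = (if \<exists>x. x \<prec> b \<and> P x \<and> (\<forall>y. y \<prec> x \<longrightarrow> \<not> P y)
    then THE x. P x \<and> (\<forall>y. y \<prec> x \<longrightarrow> \<not> P y) else \<zero>)"

lemma least_unique: "P x \<Longrightarrow> (\<forall>y. y \<prec> x \<longrightarrow> \<not> P y) \<Longrightarrow> (THE x. P x \<and> (\<forall>y. y \<prec> x \<longrightarrow> \<not> P y)) = x"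
  by (rule the_equality, blast) (metis less_total)

lemma bmu_iff:
  assumes "D1 (\<lambda>e. P (e 0))"
  shows "z = bmu b P \<longleftrightarrow> (z \<prec> b \<and> P z \<and> (\<forall>y. y \<prec> z \<longrightarrow> \<not> P y)) \<or> (z = \<zero> \<and> (\<forall>y. y \<prec> b \<longrightarrow> \<not> P y))"
proof (cases "\<exists>x. x \<prec> b \<and> P x")
  case True
  then obtain x where x: "x \<prec> b" "P x" by blast
  obtain m where m: "P m" "\<And>k. k \<prec> m \<Longrightarrow> \<not> P k" using D1_least[OF assms x(2)] by blast
  have mb: "m \<prec> b" using m(2)[of x] x less_total less_transitive by blast
  then have "bmu b P = m" unfolding bmu_def using m least_unique[of P m] by auto
  then show ?thesis using m mb x less_total by blast
next
  case False
  then show ?thesis unfolding bmu_def by auto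
qed

lemma bmu:
  assumes "D1 (\<lambda>e. P (e 0))" "x \<prec> b" "P x"
  shows "P (bmu b P)" "bmu b P \<prec> b" "bmu b P \<preceq> x"
  using bmu_iff[OF assms(1), of "bmu b P" b] assms(2,3) N.not_le by blast+

lemma F1_bmu:
  assumes f: "F1 f" and A: "D1 (\<lambda>e. A (\<lambda>n. e (Suc n)) (e 0))"
  shows "F1 (\<lambda>e. bmu (f e) (\<lambda>x. A e x))"
proof (rule F1I, rule D1_S1)
  have *: "D1 (\<lambda>e'. A e (e' 0))" for e using D1_fix[OF A, of e] by simp
  have A0: "D1 (\<lambda>e. A (\<lambda>n. e (Suc n)) (e 0))" by (rule A)
  note fS = F1_Suc[OF f]
  show "D1 (\<lambda>e. e 0 = bmu (f (\<lambda>n. e (Suc n))) (A (\<lambda>n. e (Suc n))))"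
    unfolding bmu_iff[OF *] by (intro D1_conj D1_disj D1_ball D1_neg D1_less D1_eq A0
        D1_Suc1[of A, OF A] fS F1_var F1_const)
qed

definition mu :: "('a \<Rightarrow> bool) \<Rightarrow> 'a" where
  "mu P = (THE x. P x \<and> (\<forall>y. y \<prec> x \<longrightarrow> \<not> P y))"

lemma mu:
  assumes "D1 (\<lambda>e. P (e 0))" "\<exists>x. P x"
  shows "P (mu P)" "P y \<Longrightarrow> mu P \<preceq> y" "z = mu P \<longleftrightarrow> P z \<and> (\<forall>y. y \<prec> z \<longrightarrow> \<not> P y)"
proof -
  obtain x where "P x" using assms(2) by blast
  then obtain m where m: "P m" "\<And>k. k \<prec> m \<Longrightarrow> \<not> P k" using D1_least[OF assms(1)] by blast
  then have eq: "mu P = m" unfolding mu_def using least_unique[of P m] by blast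
  show "P (mu P)" using eq m by simp
  show "P y \<Longrightarrow> mu P \<preceq> y" using eq m N.not_less by blast
  show "z = mu P \<longleftrightarrow> P z \<and> (\<forall>y. y \<prec> z \<longrightarrow> \<not> P y)" unfolding eq using m less_total by blast
qed

lemma F1_mu:
  assumes A: "D1 (\<lambda>e. A (\<lambda>n. e (Suc n)) (e 0))" and ex: "\<And>e. \<exists>x. A e x"
  shows "F1 (\<lambda>e. mu (\<lambda>x. A e x))"
proof (rule F1I, rule D1_S1)
  have *: "D1 (\<lambda>e'. A e (e' 0))" for e using D1_fix[OF A, of e] by simp
  show "D1 (\<lambda>e. e 0 = mu (A (\<lambda>n. e (Suc n))))"
    unfolding mu(3)[OF * ex] by (intro D1_conj D1_ball D1_neg A D1_Suc1[of A, OF A] F1_var)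
qed

lemma F1_bounded:
  assumes "F1 (\<lambda>e. f (e 0))"
  obtains b where "\<And>i. i \<prec> n \<Longrightarrow> f i \<prec> b"
proof -
  have "\<exists>b. \<forall>i. i \<prec> n \<longrightarrow> f i \<prec> b"
  proof (rule S1_induct[where P = "\<lambda>n. \<exists>b. \<forall>i. i \<prec> n \<longrightarrow> f i \<prec> b"])
    show "S1 (\<lambda>e. \<exists>b. \<forall>i. i \<prec> e 0 \<longrightarrow> f i \<prec> b)"
      by (intro S1_ex D1_S1 D1_ball D1_less F1_comp1[OF assms] F1_var)
  next
    fix n assume "\<exists>b. \<forall>i. i \<prec> n \<longrightarrow> f i \<prec> b"
    then obtain b where b: "\<forall>i. i \<prec> n \<longrightarrow> f i \<prec> b" by blast
    have "f i \<prec> b \<oplus> f n \<oplus> \<one>" if "i \<prec> n \<oplus> \<one>" for i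
    proof (cases "i = n")
      case True
      then show ?thesis using less_sum2 by blast
    next
      case False
      then have "f i \<prec> b" using that b unfolding less_succ by blast
      then show ?thesis using less_sum1[of b "f n"] by order
    qed
    then show "\<exists>b. \<forall>i. i \<prec> n \<oplus> \<one> \<longrightarrow> f i \<prec> b" by blast
  qed (simp add: not_less_zero)
  then show thesis using that by blast
qed

text \<open>Finite functions are coded as finite sets of pairs; \<open>\<zero>\<close> is the junk value outside the domain.\<close>

definition app :: "'a \<Rightarrow> 'a \<Rightarrow> 'a" where
  "app c i = bmu c (\<lambda>v. pair i v \<in> elts c)"

lemma F1_app: "F1 f \<Longrightarrow> F1 g \<Longrightarrow> F1 (\<lambda>e. app (f e) (g e))"
  by (rule F1_comp2[where k = app])
    (unfold app_def, intro F1_bmu D1_elts F1_pair F1_var)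

lemma app_eq:
  assumes "pair i v \<in> elts c" "\<And>w. pair i w \<in> elts c \<Longrightarrow> w = v"
  shows "app c i = v"
proof -
  have "v \<prec> c" using elts_less[OF assms(1)] leq_pair(2)[of v i] by order
  then show ?thesis unfolding app_def
    using bmu(1)[of "\<lambda>v. pair i v \<in> elts c" v c] assms D1_elts[OF F1_pair[OF F1_const F1_var] F1_const, of i 0 c]
    by blast
qed

lemma function_code:
  assumes f: "F1 (\<lambda>e. f (e 0))"
  obtains c where "\<And>i. i \<prec> n \<Longrightarrow> app c i = f i"
proof -
  obtain b where b: "\<And>i. i \<prec> n \<Longrightarrow> pair i (f i) \<prec> b"
    by (rule F1_bounded[of "\<lambda>i. pair i (f i)" n]) (intro F1_pair f F1_var, rule that)
  have "D1 (\<lambda>e. \<exists>i. i \<prec> n \<and> e 0 = pair i (f i))"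
    by (intro D1_bex D1_eq F1_pair F1_comp1[OF f] F1_var F1_const)
  then obtain c where c: "elts c = {z. z \<prec> b \<and> (\<exists>i. i \<prec> n \<and> z = pair i (f i))}"
    by (rule finite_coding[of "\<lambda>z. \<exists>i. i \<prec> n \<and> z = pair i (f i)" b]) (rule that)
  show thesis
  proof (rule that)
    fix i assume "i \<prec> n"
    then show "app c i = f i" by (intro app_eq) (auto simp: c b pair_inject)
  qed
qed

section \<open>Primitive recursion\<close>

definition computes :: "'a \<Rightarrow> 'a \<Rightarrow> ('a \<Rightarrow> 'a \<Rightarrow> 'a) \<Rightarrow> 'a \<Rightarrow> bool" where
  "computes c a G n \<longleftrightarrow> app c \<zero> = a \<and> (\<forall>i. i \<prec> n \<longrightarrow> app c (i \<oplus> \<one>) = G i (app c i))"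

definition prec :: "'a \<Rightarrow> ('a \<Rightarrow> 'a \<Rightarrow> 'a) \<Rightarrow> 'a \<Rightarrow> 'a" where
  "prec a G n = (THE v. \<exists>c. computes c a G n \<and> app c n = v)"

lemma computes_unique:
  assumes "computes c a G n" "computes d a G n"
  shows "i \<preceq> n \<Longrightarrow> app c i = app d i"
proof -
  have "i \<preceq> n \<longrightarrow> app c i = app d i"
  proof (rule D1_induct[where P = "\<lambda>i. i \<preceq> n \<longrightarrow> app c i = app d i"])
    show "D1 (\<lambda>e. e 0 \<preceq> n \<longrightarrow> app c (e 0) = app d (e 0))"
      by (intro D1_imp D1_leq D1_eq F1_app F1_var F1_const)
  qed (use assms in \<open>simp_all add: computes_def succ_leq_iff_less N.less_imp_le\<close>)
  then show "i \<preceq> n \<Longrightarrow> app c i = app d i" by blast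
qed

text \<open>Sigma_1 induction on the length: the values computed so far and one new value form a
  definable finite function, which is coded afresh.\<close>

lemma computes_exists:
  assumes G: "F1 (\<lambda>e. G (e 0) (e 1))"
  shows "\<exists>c. computes c a G n"
proof (rule S1_induct[where P = "\<lambda>n. \<exists>c. computes c a G n"])
  show "S1 (\<lambda>e. \<exists>c. computes c a G (e 0))"
    unfolding computes_def
    by (intro S1_ex D1_S1 D1_conj D1_ball D1_eq F1_comp2[OF G] F1_app F1_add F1_var F1_const)
  obtain c where "\<And>i. i \<prec> \<one> \<Longrightarrow> app c i = a"
    by (rule function_code[of "\<lambda>_. a" \<one>]) (rule F1_const, rule that)
  then have "app c \<zero> = a" by simp
  then show "\<exists>c. computes c a G \<zero>" by (auto simp: computes_def not_less_zero)
next
  fix n assume "\<exists>c. computes c a G n"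
  then obtain c where c: "computes c a G n" by blast
  let ?f = "\<lambda>i. if i \<preceq> n then app c i else G n (app c n)"
  have "F1 (\<lambda>e. ?f (e 0))" by (intro F1_if D1_leq F1_app F1_var F1_const)
  \<comment> \<open>The extended computation has the n + 2 places from zero to
    \<open>n \<oplus> \<one>\<close>.\<close>
  then obtain d where d: "\<And>i. i \<prec> n \<oplus> \<one> \<oplus> \<one> \<Longrightarrow> app d i = ?f i"
    by (rule function_code[of ?f "n \<oplus> \<one> \<oplus> \<one>"]) (rule that)
  have "app d (i \<oplus> \<one>) = G i (app d i)" if "i \<prec> n \<oplus> \<one>" for i
  proof -
    have "i \<preceq> n" using that by (simp only: less_succ_iff_leq)
    then have "app d i = app c i" using d[of i] that unfolding less_succ by auto
    moreover have "app d (i \<oplus> \<one>) = ?f (i \<oplus> \<one>)"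
      using that by (intro d) (simp only: less_succ_iff_leq succ_leq_iff_less)
    moreover have "?f (i \<oplus> \<one>) = G i (app c i)"
      using c that unfolding computes_def less_succ succ_leq_iff_less
      by (cases "i = n") (auto simp: less_irreflexive)
    ultimately show ?thesis by simp
  qed
  moreover have "app d \<zero> = a"
    using d[of \<zero>] c leq_zero unfolding less_succ_iff_leq computes_def by auto
  ultimately show "\<exists>c. computes c a G (n \<oplus> \<one>)" unfolding computes_def by blast
qed

text \<open>Codes of computations are not unique, but they agree on the values up to n. So "some
  computation ends in v" describes the value, and this is Sigma_1.\<close>

lemma prec_iff:
  assumes G: "F1 (\<lambda>e. G (e 0) (e 1))"
  shows "v = prec a G n \<longleftrightarrow> (\<exists>c. computes c a G n \<and> app c n = v)"
proof -
  obtain c where c: "computes c a G n" using computes_exists[OF G] by blast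
  have *: "(\<exists>c. computes c a G n \<and> app c n = v) \<longleftrightarrow> v = app c n" for v
    using computes_unique[OF _ c N.order_refl] c by blast
  show ?thesis unfolding prec_def * by simp
qed

lemma prec_simps:
  assumes G: "F1 (\<lambda>e. G (e 0) (e 1))"
  shows "prec a G \<zero> = a" "prec a G (n \<oplus> \<one>) = G n (prec a G n)"
proof -
  obtain c where c: "computes c a G (n \<oplus> \<one>)" using computes_exists[OF G] by blast
  then have "computes c a G n" "computes c a G \<zero>"
    unfolding computes_def less_succ by (auto simp: not_less_zero)
  then have "app c n = prec a G n" "app c \<zero> = prec a G \<zero>" "app c (n \<oplus> \<one>) = prec a G (n \<oplus> \<one>)"
    using c prec_iff[OF G] by blast+
  then show "prec a G \<zero> = a" "prec a G (n \<oplus> \<one>) = G n (prec a G n)"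
    using c unfolding computes_def less_succ by auto
qed

lemma F1_prec:
  assumes a: "F1 (\<lambda>e. a (e 0))" and G: "F1 (\<lambda>e. G (e 0) (e 1) (e 2))"
  shows "F1 (\<lambda>e. prec (a (e 0)) (G (e 0)) (e 1))"
proof (rule F1I)
  have G': "F1 (\<lambda>e. G p (e 0) (e 1))" for p by (rule F1_comp3[OF G F1_const F1_var F1_var])
  show "S1 (\<lambda>e. e 0 = prec (a (e (Suc 0))) (G (e (Suc 0))) (e (Suc 1)))"
    unfolding prec_iff[OF G'] computes_def
    by (intro S1_ex D1_S1 D1_conj D1_ball D1_eq F1_comp1[OF a] F1_comp3[OF G] F1_app F1_add F1_var F1_const)
qed


section \<open>The terms of \<open>H\<^sub>f(Q)\<close> and their quasi order\<close>

definition approx :: "('a \<Rightarrow> 'a \<Rightarrow> bool) \<Rightarrow> 'a \<Rightarrow> 'a \<Rightarrow> bool" where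
  "approx \<Phi> c x \<longleftrightarrow> (\<forall>y. y \<prec> x \<longrightarrow> (y \<in> elts c \<longleftrightarrow> \<Phi> y (cd {z. z \<prec> y \<and> z \<in> elts c})))"

lemma D1_approx:
  assumes "D1 (\<lambda>e. \<Phi> (e 0) (e 1))" "F1 f" "F1 g" shows "D1 (\<lambda>e. approx \<Phi> (f e) (g e))"
  by (rule D1_comp2[where r = "approx \<Phi>", OF _ assms(2,3)])
    (unfold approx_def, intro D1_ball D1_iff D1_elts D1_comp2[OF assms(1)] F1_cd F1_var)

lemma approx_unique:
  assumes \<Phi>: "D1 (\<lambda>e. \<Phi> (e 0) (e 1))" and "approx \<Phi> c x" "approx \<Phi> d x'"
  shows "y \<prec> x \<Longrightarrow> y \<prec> x' \<Longrightarrow> y \<in> elts c \<longleftrightarrow> y \<in> elts d"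
proof -
  have "y \<prec> x \<longrightarrow> y \<prec> x' \<longrightarrow> (y \<in> elts c \<longleftrightarrow> y \<in> elts d)"
  proof (rule D1_less_induct[where P = "\<lambda>y. y \<prec> x \<longrightarrow> y \<prec> x' \<longrightarrow> (y \<in> elts c \<longleftrightarrow> y \<in> elts d)"])
    show "D1 (\<lambda>e. e 0 \<prec> x \<longrightarrow> e 0 \<prec> x' \<longrightarrow> (e 0 \<in> elts c \<longleftrightarrow> e 0 \<in> elts d))"
      by (intro D1_imp D1_iff D1_less D1_elts F1_var F1_const)
    fix y assume "\<And>z. z \<prec> y \<Longrightarrow> z \<prec> x \<longrightarrow> z \<prec> x' \<longrightarrow> (z \<in> elts c \<longleftrightarrow> z \<in> elts d)"
    then have "{z. z \<prec> y \<and> z \<in> elts c} = {z. z \<prec> y \<and> z \<in> elts d}" if "y \<prec> x" "y \<prec> x'"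
      using that less_transitive by blast
    then show "y \<prec> x \<longrightarrow> y \<prec> x' \<longrightarrow> (y \<in> elts c \<longleftrightarrow> y \<in> elts d)"
      using assms(2,3) unfolding approx_def by simp
  qed
  then show "y \<prec> x \<Longrightarrow> y \<prec> x' \<Longrightarrow> y \<in> elts c \<longleftrightarrow> y \<in> elts d" by blast
qed

lemma approx_exists:
  assumes \<Phi>: "D1 (\<lambda>e. \<Phi> (e 0) (e 1))"
  shows "\<exists>c. approx \<Phi> c x"
proof (rule S1_induct[where P = "\<lambda>x. \<exists>c. approx \<Phi> c x"])
  show "S1 (\<lambda>e. \<exists>c. approx \<Phi> c (e 0))"
    by (intro S1_ex D1_S1 D1_approx[OF \<Phi>] F1_var)
  fix n assume "\<exists>c. approx \<Phi> c n"
  then obtain c where c: "approx \<Phi> c n" by blast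
  let ?A = "\<lambda>z. if z = n then \<Phi> n (cd {z. z \<prec> n \<and> z \<in> elts c}) else z \<in> elts c"
  have "D1 (\<lambda>e. ?A (e 0))"
    by (intro D1_if D1_eq D1_elts D1_comp2[OF \<Phi>] F1_var F1_const)
  then obtain d where d: "elts d = {z. z \<prec> n \<oplus> \<one> \<and> ?A z}"
    by (rule finite_coding[of ?A "n \<oplus> \<one>"]) (rule that)
  have "y \<in> elts d \<longleftrightarrow> \<Phi> y (cd {z. z \<prec> y \<and> z \<in> elts d})" if y: "y \<prec> n \<oplus> \<one>" for y
  proof -
    have "z \<in> elts d \<longleftrightarrow> z \<in> elts c" if "z \<prec> y" for z
      using that y unfolding d less_succ using less_transitive less_irreflexive by auto
    then have *: "{z. z \<prec> y \<and> z \<in> elts d} = {z. z \<prec> y \<and> z \<in> elts c}" by blast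
    show ?thesis
    proof (cases "y = n")
      case True
      then show ?thesis unfolding * by (simp add: d less_succ)
    next
      case False
      then have "y \<prec> n" using y unfolding less_succ by blast
      then have "y \<in> elts c \<longleftrightarrow> \<Phi> y (cd {z. z \<prec> y \<and> z \<in> elts c})"
        using c unfolding approx_def by blast
      then show ?thesis unfolding * using False y by (simp add: d)
    qed
  qed
  then show "\<exists>c. approx \<Phi> c (n \<oplus> \<one>)" unfolding approx_def by blast
qed (simp add: approx_def not_less_zero)

text \<open>Coded approximations to the solution exist at all lengths and agree where they overlap,
  so their union is a Delta_1 solution. \<open>\<Phi>\<close> decides \<open>x\<close> from the code
  of the part of the solution below \<open>x\<close>.\<close>

lemma set_recursion:
  assumes \<Phi>: "D1 (\<lambda>e. \<Phi> (e 0) (e 1))"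
  obtains H where "H \<in> sets M" "\<And>x. coded {z. z \<prec> x \<and> z \<in> H}"
    "\<And>x. x \<in> H \<longleftrightarrow> \<Phi> x (cd {z. z \<prec> x \<and> z \<in> H})"
proof -
  define H where "H = {x. \<exists>c. approx \<Phi> c (x \<oplus> \<one>) \<and> x \<in> elts c}"
  have mem: "y \<in> H \<longleftrightarrow> y \<in> elts c" if "approx \<Phi> c x" "y \<prec> x" for x y c
    using approx_unique[OF \<Phi> that(1), of _ "y \<oplus> \<one>" y] approx_exists[OF \<Phi>, of "y \<oplus> \<one>"] that(2)
    unfolding H_def less_succ by blast
  \<comment> \<open>Being left out by some approximation is the same as being left out by all of
    them; this makes the complement of \<open>H\<close> Sigma_1.\<close>
  have not: "(\<nexists>c. approx \<Phi> c (x \<oplus> \<one>) \<and> x \<in> elts c) \<longleftrightarrow> (\<exists>c. approx \<Phi> c (x \<oplus> \<one>) \<and> x \<notin> elts c)" for x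
    using approx_unique[OF \<Phi>, of _ "x \<oplus> \<one>" _ "x \<oplus> \<one>" x] approx_exists[OF \<Phi>, of "x \<oplus> \<one>"]
    unfolding less_succ by blast
  have H: "H \<in> sets M"
    unfolding H_def
  proof (rule D1_set, unfold D1_def not, intro conjI)
    show "S1 (\<lambda>e. \<exists>c. approx \<Phi> c (e 0 \<oplus> \<one>) \<and> e 0 \<in> elts c)"
      by (intro S1_ex D1_S1 D1_conj D1_approx[OF \<Phi>] D1_elts F1_add F1_var F1_const)
    show "S1 (\<lambda>e. \<exists>c. approx \<Phi> c (e 0 \<oplus> \<one>) \<and> e 0 \<notin> elts c)"
      by (intro S1_ex D1_S1 D1_conj D1_neg D1_approx[OF \<Phi>] D1_elts F1_add F1_var F1_const)
  qed
  show thesis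
  proof (rule that[OF H])
    show "coded {z. z \<prec> x \<and> z \<in> H}" for x by (rule coded_subset[OF H refl])
    fix x
    obtain c where c: "approx \<Phi> c (x \<oplus> \<one>)" using approx_exists[OF \<Phi>] by blast
    have "z \<in> H \<longleftrightarrow> z \<in> elts c" if "z \<preceq> x" for z
      using that by (intro mem[OF c]) (simp only: less_succ_iff_leq)
    then have "{z. z \<prec> x \<and> z \<in> H} = {z. z \<prec> x \<and> z \<in> elts c}" "x \<in> H \<longleftrightarrow> x \<in> elts c"
      by (auto simp: leq_def)
    then show "x \<in> H \<longleftrightarrow> \<Phi> x (cd {z. z \<prec> x \<and> z \<in> H})"
      using c unfolding approx_def less_succ by simp
  qed
qed

section \<open>Existence of the terms and of their order\<close>

lemma ur_inject: "ur p = ur q \<longleftrightarrow> p = q" and st_inject: "st a = st b \<longleftrightarrow> a = b"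
  and ur_neq_st: "ur p \<noteq> st a" "st a \<noteq> ur p"
  by (simp_all add: ur_def st_def pair_inject)

lemma leq_ur: "q \<preceq> ur q" and leq_st: "a \<preceq> st a"
  by (simp_all only: ur_def st_def leq_pair)

lemma elts_less_st: "y \<in> elts a \<Longrightarrow> y \<prec> st a"
  using elts_less leq_st N.less_le_trans by blast

lemma F1_ur: "F1 f \<Longrightarrow> F1 (\<lambda>e. ur (f e))" and F1_st: "F1 f \<Longrightarrow> F1 (\<lambda>e. st (f e))"
  unfolding ur_def st_def by (intro F1_pair F1_const, assumption)+

text \<open>Whether \<open>st a\<close> is a term depends only on the elements of \<open>a\<close>,
  whose codes are smaller, so the clause is a course-of-values recursion; the bounds on
  \<open>q\<close> and \<open>a\<close> make it Delta_1.\<close>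

lemma terms_exist:
  assumes Q: "Q \<in> sets M"
  obtains H where "H \<in> sets M"
    "\<And>x. x \<in> H \<longleftrightarrow> (\<exists>q\<in>Q. x = ur q) \<or> (\<exists>a. fincode a \<and> elts a \<subseteq> H \<and> x = st a)"
proof -
  let ?\<Phi> = "\<lambda>x c. (\<exists>q. q \<prec> x \<oplus> \<one> \<and> q \<in> Q \<and> x = ur q) \<or>
    (\<exists>a. a \<prec> x \<oplus> \<one> \<and> fincode a \<and> (\<forall>y\<in>elts a. y \<in> elts c) \<and> x = st a)"
  have "D1 (\<lambda>e. ?\<Phi> (e 0) (e 1))"
    by (intro D1_disj D1_bex D1_conj D1_mem Q D1_eq D1_fincode D1_ball_elts D1_elts
        F1_ur F1_st F1_add F1_var F1_const)
  then obtain H where H: "H \<in> sets M" "\<And>x. coded {z. z \<prec> x \<and> z \<in> H}"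
    "\<And>x. x \<in> H \<longleftrightarrow> ?\<Phi> x (cd {z. z \<prec> x \<and> z \<in> H})"
    by (rule set_recursion[of ?\<Phi>]) (rule that)
  show thesis
  proof (rule that[OF H(1)])
    fix x
    have "x \<in> H \<longleftrightarrow> (\<exists>q. q \<prec> x \<oplus> \<one> \<and> q \<in> Q \<and> x = ur q) \<or>
      (\<exists>a. a \<prec> x \<oplus> \<one> \<and> fincode a \<and> (\<forall>y\<in>elts a. y \<prec> x \<and> y \<in> H) \<and> x = st a)"
      unfolding H(3)[of x] by (simp only: coded_cd(2)[OF H(2)] mem_Collect_eq)
    also have "\<dots> \<longleftrightarrow> (\<exists>q\<in>Q. x = ur q) \<or> (\<exists>a. fincode a \<and> elts a \<subseteq> H \<and> x = st a)"
      using leq_ur leq_st elts_less_st unfolding less_succ_iff_leq by blast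
    finally show "x \<in> H \<longleftrightarrow> (\<exists>q\<in>Q. x = ur q) \<or> (\<exists>a. fincode a \<and> elts a \<subseteq> H \<and> x = st a)" .
  qed
qed

text \<open>The recursion runs on the code of the pair \<open>(x, y)\<close>: each clause that
  refers back replaces at least one component by an element of it, and this lowers the code of the
  pair. The four disjuncts of \<open>\<Psi>\<close> are the four clauses of the order.\<close>

lemma is_Hf_exists:
  assumes "quasi_order Q R"
  shows "\<exists>H L. is_Hf Q R H L"
proof -
  have QR: "Q \<in> sets M" "R \<in> sets M" using assms unfolding quasi_order_def by auto
  obtain H where H: "H \<in> sets M"
    "\<And>x. x \<in> H \<longleftrightarrow> (\<exists>q\<in>Q. x = ur q) \<or> (\<exists>a. fincode a \<and> elts a \<subseteq> H \<and> x = st a)"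
    using terms_exist[OF QR(1)] by metis
  have ur_H: "ur q \<in> H \<longleftrightarrow> q \<in> Q" for q
    using H(2)[of "ur q"] by (auto simp: ur_inject ur_neq_st)
  define \<Psi> where "\<Psi> x y c \<longleftrightarrow> (\<exists>p. p \<prec> x \<oplus> \<one> \<and> x = ur p \<and> (\<exists>q. q \<prec> y \<oplus> \<one> \<and> y = ur q \<and> pair p q \<in> R)) \<or>
      (\<exists>p. p \<prec> x \<oplus> \<one> \<and> x = ur p \<and> (\<exists>b. b \<prec> y \<oplus> \<one> \<and> y = st b \<and> (\<exists>v\<in>elts b. pair x v \<in> elts c))) \<or>
      (\<exists>a. a \<prec> x \<oplus> \<one> \<and> x = st a \<and> (\<exists>q. q \<prec> y \<oplus> \<one> \<and> y = ur q \<and> (\<forall>u\<in>elts a. pair u y \<in> elts c))) \<or>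
      (\<exists>a. a \<prec> x \<oplus> \<one> \<and> x = st a \<and> (\<exists>b. b \<prec> y \<oplus> \<one> \<and> y = st b \<and>
        (\<forall>u\<in>elts a. \<exists>v\<in>elts b. pair u v \<in> elts c)))" for x y c
  let ?\<Phi> = "\<lambda>z c. \<exists>x. x \<prec> z \<oplus> \<one> \<and> (\<exists>y. y \<prec> z \<oplus> \<one> \<and> z = pair x y \<and> x \<in> H \<and> y \<in> H \<and> \<Psi> x y c)"
  have "D1 (\<lambda>e. ?\<Phi> (e 0) (e 1))"
    unfolding \<Psi>_def
    by (intro D1_disj D1_bex D1_conj D1_mem H(1) QR D1_eq D1_ball_elts D1_bex_elts D1_elts
        F1_ur F1_st F1_pair F1_add F1_var F1_const)
  then obtain L where L: "L \<in> sets M" "\<And>x. coded {z. z \<prec> x \<and> z \<in> L}"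
    "\<And>x. x \<in> L \<longleftrightarrow> ?\<Phi> x (cd {z. z \<prec> x \<and> z \<in> L})"
    by (rule set_recursion[of ?\<Phi>]) (rule that)
  have elts_cd: "elts (cd {z. z \<prec> x \<and> z \<in> L}) = {z. z \<prec> x \<and> z \<in> L}" for x
    by (rule coded_cd(2)[OF L(2)])
  have L_iff: "z \<in> L \<longleftrightarrow> (\<exists>x y. z = pair x y \<and> x \<in> H \<and> y \<in> H \<and> \<Psi> x y (cd {w. w \<prec> z \<and> w \<in> L}))" for z
    unfolding L(3)[of z] less_succ_iff_leq
    by (intro iffI; elim exE conjE; hypsubst?; intro exI conjI; (rule refl leq_pair | assumption)?)
  have pair_L: "pair x y \<in> L \<longleftrightarrow> \<Psi> x y (cd {w. w \<prec> pair x y \<and> w \<in> L})" if "x \<in> H" "y \<in> H" for x y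
    unfolding L_iff[of "pair x y"] pair_inject using that by blast
  have "is_Hf Q R H L"
    unfolding is_Hf_def
  proof (intro conjI allI ballI impI)
    show "H \<in> sets M" "L \<in> sets M" by fact+
    show "x \<in> H \<longleftrightarrow> (\<exists>q\<in>Q. x = ur q) \<or> (\<exists>a. fincode a \<and> elts a \<subseteq> H \<and> x = st a)" for x by (rule H(2))
    show "\<exists>x\<in>H. \<exists>y\<in>H. z = pair x y" if "z \<in> L" for z using that L_iff[of z] by blast
    show "pair (ur p) (ur q) \<in> L \<longleftrightarrow> pair p q \<in> R" if "p \<in> Q" "q \<in> Q" for p q
      using that by (subst pair_L) (auto simp: \<Psi>_def ur_H ur_inject ur_neq_st less_succ_iff_leq leq_ur)
    show "pair (ur p) (st b) \<in> L \<longleftrightarrow> (\<exists>y\<in>elts b. pair (ur p) y \<in> L)" if "p \<in> Q" "st b \<in> H" for p b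
      using that by (subst pair_L)
        (auto simp: \<Psi>_def ur_H ur_inject st_inject ur_neq_st less_succ_iff_leq leq_ur leq_st elts_cd
          pair_less_right elts_less_st)
    show "pair (st a) (ur q) \<in> L \<longleftrightarrow> (\<forall>x\<in>elts a. pair x (ur q) \<in> L)" if "q \<in> Q" "st a \<in> H" for a q
      using that by (subst pair_L)
        (auto simp: \<Psi>_def ur_H ur_inject st_inject ur_neq_st less_succ_iff_leq leq_ur leq_st elts_cd
          pair_less_left elts_less_st)
    show "pair (st a) (st b) \<in> L \<longleftrightarrow> (\<forall>x\<in>elts a. \<exists>y\<in>elts b. pair x y \<in> L)"
      if ab: "st a \<in> H \<and> st b \<in> H" for a b
    proof -
      have "pair x y \<prec> pair (st a) (st b)" if "x \<in> elts a" "y \<in> elts b" for x y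
        using that by (intro pair_less N.add_strict_mono elts_less_st)
      then show ?thesis using ab by (subst pair_L)
        (auto simp: \<Psi>_def st_inject ur_neq_st less_succ_iff_leq leq_st elts_cd)
    qed
  qed
  then show ?thesis by blast
qed

end

section \<open>The order on the terms is a quasi order\<close>

locale Hf = rca0 +
  fixes Q R H L
  assumes Q: "quasi_order Q R" and Hf: "is_Hf Q R H L"
begin

text \<open>A urelement counts as its own only element. In this way the four clauses of the order
  merge into the single \<open>L_iff\<close>, and urelements become fixed points of the
  descent.\<close>

definition els :: "'a \<Rightarrow> 'a set" where
  "els x = {y. (y = x \<and> (\<exists>q. x = ur q)) \<or> (\<exists>a. x = st a \<and> y \<in> elts a)}"

lemma els_ur: "els (ur q) = {ur q}" and els_st: "els (st a) = elts a"
  by (auto simp: els_def ur_inject st_inject ur_neq_st)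

lemma H_sets: "H \<in> sets M" and L_sets: "L \<in> sets M"
  using Hf unfolding is_Hf_def by - (elim conjE, assumption)+

lemma H_iff: "x \<in> H \<longleftrightarrow> (\<exists>q\<in>Q. x = ur q) \<or> (\<exists>a. fincode a \<and> elts a \<subseteq> H \<and> x = st a)"
  using Hf unfolding is_Hf_def by (elim conjE) (rule spec)

lemma ur_in_H: "ur q \<in> H \<longleftrightarrow> q \<in> Q"
  using H_iff[of "ur q"] by (auto simp: ur_inject ur_neq_st)

lemma st_in_H: "st a \<in> H \<longleftrightarrow> fincode a \<and> elts a \<subseteq> H"
  using H_iff[of "st a"] by (auto simp: st_inject ur_neq_st)

lemma H_cases:
  assumes "x \<in> H"
  obtains q where "q \<in> Q" "x = ur q" | a where "fincode a" "elts a \<subseteq> H" "x = st a"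
  using assms H_iff[of x] by blast

lemma L_clauses:
  "\<forall>p\<in>Q. \<forall>q\<in>Q. pair (ur p) (ur q) \<in> L \<longleftrightarrow> pair p q \<in> R"
  "\<forall>p\<in>Q. \<forall>b. st b \<in> H \<longrightarrow> (pair (ur p) (st b) \<in> L \<longleftrightarrow> (\<exists>y\<in>elts b. pair (ur p) y \<in> L))"
  "\<forall>a. \<forall>q\<in>Q. st a \<in> H \<longrightarrow> (pair (st a) (ur q) \<in> L \<longleftrightarrow> (\<forall>x\<in>elts a. pair x (ur q) \<in> L))"
  "\<forall>a b. st a \<in> H \<and> st b \<in> H \<longrightarrow> (pair (st a) (st b) \<in> L \<longleftrightarrow> (\<forall>x\<in>elts a. \<exists>y\<in>elts b. pair x y \<in> L))"
  using Hf unfolding is_Hf_def by - (elim conjE, assumption)+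

lemma L_ur_ur: "p \<in> Q \<Longrightarrow> q \<in> Q \<Longrightarrow> pair (ur p) (ur q) \<in> L \<longleftrightarrow> pair p q \<in> R"
  and L_ur_st: "p \<in> Q \<Longrightarrow> st b \<in> H \<Longrightarrow> pair (ur p) (st b) \<in> L \<longleftrightarrow> (\<exists>y\<in>elts b. pair (ur p) y \<in> L)"
  and L_st_ur: "q \<in> Q \<Longrightarrow> st a \<in> H \<Longrightarrow> pair (st a) (ur q) \<in> L \<longleftrightarrow> (\<forall>x\<in>elts a. pair x (ur q) \<in> L)"
  and L_st_st: "st a \<in> H \<Longrightarrow> st b \<in> H \<Longrightarrow> pair (st a) (st b) \<in> L \<longleftrightarrow> (\<forall>x\<in>elts a. \<exists>y\<in>elts b. pair x y \<in> L)"
  by (simp_all only: L_clauses[rule_format] simp_thms)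

lemma L_iff: "x \<in> H \<Longrightarrow> y \<in> H \<Longrightarrow> pair x y \<in> L \<longleftrightarrow> (\<forall>u\<in>els x. \<exists>v\<in>els y. pair u v \<in> L)"
  by (elim H_cases) (auto simp: els_ur els_st L_ur_ur L_ur_st L_st_ur L_st_st st_in_H)

lemma els_H: "x \<in> H \<Longrightarrow> u \<in> els x \<Longrightarrow> u \<in> H"
  by (erule H_cases) (auto simp: els_ur els_st ur_in_H)

lemma els_leq: "u \<in> els x \<Longrightarrow> u \<preceq> x"
  by (auto simp: els_def leq_def elts_less_st)

lemma D1_els: "F1 f \<Longrightarrow> F1 g \<Longrightarrow> D1 (\<lambda>e. f e \<in> els (g e))"
proof (rule D1_comp2[where r = "\<lambda>y x. y \<in> els x"])
  have *: "y \<in> els x \<longleftrightarrow> (y = x \<and> (\<exists>q. q \<prec> x \<oplus> \<one> \<and> x = ur q)) \<or> (\<exists>a. a \<prec> x \<oplus> \<one> \<and> x = st a \<and> y \<in> elts a)" for x y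
    unfolding els_def less_succ_iff_leq using leq_ur leq_st by auto
  show "D1 (\<lambda>e. e 0 \<in> els (e 1))"
    unfolding * by (intro D1_disj D1_conj D1_bex D1_eq D1_elts F1_ur F1_st F1_add F1_var F1_const)
qed

lemma L_refl: "x \<in> H \<Longrightarrow> pair x x \<in> L"
proof -
  have "x \<in> H \<longrightarrow> pair x x \<in> L"
  proof (rule D1_less_induct[where P = "\<lambda>x. x \<in> H \<longrightarrow> pair x x \<in> L"])
    show "D1 (\<lambda>e. e 0 \<in> H \<longrightarrow> pair (e 0) (e 0) \<in> L)"
      by (intro D1_imp D1_mem H_sets L_sets F1_pair F1_var)
    fix x assume IH: "\<And>m. m \<prec> x \<Longrightarrow> m \<in> H \<longrightarrow> pair m m \<in> L"
    show "x \<in> H \<longrightarrow> pair x x \<in> L"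
    proof
      assume x: "x \<in> H"
      then show "pair x x \<in> L"
      proof (cases x rule: H_cases)
        case (1 q)
        then show ?thesis using Q L_ur_ur unfolding quasi_order_def by blast
      next
        case (2 a)
        then have "pair u u \<in> L" if "u \<in> els x" for u
          using that IH[of u] elts_less_st[of u a] by (auto simp: els_st)
        then show ?thesis unfolding L_iff[OF x x] by blast
      qed
    qed
  qed
  then show "x \<in> H \<Longrightarrow> pair x x \<in> L" by blast
qed

text \<open>Induction on the sum of the three codes. If all three terms are urelements, transitivity
  of \<open>R\<close> applies. Otherwise each is replaced by a member of its \<open>els\<close>; no
  code grows and that of a set drops, so the sum gets smaller. The bounds in \<open>?P\<close> keep
  it Delta_1.\<close>

lemma L_trans:
  assumes "x \<in> H" "y \<in> H" "z \<in> H" "pair x y \<in> L" "pair y z \<in> L"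
  shows "pair x z \<in> L"
proof -
  let ?P = "\<lambda>n. \<forall>x. x \<prec> n \<oplus> \<one> \<longrightarrow> (\<forall>y. y \<prec> n \<oplus> \<one> \<longrightarrow> (\<forall>z. z \<prec> n \<oplus> \<one> \<longrightarrow> x \<oplus> y \<oplus> z = n \<longrightarrow>
    x \<in> H \<longrightarrow> y \<in> H \<longrightarrow> z \<in> H \<longrightarrow> pair x y \<in> L \<longrightarrow> pair y z \<in> L \<longrightarrow> pair x z \<in> L))"
  have bound: "x \<prec> x \<oplus> y \<oplus> z \<oplus> \<one>" "y \<prec> x \<oplus> y \<oplus> z \<oplus> \<one>" "z \<prec> x \<oplus> y \<oplus> z \<oplus> \<one>" for x y z
  proof -
    note le = less_sum1[unfolded less_succ_iff_leq] less_sum2[unfolded less_succ_iff_leq]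
    have "x \<preceq> x \<oplus> y" "y \<preceq> x \<oplus> y" "x \<oplus> y \<preceq> x \<oplus> y \<oplus> z" "z \<preceq> x \<oplus> y \<oplus> z"
      by (rule le)+
    then show "x \<prec> x \<oplus> y \<oplus> z \<oplus> \<one>" "y \<prec> x \<oplus> y \<oplus> z \<oplus> \<one>" "z \<prec> x \<oplus> y \<oplus> z \<oplus> \<one>"
      unfolding less_succ_iff_leq by (blast intro: N.order_trans)+
  qed
  have "?P n" for n
  proof (rule D1_less_induct[where P = ?P])
    show "D1 (\<lambda>e. ?P (e 0))"
      by (intro D1_ball D1_imp D1_mem D1_eq H_sets L_sets F1_pair F1_add F1_var F1_const)
    fix n assume IH: "\<And>m. m \<prec> n \<Longrightarrow> ?P m"
    show "?P n"
    proof (intro allI impI)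
      fix x y z assume xyz: "x \<oplus> y \<oplus> z = n" "x \<in> H" "y \<in> H" "z \<in> H" "pair x y \<in> L" "pair y z \<in> L"
      show "pair x z \<in> L"
      proof (cases "(\<exists>q. x = ur q) \<and> (\<exists>q. y = ur q) \<and> (\<exists>q. z = ur q)")
        case True
        then obtain p q r where [simp]: "x = ur p" "y = ur q" "z = ur r" by blast
        have pqr: "p \<in> Q" "q \<in> Q" "r \<in> Q" using xyz(2-4) by (simp_all add: ur_in_H)
        have "pair p q \<in> R" "pair q r \<in> R" using xyz(5,6) pqr by (simp_all add: L_ur_ur)
        moreover have "\<forall>x\<in>Q. \<forall>y\<in>Q. \<forall>z\<in>Q. pair x y \<in> R \<and> pair y z \<in> R \<longrightarrow> pair x z \<in> R"
          using Q unfolding quasi_order_def by (elim conjE)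
        ultimately have "pair p r \<in> R" using pqr by blast
        then show ?thesis using pqr by (simp add: L_ur_ur)
      next
        case F: False
        have less: "u \<prec> v" if "v \<in> H" "\<nexists>q. v = ur q" "u \<in> els v" for u v
          using that elts_less_st by (elim H_cases) (auto simp: els_st)
        show ?thesis unfolding L_iff[OF xyz(2,4)]
        proof
          fix u assume u: "u \<in> els x"
          then obtain v where v: "v \<in> els y" "pair u v \<in> L" using xyz L_iff by blast
          then obtain w where w: "w \<in> els z" "pair v w \<in> L" using xyz L_iff by blast
          have le: "u \<preceq> x" "v \<preceq> y" "w \<preceq> z" using u v w els_leq by auto
          have "u \<prec> x \<or> v \<prec> y \<or> w \<prec> z" using F less xyz u v w by blast
          then have "u \<oplus> v \<oplus> w \<prec> n"
            unfolding xyz(1)[symmetric] using le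
            by (elim disjE) (blast intro: N.add_less_le_mono N.add_le_less_mono N.add_mono)+
          then have "pair u w \<in> L"
            using IH[rule_format, OF _ bound(1) bound(2) bound(3) refl, of u v w] v(2) w(2)
              els_H[OF xyz(2) u] els_H[OF xyz(3) v(1)] els_H[OF xyz(4) w(1)] by blast
          then show "\<exists>w\<in>els z. pair u w \<in> L" using w by blast
        qed
      qed
    qed
  qed
  from this[rule_format, OF bound(1) bound(2) bound(3) refl assms] show ?thesis .
qed

lemma quasi_order_H: "quasi_order H L"
proof -
  have "\<forall>z\<in>L. \<exists>x\<in>H. \<exists>y\<in>H. z = pair x y" using Hf unfolding is_Hf_def by (elim conjE)
  then show ?thesis
    unfolding quasi_order_def using H_sets L_sets L_refl L_trans by blast
qed

end

context rca0
begin

section \<open>Infinite sets and bounds\<close>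

text \<open>A least code has no explicit bound in terms of its elements. The bound is therefore
  built by recursion: \<open>b (m \<oplus> \<one>)\<close> exceeds the results of inserting
  \<open>m\<close> into all sets with codes below \<open>b m\<close>, of which collection bounds the
  codes.\<close>

lemma finite_sets_bound:
  obtains b where "F1 (\<lambda>e. b (e 0))" "\<And>m m'. m \<preceq> m' \<Longrightarrow> b m \<preceq> b m'"
    "\<And>m u. fincode u \<Longrightarrow> elts u \<subseteq> {i. i \<prec> m} \<Longrightarrow> u \<prec> b m"
proof -
  define ins where "ins m u = cd {i. i \<prec> m \<oplus> \<one> \<and> (i \<in> elts u \<or> i = m)}" for m u
  have F1_ins: "F1 (\<lambda>e. ins (f e) (g e))" if "F1 f" "F1 g" for f g
    by (rule F1_comp2[where k = ins, OF _ that])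
      (unfold ins_def, intro F1_cd D1_disj D1_elts D1_eq F1_add F1_var F1_const)
  define G where "G m w = mu (\<lambda>b. w \<preceq> b \<and> (\<forall>u. u \<prec> w \<longrightarrow> ins m u \<prec> b))" for m w
  have D1_G: "D1 (\<lambda>e. f e \<preceq> g e \<and> (\<forall>u. u \<prec> f e \<longrightarrow> ins (h e) u \<prec> g e))"
    if "F1 f" "F1 g" "F1 h" for f g h
    by (rule D1_comp3[where r = "\<lambda>w b m. w \<preceq> b \<and> (\<forall>u. u \<prec> w \<longrightarrow> ins m u \<prec> b)", OF _ that])
      (intro D1_conj D1_leq D1_ball D1_less F1_ins F1_var)
  have ex: "\<exists>b. w \<preceq> b \<and> (\<forall>u. u \<prec> w \<longrightarrow> ins m u \<prec> b)" for m w
  proof -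
    obtain b where b: "\<And>u. u \<prec> w \<Longrightarrow> ins m u \<prec> b"
      by (rule F1_bounded[of "ins m" w]) (intro F1_ins F1_const F1_var, rule that)
    have "w \<prec> w \<oplus> b \<oplus> \<one>" "b \<prec> w \<oplus> b \<oplus> \<one>" by (rule less_sum1, rule less_sum2)
    then show ?thesis using b by (intro exI[of _ "w \<oplus> b \<oplus> \<one>"]) (auto simp: N.less_imp_le intro: N.less_trans)
  qed
  have F1_G: "F1 (\<lambda>e. G (f e) (g e))" if "F1 f" "F1 g" for f g
    by (rule F1_comp2[where k = G, OF _ that]) (unfold G_def, intro F1_mu D1_G F1_var ex)
  have G: "w \<preceq> G m w" "u \<prec> w \<Longrightarrow> ins m u \<prec> G m w" for m w u
    unfolding G_def using mu(1)[OF D1_G[OF F1_const F1_var F1_const] ex, of w m] by auto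
  \<comment> \<open>At zero only the code of the empty set has to be exceeded.\<close>
  define b where "b = prec (cd {} \<oplus> \<one>) G"
  have b_simps: "b \<zero> = cd {} \<oplus> \<one>" "b (m \<oplus> \<one>) = G m (b m)" for m
    unfolding b_def by (rule prec_simps[where G = G, OF F1_G[OF F1_var F1_var]])+
  have F1_b: "F1 (\<lambda>e. b (e 0))"
    unfolding b_def using F1_comp2[OF F1_prec[of "\<lambda>_. cd {} \<oplus> \<one>" "\<lambda>_. G"], of "\<lambda>_. \<zero>" "\<lambda>e. e 0"]
      F1_const F1_var F1_G by simp
  have mono: "m \<preceq> m' \<longrightarrow> b m \<preceq> b m'" for m m'
  proof (rule D1_induct[where P = "\<lambda>m'. m \<preceq> m' \<longrightarrow> b m \<preceq> b m'"])
    show "D1 (\<lambda>e. m \<preceq> e 0 \<longrightarrow> b m \<preceq> b (e 0))"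
      by (intro D1_imp D1_leq F1_comp1[OF F1_b] F1_var F1_const)
    show "m \<preceq> \<zero> \<longrightarrow> b m \<preceq> b \<zero>" using not_less_zero by (auto simp: leq_def)
    show "m \<preceq> n \<oplus> \<one> \<longrightarrow> b m \<preceq> b (n \<oplus> \<one>)" if "m \<preceq> n \<longrightarrow> b m \<preceq> b n" for n
    proof (cases "m = n \<oplus> \<one>")
      case False
      then show ?thesis
        using that N.order_trans[OF _ G(1)[of "b n" n]]
        unfolding leq_def[of m "n \<oplus> \<one>"] less_succ_iff_leq b_simps by blast
    qed simp
  qed
  show thesis
  proof (rule that[OF F1_b])
    show "m \<preceq> m' \<Longrightarrow> b m \<preceq> b m'" for m m' using mono by blast
    fix m u assume u: "fincode u" "elts u \<subseteq> {i. i \<prec> m}"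
    \<comment> \<open>The induction follows the parts of one fixed \<open>u\<close> below m; each
      part is the previous one or arises from it by \<open>ins\<close>.\<close>
    define v where "v m = cd {i. i \<prec> m \<and> i \<in> elts u}" for m
    have v: "elts (v m) = {i. i \<prec> m \<and> i \<in> elts u}" for m
      unfolding v_def by (intro coded_cd(2) coded_Collect D1_elts F1_var F1_const)
    have "v m \<prec> b m"
    proof (rule D1_induct[where P = "\<lambda>m. v m \<prec> b m"])
      show "D1 (\<lambda>e. v (e 0) \<prec> b (e 0))"
        unfolding v_def by (intro D1_less F1_cd D1_elts F1_comp1[OF F1_b] F1_var F1_const)
      show "v \<zero> \<prec> b \<zero>" unfolding v_def b_simps by (simp add: not_less_zero less_succ)
      fix n assume n: "v n \<prec> b n"
      show "v (n \<oplus> \<one>) \<prec> b (n \<oplus> \<one>)"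
      proof (cases "n \<in> elts u")
        case True
        have "{i. i \<prec> n \<oplus> \<one> \<and> i \<in> elts u} = {i. i \<prec> n \<oplus> \<one> \<and> (i \<in> elts (v n) \<or> i = n)}"
          using True unfolding v less_succ by blast
        then have "v (n \<oplus> \<one>) = ins n (v n)" unfolding v_def[of "n \<oplus> \<one>"] ins_def by simp
        then show ?thesis using G(2)[OF n, of n] by (simp add: b_simps)
      next
        case False
        then have "{i. i \<prec> n \<oplus> \<one> \<and> i \<in> elts u} = {i. i \<prec> n \<and> i \<in> elts u}" unfolding less_succ by blast
        then have "v (n \<oplus> \<one>) = v n" unfolding v_def by simp
        then show ?thesis using n G(1)[of "b n" n] by (simp add: b_simps)
      qed
    qed
    moreover have "{i. i \<prec> m \<and> i \<in> elts u} = elts u" using u(2) by blast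
    ultimately show "u \<prec> b m" unfolding v_def using cd_unique[OF u(1)] by simp
  qed
qed

text \<open>The least codes of sets with elements up to \<open>m\<close> lie below
  \<open>b (m \<oplus> \<one>)\<close>, and collection bounds \<open>f\<close> there. Taking the
  least bound makes \<open>g\<close> inherit the monotonicity of \<open>b\<close>.\<close>

lemma finite_sets_function_bound:
  assumes f: "F1 (\<lambda>e. f (e 0))"
  obtains g where "F1 (\<lambda>e. g (e 0))" "\<And>m m'. m \<preceq> m' \<Longrightarrow> g m \<preceq> g m'"
    "\<And>m s. fincode s \<Longrightarrow> \<forall>i\<in>elts s. i \<preceq> m \<Longrightarrow> f s \<prec> g m"
proof -
  obtain b where b: "F1 (\<lambda>e. b (e 0))" "\<And>m m'. m \<preceq> m' \<Longrightarrow> b m \<preceq> b m'"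
    "\<And>m u. fincode u \<Longrightarrow> elts u \<subseteq> {i. i \<prec> m} \<Longrightarrow> u \<prec> b m"
    by (rule finite_sets_bound) (rule that)
  let ?P = "\<lambda>m g. \<forall>s. s \<prec> b (m \<oplus> \<one>) \<longrightarrow> f s \<prec> g"
  define g where "g m = mu (?P m)" for m
  have D1_P: "D1 (\<lambda>e. ?P (h e) (k e))" if "F1 h" "F1 k" for h k
    by (rule D1_comp2[where r = ?P, OF _ that])
      (intro D1_ball D1_less F1_comp1[OF f] F1_comp1[OF b(1)] F1_add F1_var F1_const)
  have ex: "\<exists>g. ?P m g" for m
    by (rule F1_bounded[OF f, of "b (m \<oplus> \<one>)"]) blast
  note mu = mu[OF D1_P[OF F1_const F1_var] ex, folded g_def]
  show thesis
  proof (rule that)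
    show "F1 (\<lambda>e. g (e 0))" unfolding g_def by (intro F1_mu D1_P F1_var ex)
    show "g m \<preceq> g m'" if "m \<preceq> m'" for m m'
    proof (rule mu(2))
      have "b (m \<oplus> \<one>) \<preceq> b (m' \<oplus> \<one>)" using that by (intro b(2) N.add_right_mono)
      then show "?P m (g m')" using mu(1)[of m'] N.less_le_trans by blast
    qed
    show "f s \<prec> g m" if "fincode s" "\<forall>i\<in>elts s. i \<preceq> m" for m s
      using mu(1)[of m] b(3)[OF that(1), of "m \<oplus> \<one>"] that(2) by (auto simp: less_succ_iff_leq)
  qed
qed

text \<open>The maximum is found as the least upper bound, which exists because the code itself is a
  bound; were it no element, its predecessor would be a bound too.\<close>

lemma coded_max:
  assumes "x \<in> elts s" obtains z where "z \<in> elts s" "\<And>y. y \<in> elts s \<Longrightarrow> y \<preceq> z"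
proof -
  have "D1 (\<lambda>e. \<forall>y\<in>elts s. y \<preceq> e 0)" by (intro D1_ball_elts D1_leq F1_var F1_const)
  moreover have "\<forall>y\<in>elts s. y \<preceq> s" using elts_less by (blast intro: N.less_imp_le)
  ultimately obtain z where z: "\<forall>y\<in>elts s. y \<preceq> z" "\<And>k. k \<prec> z \<Longrightarrow> \<not> (\<forall>y\<in>elts s. y \<preceq> k)"
    by (rule D1_least[of "\<lambda>z. \<forall>y\<in>elts s. y \<preceq> z" s]) (rule that)
  show thesis
  proof (cases "z \<in> elts s")
    case False
    then have less: "y \<prec> z" if "y \<in> elts s" for y using that z(1) unfolding leq_def by blast
    obtain k where k: "z = k \<oplus> \<one>" using less[OF assms] not_less_zero zero_or_succ by blast
    then have "\<forall>y\<in>elts s. y \<preceq> k" using less less_succ_iff_leq by blast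
    then show thesis using z(2)[of k] less_succ[of k k] k by blast
  qed (use z(1) that in blast)
qed

section \<open>Increasing enumeration of an infinite set\<close>

definition nx :: "'a set \<Rightarrow> 'a \<Rightarrow> 'a" where
  "nx X x = mu (\<lambda>y. y \<in> X \<and> x \<prec> y)"

definition en :: "'a set \<Rightarrow> 'a \<Rightarrow> 'a" where
  "en X = prec (mu (\<lambda>y. y \<in> X)) (\<lambda>_. nx X)"

definition infinite_set :: "'a set \<Rightarrow> bool" where
  "infinite_set X \<longleftrightarrow> X \<in> sets M \<and> infinite_class X"

context
  fixes X assumes X: "infinite_set X"
begin

lemma X_sets: "X \<in> sets M" and X_unbounded: "\<exists>y. y \<in> X \<and> x \<prec> y"
  using X unfolding infinite_set_def infinite_class_def by auto

lemma nx: "nx X x \<in> X" "x \<prec> nx X x" "y \<in> X \<Longrightarrow> x \<prec> y \<Longrightarrow> nx X x \<preceq> y"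
  unfolding nx_def
  using mu[of "\<lambda>y. y \<in> X \<and> x \<prec> y", OF D1_conj[OF D1_mem[OF F1_var X_sets] D1_less[OF F1_const F1_var]] X_unbounded]
  by blast+

lemma F1_nx: "F1 (\<lambda>e. nx X (e 0))"
  unfolding nx_def by (intro F1_mu D1_conj D1_mem D1_less X_sets X_unbounded F1_var)

lemma en_zero: "en X \<zero> = mu (\<lambda>y. y \<in> X)" and en_succ: "en X (i \<oplus> \<one>) = nx X (en X i)"
  unfolding en_def by (rule prec_simps[where G = "\<lambda>_. nx X", OF F1_comp1[OF F1_nx F1_var]])+

lemma en_least: "y \<in> X \<Longrightarrow> en X \<zero> \<preceq> y" and en_zero_in: "en X \<zero> \<in> X"
  unfolding en_zero using mu[of "\<lambda>y. y \<in> X", OF D1_mem[OF F1_var X_sets]] X_unbounded by blast+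

lemma en_in: "en X i \<in> X"
  using en_zero_in nx(1) by (cases i rule: zero_or_succ) (auto simp: en_succ)

lemma F1_en: "F1 f \<Longrightarrow> F1 (\<lambda>e. en X (f e))"
proof (rule F1_comp1[where k = "en X"])
  have "F1 (\<lambda>e. prec (mu (\<lambda>y. y \<in> X)) (\<lambda>_. nx X) (e 1))"
    by (rule F1_prec[of "\<lambda>_. mu (\<lambda>y. y \<in> X)" "\<lambda>_ _. nx X"]) (rule F1_const F1_comp1[OF F1_nx] F1_var)+
  from F1_comp2[where k = "\<lambda>_ i. prec (mu (\<lambda>y. y \<in> X)) (\<lambda>_. nx X) i", OF this F1_const F1_var]
  show "F1 (\<lambda>e. en X (e 0))" unfolding en_def .
qed

lemma en_less: "i \<prec> j \<Longrightarrow> en X i \<prec> en X j"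
proof -
  have "i \<prec> j \<longrightarrow> en X i \<prec> en X j"
  proof (rule D1_induct[where P = "\<lambda>j. i \<prec> j \<longrightarrow> en X i \<prec> en X j"])
    show "D1 (\<lambda>e. i \<prec> e 0 \<longrightarrow> en X i \<prec> en X (e 0))"
      by (intro D1_imp D1_less F1_en F1_var F1_const)
    show "i \<prec> n \<oplus> \<one> \<longrightarrow> en X i \<prec> en X (n \<oplus> \<one>)" if "i \<prec> n \<longrightarrow> en X i \<prec> en X n" for n
      using that nx(2)[of "en X n"] less_transitive unfolding less_succ en_succ by blast
  qed (simp add: not_less_zero)
  then show "i \<prec> j \<Longrightarrow> en X i \<prec> en X j" by blast
qed

lemma en_mono: "i \<preceq> j \<Longrightarrow> en X i \<preceq> en X j"
  unfolding leq_def using en_less by blast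

lemma leq_en: "i \<preceq> en X i"
proof (rule D1_induct[where P = "\<lambda>i. i \<preceq> en X i"])
  show "D1 (\<lambda>e. e 0 \<preceq> en X (e 0))" by (intro D1_leq F1_en F1_var)
  show "n \<oplus> \<one> \<preceq> en X (n \<oplus> \<one>)" if "n \<preceq> en X n" for n
    unfolding succ_leq_iff_less en_succ using that nx(2) N.le_less_trans by blast
qed (rule leq_zero)

lemma en_surj:
  assumes "x \<in> X" obtains i where "x = en X i"
proof -
  have "D1 (\<lambda>e. x \<preceq> en X (e 0))" by (intro D1_leq F1_en F1_var F1_const)
  then obtain i where i: "x \<preceq> en X i" "\<And>k. k \<prec> i \<Longrightarrow> \<not> x \<preceq> en X k"
    by (rule D1_least[of "\<lambda>i. x \<preceq> en X i" x]) (rule leq_en, rule that)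
  show thesis
  proof (cases i rule: zero_or_succ)
    case 1
    then show thesis using that i(1) en_least[OF assms] by (metis N.order_antisym)
  next
    case (2 k)
    then have "\<not> x \<preceq> en X k" using i(2) by (simp add: less_succ)
    then have "en X k \<prec> x" by (simp add: N.not_le)
    then have "en X i \<preceq> x" unfolding 2 en_succ by (rule nx(3)[OF assms])
    then show thesis using that i(1) by (metis N.order_antisym)
  qed
qed

end

text \<open>The base is only a Sigma_1 class. Searching for a pair of a member \<open>s\<close> and
  an element \<open>y\<close> of it above \<open>x\<close> yields a function \<open>h\<close>, and
  iterating \<open>h\<close> gives an increasing sequence in the base whose range is a set of the
  model.\<close>

lemma infinite_subset_of_base:
  assumes B: "B \<in> sets M" and inf: "infinite_class (base B)"
  obtains X where "infinite_set X" "X \<subseteq> base B"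
proof -
  let ?P = "\<lambda>x p. \<exists>s. s \<prec> p \<oplus> \<one> \<and> (\<exists>y. y \<prec> p \<oplus> \<one> \<and> p = pair s y \<and> s \<in> B \<and> y \<in> elts s \<and> x \<prec> y)"
  have D1_P: "D1 (\<lambda>e. ?P (f e) (g e))" if "F1 f" "F1 g" for f g
    by (rule D1_comp2[where r = ?P, OF _ that])
      (intro D1_bex D1_conj D1_eq D1_mem B D1_elts D1_less F1_pair F1_add F1_var F1_const)
  have ex: "\<exists>p. ?P x p" for x
  proof -
    obtain y s where "x \<prec> y" "s \<in> B" "y \<in> elts s" using inf unfolding infinite_class_def base_def by blast
    then show ?thesis unfolding less_succ_iff_leq using leq_pair by blast
  qed
  define t where "t x = mu (?P x)" for x
  have F1_t: "F1 (\<lambda>e. t (f e))" if "F1 f" for f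
    by (rule F1_comp1[where k = t, OF _ that]) (unfold t_def, intro F1_mu D1_P F1_var ex)
  define h where "h x = bmu (t x \<oplus> \<one>) (\<lambda>y. \<exists>s. s \<prec> t x \<oplus> \<one> \<and> t x = pair s y)" for x
  have F1_h: "F1 (\<lambda>e. h (f e))" if "F1 f" for f
    by (rule F1_comp1[where k = h, OF _ that])
      (unfold h_def, intro F1_bmu D1_bex D1_eq F1_pair F1_t F1_add F1_var F1_const)
  have h: "x \<prec> h x" "h x \<in> base B" for x
  proof -
    have "?P x (t x)" unfolding t_def by (rule mu(1)[OF D1_P[OF F1_const F1_var] ex])
    then obtain s y where sy: "s \<prec> t x \<oplus> \<one>" "y \<prec> t x \<oplus> \<one>" "t x = pair s y" "s \<in> B" "y \<in> elts s" "x \<prec> y"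
      by blast
    have "D1 (\<lambda>e. \<exists>s. s \<prec> t x \<oplus> \<one> \<and> t x = pair s (e 0))"
      by (intro D1_bex D1_eq F1_pair F1_var F1_const)
    then have "\<exists>s. s \<prec> t x \<oplus> \<one> \<and> t x = pair s (h x)"
      unfolding h_def by (rule bmu(1)[where P = "\<lambda>y. \<exists>s. s \<prec> t x \<oplus> \<one> \<and> t x = pair s y", OF _ sy(2)])
        (use sy in blast)
    then have "h x = y" using sy(3) by (auto simp: pair_inject)
    then show "x \<prec> h x" "h x \<in> base B" using sy unfolding base_def by auto
  qed
  define k where "k = prec (h \<zero>) (\<lambda>_. h)"
  have k: "k \<zero> = h \<zero>" "k (i \<oplus> \<one>) = h (k i)" for i
    unfolding k_def by (rule prec_simps[where G = "\<lambda>_. h", OF F1_h[OF F1_var]])+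
  have "F1 (\<lambda>e. prec (h \<zero>) (\<lambda>_. h) (e 1))"
    by (rule F1_prec[of "\<lambda>_. h \<zero>" "\<lambda>_ _. h"]) (rule F1_const F1_h F1_var)+
  from F1_comp2[where k = "\<lambda>_ i. prec (h \<zero>) (\<lambda>_. h) i", OF this F1_const F1_var]
  have F1_k: "F1 (\<lambda>e. k (e n))" for n unfolding k_def .
  have leq_k: "i \<prec> k i" for i
  proof (rule D1_induct[where P = "\<lambda>i. i \<prec> k i"])
    show "D1 (\<lambda>e. e 0 \<prec> k (e 0))" by (intro D1_less F1_k F1_var)
    show "n \<oplus> \<one> \<prec> k (n \<oplus> \<one>)" if "n \<prec> k n" for n
      using that h(1)[of "k n"] N.le_less_trans unfolding k succ_leq_iff_less[symmetric] by blast
  qed (simp add: k h)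
  have k_base: "k i \<in> base B" for i
    by (cases i rule: zero_or_succ) (simp_all add: k h)
  \<comment> \<open>Since \<open>i \<prec> k i\<close>, the search for the index is bounded and the
    range is Delta_1.\<close>
  define X where "X = {x. \<exists>i. i \<prec> x \<and> x = k i}"
  have "X \<in> sets M" unfolding X_def by (intro D1_set D1_bex D1_eq F1_k F1_var)
  moreover have "k m \<in> X" for m unfolding X_def using leq_k by blast
  ultimately have "infinite_set X" unfolding infinite_set_def infinite_class_def using leq_k by blast
  moreover have "X \<subseteq> base B" unfolding X_def using k_base by blast
  ultimately show thesis by (rule that)
qed


lemma leq_add1: "x \<preceq> x \<oplus> y" and leq_add2: "y \<preceq> x \<oplus> y"
  by (rule less_sum1[unfolded less_succ_iff_leq] less_sum2[unfolded less_succ_iff_leq])+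

lemma less_succD: "x \<oplus> \<one> \<prec> n \<Longrightarrow> x \<prec> n"
  using less_succ[of x x] less_transitive by blast

lemma bmu_leq: "D1 (\<lambda>e. P (e 0)) \<Longrightarrow> bmu (b \<oplus> \<one>) P \<preceq> b"
  using bmu_iff[of P "bmu (b \<oplus> \<one>) P" "b \<oplus> \<one>"] leq_zero[of b] by (auto simp: less_succ_iff_leq)

end

context Hf
begin

section \<open>The descent to urelements\<close>

definition pick :: "'a \<Rightarrow> 'a \<Rightarrow> 'a" where
  "pick a b = bmu (a \<oplus> \<one>) (\<lambda>x. x \<in> els a \<and> (\<forall>y. y \<prec> b \<oplus> \<one> \<longrightarrow> y \<in> els b \<longrightarrow> pair x y \<notin> L))"

lemma D1_pick: "F1 f \<Longrightarrow> F1 g \<Longrightarrow> F1 h \<Longrightarrow>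
  D1 (\<lambda>e. f e \<in> els (g e) \<and> (\<forall>y. y \<prec> h e \<oplus> \<one> \<longrightarrow> y \<in> els (h e) \<longrightarrow> pair (f e) y \<notin> L))"
  by (rule D1_comp3[where r = "\<lambda>x a b. x \<in> els a \<and> (\<forall>y. y \<prec> b \<oplus> \<one> \<longrightarrow> y \<in> els b \<longrightarrow> pair x y \<notin> L)"])
    (intro D1_conj D1_els D1_ball D1_imp D1_neg D1_mem L_sets F1_pair F1_add F1_var F1_const)

lemma F1_pick: "F1 f \<Longrightarrow> F1 g \<Longrightarrow> F1 (\<lambda>e. pick (f e) (g e))"
  by (rule F1_comp2[where k = pick]) (unfold pick_def, intro F1_bmu D1_pick F1_add F1_var F1_const)

text \<open>True for all \<open>a\<close> and \<open>b\<close>, as the default of \<open>bmu\<close>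
  is zero. It keeps the pairs of a new row below the bound used in \<open>step\<close>.\<close>

lemma pick_leq: "pick a b \<preceq> a"
  unfolding pick_def by (intro bmu_leq D1_pick F1_var F1_const)

lemma pick:
  assumes "a \<in> H" "b \<in> H" "pair a b \<notin> L"
  shows "pick a b \<in> els a" "y \<in> els b \<Longrightarrow> pair (pick a b) y \<notin> L"
proof -
  obtain x where x: "x \<in> els a" "\<forall>y\<in>els b. pair x y \<notin> L" using assms L_iff by blast
  have "x \<prec> a \<oplus> \<one>" using els_leq[OF x(1)] by (simp only: less_succ_iff_leq)
  then have *: "pick a b \<in> els a \<and> (\<forall>y. y \<prec> b \<oplus> \<one> \<longrightarrow> y \<in> els b \<longrightarrow> pair (pick a b) y \<notin> L)"
    unfolding pick_def
    by (rule bmu(1)[OF D1_pick[OF F1_var F1_const F1_const]]) (use x in blast)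
  then show "pick a b \<in> els a" by blast
  show "y \<in> els b \<Longrightarrow> pair (pick a b) y \<notin> L"
    using * els_leq[of y b] unfolding less_succ_iff_leq by blast
qed

text \<open>
  One round of the descent replaces each entry of a coded sequence by an element of it that is not
  below any element of the next entry; urelements stay fixed.
\<close>

definition step :: "'a \<Rightarrow> 'a" where
  "step w = cd {z. z \<prec> w \<and> (\<exists>i. i \<prec> w \<and> z = pair i (pick (app w i) (app w (i \<oplus> \<one>))))}"

definition row :: "'a \<Rightarrow> 'a \<Rightarrow> 'a" where
  "row w = prec w (\<lambda>_. step)"

text \<open>The value at place \<open>i\<close> after \<open>j\<close> rounds. In a sequence of
  length n only the triangle i + j < n is meaningful, because a round compares each place with the
  next one.\<close>

definition entry :: "'a \<Rightarrow> 'a \<Rightarrow> 'a \<Rightarrow> 'a" where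
  "entry w i j = app (row w j) i"

lemma D1_step: "F1 f \<Longrightarrow> F1 g \<Longrightarrow>
  D1 (\<lambda>e. \<exists>i. i \<prec> f e \<and> g e = pair i (pick (app (f e) i) (app (f e) (i \<oplus> \<one>))))"
  by (rule D1_comp2[where r = "\<lambda>w z. \<exists>i. i \<prec> w \<and> z = pair i (pick (app w i) (app w (i \<oplus> \<one>)))"])
    (intro D1_bex D1_eq F1_pair F1_pick F1_app F1_add F1_var F1_const)

lemma F1_step: "F1 f \<Longrightarrow> F1 (\<lambda>e. step (f e))"
  by (rule F1_comp1[where k = step]) (unfold step_def, intro F1_cd D1_step F1_var)

lemma F1_row: "F1 f \<Longrightarrow> F1 g \<Longrightarrow> F1 (\<lambda>e. row (f e) (g e))"
  by (rule F1_comp2[where k = row])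
    (unfold row_def, intro F1_prec[of "\<lambda>w. w" "\<lambda>_ _. step"] F1_step F1_var)

lemma F1_entry: "F1 f \<Longrightarrow> F1 g \<Longrightarrow> F1 h \<Longrightarrow> F1 (\<lambda>e. entry (f e) (g e) (h e))"
  by (rule F1_comp3[where k = entry]) (unfold entry_def, intro F1_app F1_row F1_var)

lemma row_simps: "row w \<zero> = w" "row w (j \<oplus> \<one>) = step (row w j)"
  unfolding row_def by (rule prec_simps[where G = "\<lambda>_. step", OF F1_step[OF F1_var]])+

lemma app_step:
  assumes "pair i (app w i) \<in> elts w"
  shows "app (step w) i = pick (app w i) (app w (i \<oplus> \<one>))" "pair i (app (step w) i) \<in> elts (step w)"
proof -
  let ?v = "pick (app w i) (app w (i \<oplus> \<one>))"
  have elts: "elts (step w) = {z. z \<prec> w \<and> (\<exists>i. i \<prec> w \<and> z = pair i (pick (app w i) (app w (i \<oplus> \<one>))))}"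
    unfolding step_def by (intro coded_cd(2) coded_Collect D1_step F1_var F1_const)
  \<comment> \<open>Picking never raises a value, so the new pair is at most the old one, an element
    of \<open>w\<close>, and meets the bound in \<open>step\<close>.\<close>
  have "pair i ?v \<preceq> pair i (app w i)"
    using pick_leq[of "app w i" "app w (i \<oplus> \<one>)"] pair_less_right[of ?v "app w i" i]
    unfolding leq_def by auto
  then have "pair i ?v \<prec> w" using elts_less[OF assms] by order
  moreover from this have "i \<prec> w" using leq_pair(1)[of i ?v] by order
  ultimately have v: "pair i ?v \<in> elts (step w)" unfolding elts by blast
  then show "app (step w) i = ?v" by (rule app_eq) (auto simp: elts pair_inject)
  then show "pair i (app (step w) i) \<in> elts (step w)" using v by simp
qed

lemma entry_zero: "entry w i \<zero> = app w i"
  by (simp add: entry_def row_simps)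

lemma entry_succ:
  assumes "pair i (app w i) \<in> elts w"
  shows "entry w i (j \<oplus> \<one>) = pick (entry w i j) (entry w (i \<oplus> \<one>) j)"
proof -
  have "pair i (app (row w j) i) \<in> elts (row w j)" for j
  proof (rule D1_induct[where P = "\<lambda>j. pair i (app (row w j) i) \<in> elts (row w j)"])
    show "D1 (\<lambda>e. pair i (app (row w (e 0)) i) \<in> elts (row w (e 0)))"
      by (intro D1_elts F1_pair F1_app F1_row F1_var F1_const)
    show "pair i (app (row w (n \<oplus> \<one>)) i) \<in> elts (row w (n \<oplus> \<one>))"
      if "pair i (app (row w n) i) \<in> elts (row w n)" for n
      using app_step(2)[OF that] by (simp add: row_simps)
  qed (simp add: row_simps assms)
  then show ?thesis unfolding entry_def row_simps by (rule app_step(1))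
qed

text \<open>An entry depends only on the places \<open>i\<close> to i + j of the first row, so
  sequences that agree on a shifted window have the same triangle over it. This compares the
  sequences of two different members of the new barrier.\<close>

lemma entry_shift:
  assumes w: "\<And>i. i \<prec> n \<Longrightarrow> pair i (app w i) \<in> elts w"
    and w': "\<And>i. i \<prec> n \<Longrightarrow> pair (d \<oplus> i) (app w' (d \<oplus> i)) \<in> elts w'"
    and eq: "\<And>i. i \<prec> n \<Longrightarrow> app w i = app w' (d \<oplus> i)"
    and less: "i \<oplus> j \<prec> n"
  shows "entry w i j = entry w' (d \<oplus> i) j"
proof -
  let ?P = "\<lambda>j. \<forall>i. i \<prec> n \<longrightarrow> i \<oplus> j \<prec> n \<longrightarrow> entry w i j = entry w' (d \<oplus> i) j"
  have "?P j"
  proof (rule D1_induct[where P = ?P])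
    show "D1 (\<lambda>e. ?P (e 0))"
      by (intro D1_ball D1_imp D1_less D1_eq F1_entry F1_add F1_var F1_const)
    show "?P \<zero>" using eq by (simp add: entry_zero)
    fix j assume IH: "?P j"
    show "?P (j \<oplus> \<one>)"
    proof (intro allI impI)
      fix i assume i: "i \<prec> n" "i \<oplus> (j \<oplus> \<one>) \<prec> n"
      then have 1: "i \<oplus> j \<prec> n" "(i \<oplus> \<one>) \<oplus> j \<prec> n"
        unfolding add_succ succ_add using less_succD by blast+
      have "i \<oplus> \<one> \<prec> n" using 1(2) leq_add1[of "i \<oplus> \<one>" j] by order
      then have "entry w (i \<oplus> \<one>) j = entry w' (d \<oplus> i \<oplus> \<one>) j" using IH 1(2) by (metis add_succ)
      moreover have "entry w i j = entry w' (d \<oplus> i) j" using IH 1(1) i(1) by blast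
      ultimately show "entry w i (j \<oplus> \<one>) = entry w' (d \<oplus> i) (j \<oplus> \<one>)"
        unfolding entry_succ[OF w[OF i(1)]] entry_succ[OF w'[OF i(1)]] by simp
    qed
  qed
  moreover have "i \<prec> n" using less leq_add1[of i j] by order
  ultimately show ?thesis using less by blast
qed

definition bad_code :: "'a \<Rightarrow> 'a \<Rightarrow> bool" where
  "bad_code w n \<longleftrightarrow> (\<forall>i. i \<prec> n \<longrightarrow> pair i (app w i) \<in> elts w \<and> app w i \<in> H) \<and>
    (\<forall>i. i \<oplus> \<one> \<prec> n \<longrightarrow> pair (app w i) (app w (i \<oplus> \<one>)) \<notin> L)"

lemma ur_bounded: "(\<exists>q. x = ur q) \<longleftrightarrow> (\<exists>q. q \<prec> x \<oplus> \<one> \<and> x = ur q)"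
  unfolding less_succ_iff_leq using leq_ur by blast

text \<open>The three claims need one joint induction on the round: picking requires that the pair
  of neighbours is bad, and badness survives because of how the elements are picked. The second
  claim is the measure: a round that starts from a set lowers the code by at least one.\<close>

lemma entry_invariant:
  assumes bad: "bad_code w n" and less: "i \<oplus> j \<prec> n"
  shows "entry w i j \<in> H" "(\<exists>q. entry w i j = ur q) \<or> entry w i j \<oplus> j \<preceq> app w i"
    "i \<oplus> \<one> \<oplus> j \<prec> n \<Longrightarrow> pair (entry w i j) (entry w (i \<oplus> \<one>) j) \<notin> L"
proof -
  let ?P = "\<lambda>j. \<forall>i. i \<prec> n \<longrightarrow> i \<oplus> j \<prec> n \<longrightarrow> entry w i j \<in> H \<and>
    ((\<exists>q. q \<prec> entry w i j \<oplus> \<one> \<and> entry w i j = ur q) \<or> entry w i j \<oplus> j \<preceq> app w i) \<and>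
    (i \<oplus> \<one> \<oplus> j \<prec> n \<longrightarrow> pair (entry w i j) (entry w (i \<oplus> \<one>) j) \<notin> L)"
  have "?P j"
  proof (rule D1_induct[where P = ?P])
    show "D1 (\<lambda>e. ?P (e 0))"
      by (intro D1_ball D1_imp D1_conj D1_disj D1_bex D1_neg D1_mem H_sets L_sets D1_less D1_leq D1_eq
          F1_entry F1_pair F1_ur F1_app F1_add F1_var F1_const)
    show "?P \<zero>" using bad unfolding bad_code_def by (simp add: entry_zero add_zero)
    fix j assume IH: "?P j"
    have IH': "entry w i j \<in> H" "(\<exists>q. entry w i j = ur q) \<or> entry w i j \<oplus> j \<preceq> app w i"
      "i \<oplus> \<one> \<oplus> j \<prec> n \<Longrightarrow> pair (entry w i j) (entry w (i \<oplus> \<one>) j) \<notin> L" if "i \<oplus> j \<prec> n" for i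
    proof -
      have "i \<prec> n" using that leq_add1[of i j] by order
      then show "entry w i j \<in> H" "(\<exists>q. entry w i j = ur q) \<or> entry w i j \<oplus> j \<preceq> app w i"
        "i \<oplus> \<one> \<oplus> j \<prec> n \<Longrightarrow> pair (entry w i j) (entry w (i \<oplus> \<one>) j) \<notin> L"
        using IH that by blast+
    qed
    have w: "entry w i (j \<oplus> \<one>) = pick (entry w i j) (entry w (i \<oplus> \<one>) j)" if "i \<prec> n" for i
      using bad that unfolding bad_code_def by (intro entry_succ) blast
    show "?P (j \<oplus> \<one>)"
    proof (intro allI impI)
      fix i assume i: "i \<prec> n" "i \<oplus> (j \<oplus> \<one>) \<prec> n"
      then have 1: "i \<oplus> j \<prec> n" "(i \<oplus> \<one>) \<oplus> j \<prec> n"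
        unfolding add_succ succ_add using less_succD by blast+
      note a = IH'(1,3)[OF 1(1)] and b = IH'(1)[OF 1(2)]
      note p = pick[OF a(1) b a(2)[OF 1(2)], folded w[OF i(1)]]
      have "entry w i (j \<oplus> \<one>) \<in> H" using els_H[OF a(1) p(1)] .
      moreover have "(\<exists>q. entry w i (j \<oplus> \<one>) = ur q) \<or> entry w i (j \<oplus> \<one>) \<oplus> (j \<oplus> \<one>) \<preceq> app w i"
        using a(1)
      proof (cases rule: H_cases)
        case (1 q)
        then show ?thesis using p(1) by (auto simp: els_ur)
      next
        case (2 c)
        then have "entry w i (j \<oplus> \<one>) \<prec> entry w i j" using p(1) elts_less_st by (simp add: els_st)
        then have "entry w i (j \<oplus> \<one>) \<oplus> \<one> \<oplus> j \<preceq> entry w i j \<oplus> j"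
          by (intro N.add_right_mono) (simp only: succ_leq_iff_less)
        moreover have "entry w i j \<oplus> j \<preceq> app w i" using IH'(2)[OF 1(1)] 2 by (auto simp: ur_neq_st)
        ultimately have "entry w i (j \<oplus> \<one>) \<oplus> \<one> \<oplus> j \<preceq> app w i" by order
        then show ?thesis unfolding succ_add add_succ by blast
      qed
      moreover have "pair (entry w i (j \<oplus> \<one>)) (entry w (i \<oplus> \<one>) (j \<oplus> \<one>)) \<notin> L" if "i \<oplus> \<one> \<oplus> (j \<oplus> \<one>) \<prec> n"
      proof (rule p(2))
        \<comment> \<open>The neighbour of place i in the new round is picked by comparison with
          place i + 2, which must still lie in the triangle. It is an element of the previous
          neighbour, and what was picked at place i is below no such element.\<close>
        have 2: "i \<oplus> \<one> \<oplus> \<one> \<oplus> j \<prec> n" using that unfolding add_succ[of "i \<oplus> \<one>" j] succ_add[of "i \<oplus> \<one>" j] .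
        have "i \<oplus> \<one> \<prec> n" using 1(2) leq_add1[of "i \<oplus> \<one>" j] by order
        then show "entry w (i \<oplus> \<one>) (j \<oplus> \<one>) \<in> els (entry w (i \<oplus> \<one>) j)"
          unfolding w[OF \<open>i \<oplus> \<one> \<prec> n\<close>] using IH'[OF 1(2)] IH'(1)[OF 2] 2 by (intro pick) blast+
      qed
      ultimately show "entry w i (j \<oplus> \<one>) \<in> H \<and>
        ((\<exists>q. q \<prec> entry w i (j \<oplus> \<one>) \<oplus> \<one> \<and> entry w i (j \<oplus> \<one>) = ur q) \<or>
          entry w i (j \<oplus> \<one>) \<oplus> (j \<oplus> \<one>) \<preceq> app w i) \<and>
        (i \<oplus> \<one> \<oplus> (j \<oplus> \<one>) \<prec> n \<longrightarrow> pair (entry w i (j \<oplus> \<one>)) (entry w (i \<oplus> \<one>) (j \<oplus> \<one>)) \<notin> L)"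
        unfolding ur_bounded[symmetric] by blast
    qed
  qed
  moreover have "i \<prec> n" using less leq_add1[of i j] by order
  ultimately have "entry w i j \<in> H \<and>
    ((\<exists>q. q \<prec> entry w i j \<oplus> \<one> \<and> entry w i j = ur q) \<or> entry w i j \<oplus> j \<preceq> app w i) \<and>
    (i \<oplus> \<one> \<oplus> j \<prec> n \<longrightarrow> pair (entry w i j) (entry w (i \<oplus> \<one>) j) \<notin> L)"
    using less by blast
  then show "entry w i j \<in> H" "(\<exists>q. entry w i j = ur q) \<or> entry w i j \<oplus> j \<preceq> app w i"
    "i \<oplus> \<one> \<oplus> j \<prec> n \<Longrightarrow> pair (entry w i j) (entry w (i \<oplus> \<one>) j) \<notin> L"
    by blast+
qed

text \<open>By the measure in \<open>entry_invariant\<close>, a set that remained after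
  \<open>k\<close> rounds would force \<open>k \<preceq> app w \<zero>\<close>.\<close>

lemma entry_ur:
  assumes bad: "bad_code w n" and k: "app w \<zero> \<prec> k" "k \<prec> n"
  obtains q where "q \<in> Q" "entry w \<zero> k = ur q"
proof -
  have k': "\<zero> \<oplus> k \<prec> n" using k(2) by (simp only: zero_add)
  have "\<not> entry w \<zero> k \<oplus> k \<preceq> app w \<zero>" using leq_add2[of k "entry w \<zero> k"] k(1) by order
  then obtain q where "entry w \<zero> k = ur q" using entry_invariant(2)[OF bad k'] by blast
  moreover from this have "q \<in> Q" using entry_invariant(1)[OF bad k'] by (simp add: ur_in_H)
  ultimately show thesis by (rule that[rotated])
qed

text \<open>From a urelement only the urelement itself can be picked; badness guarantees that
  something is picked, and not the default.\<close>

lemma entry_stable: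
  assumes bad: "bad_code w n" and q: "entry w \<zero> k = ur q" and k': "k \<preceq> k'" "k' \<prec> n"
  shows "entry w \<zero> k' = ur q"
proof -
  have "k \<preceq> k' \<longrightarrow> k' \<prec> n \<longrightarrow> entry w \<zero> k' = ur q"
  proof (rule D1_induct[where P = "\<lambda>k'. k \<preceq> k' \<longrightarrow> k' \<prec> n \<longrightarrow> entry w \<zero> k' = ur q"])
    show "D1 (\<lambda>e. k \<preceq> e 0 \<longrightarrow> e 0 \<prec> n \<longrightarrow> entry w \<zero> (e 0) = ur q)"
      by (intro D1_imp D1_leq D1_less D1_eq F1_entry F1_var F1_const)
    show "k \<preceq> \<zero> \<longrightarrow> \<zero> \<prec> n \<longrightarrow> entry w \<zero> \<zero> = ur q"
      using q not_less_zero[of k] unfolding leq_def by blast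
    fix j assume IH: "k \<preceq> j \<longrightarrow> j \<prec> n \<longrightarrow> entry w \<zero> j = ur q"
    show "k \<preceq> j \<oplus> \<one> \<longrightarrow> j \<oplus> \<one> \<prec> n \<longrightarrow> entry w \<zero> (j \<oplus> \<one>) = ur q"
    proof (intro impI)
      assume j: "k \<preceq> j \<oplus> \<one>" "j \<oplus> \<one> \<prec> n"
      show "entry w \<zero> (j \<oplus> \<one>) = ur q"
      proof (cases "k = j \<oplus> \<one>")
        case False
        then have "k \<preceq> j" using j(1) unfolding leq_def[of k "j \<oplus> \<one>"] less_succ_iff_leq by blast
        then have jq: "entry w \<zero> j = ur q" using IH less_succD[OF j(2)] by blast
        have 1: "\<zero> \<oplus> j \<prec> n" "\<zero> \<oplus> \<one> \<oplus> j \<prec> n" using j(2) less_succD[OF j(2)]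
          unfolding zero_add by (simp_all only: add_commutes[of \<one> j])
        have "\<zero> \<prec> n" using leq_zero[of j] less_succD[OF j(2)] by order
        then have "entry w \<zero> (j \<oplus> \<one>) = pick (entry w \<zero> j) (entry w (\<zero> \<oplus> \<one>) j)"
          using bad unfolding bad_code_def by (intro entry_succ) blast
        moreover have "\<dots> \<in> els (entry w \<zero> j)"
          using entry_invariant[OF bad 1(1)] entry_invariant(1)[OF bad 1(2)] 1(2) by (intro pick(1)) blast+
        ultimately show ?thesis by (simp add: jq els_ur)
      qed (use q in simp)
    qed
  qed
  then show ?thesis using k' by blast
qed

end

section \<open>The barrier of longer sequences\<close>

locale refinement = rca0 +
  fixes B g
  assumes barrier: "barrier B"
    and F1_g: "F1 (\<lambda>e. g (e 0))"
    and g_mono: "m \<preceq> m' \<Longrightarrow> g m \<preceq> g m'"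
begin

lemma B_sets: "B \<in> sets M" and B_fincode: "s \<in> B \<Longrightarrow> fincode s"
  and B_base: "infinite_class (base B)"
  and B_init: "X \<in> sets M \<Longrightarrow> infinite_class X \<Longrightarrow> X \<subseteq> base B \<Longrightarrow> \<exists>s\<in>B. init_seg (elts s) X"
  and B_antichain: "s \<in> B \<Longrightarrow> t \<in> B \<Longrightarrow> elts s \<subseteq> elts t \<Longrightarrow> elts s = elts t"
  using barrier unfolding barrier_def block_def by blast+

definition seg :: "'a set \<Rightarrow> 'a \<Rightarrow> 'a \<Rightarrow> 'a" where
  "seg X x z = cd {y. y \<prec> z \<oplus> \<one> \<and> y \<in> X \<and> x \<preceq> y}"

text \<open>The interval of \<open>X\<close> from \<open>x\<close> to \<open>z\<close> is the member of \<open>B\<close> that \<open>X\<close> determines from \<open>x\<close> on.\<close>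

definition spans :: "'a set \<Rightarrow> 'a \<Rightarrow> 'a \<Rightarrow> bool" where
  "spans X x z \<longleftrightarrow> x \<in> X \<and> z \<in> X \<and> x \<preceq> z \<and> seg X x z \<in> B"

lemma elts_seg: "X \<in> sets M \<Longrightarrow> elts (seg X x z) = {y \<in> X. x \<preceq> y \<and> y \<preceq> z}"
proof -
  assume "X \<in> sets M"
  then have "D1 (\<lambda>e. e 0 \<in> X \<and> x \<preceq> e 0)" by (intro D1_conj D1_mem D1_leq F1_var F1_const)
  then have "elts (seg X x z) = {y. y \<prec> z \<oplus> \<one> \<and> y \<in> X \<and> x \<preceq> y}"
    unfolding seg_def by (intro coded_cd(2) coded_Collect)
  then show ?thesis unfolding less_succ_iff_leq by blast
qed

text \<open>What \<open>spans\<close>, \<open>en\<close> and \<open>chain\<close> say up to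
  \<open>z\<close> is determined by the set up to \<open>z\<close>, so it carries over to any set
  that agrees with it there.\<close>

definition agree :: "'a set \<Rightarrow> 'a set \<Rightarrow> 'a \<Rightarrow> bool" where
  "agree X Y z \<longleftrightarrow> (\<forall>y. y \<preceq> z \<longrightarrow> (y \<in> X \<longleftrightarrow> y \<in> Y))"

lemma agree_sym: "agree X Y z \<Longrightarrow> agree Y X z"
  unfolding agree_def by blast

lemma agree_leq: "agree X Y z \<Longrightarrow> z' \<preceq> z \<Longrightarrow> agree X Y z'"
  unfolding agree_def using N.order_trans by blast

lemma seg_agree: "agree X Y z \<Longrightarrow> seg X x z = seg Y x z"
  unfolding seg_def agree_def less_succ_iff_leq by (rule arg_cong[of _ _ cd]) blast

lemma spans_agree: "agree X Y z \<Longrightarrow> spans X x z \<Longrightarrow> spans Y x z"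
  using seg_agree[of X Y z x] unfolding spans_def agree_def by auto

lemma spans_antichain:
  assumes "X \<in> sets M" "Y \<in> sets M" "spans X x z" "spans Y x' z'"
    and "\<And>y. y \<in> X \<Longrightarrow> x \<preceq> y \<Longrightarrow> y \<preceq> z \<Longrightarrow> y \<in> Y \<and> x' \<preceq> y \<and> y \<preceq> z'"
  shows "x = x'" "z = z'" "{y \<in> X. x \<preceq> y \<and> y \<preceq> z} = {y \<in> Y. x' \<preceq> y \<and> y \<preceq> z'}"
proof -
  have "{y \<in> X. x \<preceq> y \<and> y \<preceq> z} \<subseteq> {y \<in> Y. x' \<preceq> y \<and> y \<preceq> z'}" using assms(5) by blast
  then show *: "{y \<in> X. x \<preceq> y \<and> y \<preceq> z} = {y \<in> Y. x' \<preceq> y \<and> y \<preceq> z'}"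
    using B_antichain[of "seg X x z" "seg Y x' z'"] assms(1-4) by (simp add: elts_seg spans_def)
  have "x \<in> {y \<in> X. x \<preceq> y \<and> y \<preceq> z}" "z \<in> {y \<in> X. x \<preceq> y \<and> y \<preceq> z}"
    "x' \<in> {y \<in> Y. x' \<preceq> y \<and> y \<preceq> z'}" "z' \<in> {y \<in> Y. x' \<preceq> y \<and> y \<preceq> z'}"
    using assms(3,4) unfolding spans_def by auto
  then have "x' \<preceq> x" "z \<preceq> z'" "x \<preceq> x'" "z' \<preceq> z" using * by blast+
  then show "x = x'" "z = z'" by order+
qed

text \<open>Otherwise the member that starts at x' would be included in the one that starts at x and
  end earlier, against the antichain property.\<close>

lemma spans_mono:
  assumes "X \<in> sets M" "spans X x z" "spans X x' z'" "x \<preceq> x'" shows "z \<preceq> z'"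
proof (rule ccontr)
  assume "\<not> z \<preceq> z'"
  then have "z' \<prec> z" by order
  moreover have "z' = z"
  proof (rule spans_antichain(2)[OF assms(1,1,3,2)])
    fix y assume "y \<in> X" "x' \<preceq> y" "y \<preceq> z'"
    moreover from this \<open>z' \<prec> z\<close> assms(4) have "x \<preceq> y" "y \<preceq> z" by order+
    ultimately show "y \<in> X \<and> x \<preceq> y \<and> y \<preceq> z" by blast
  qed
  ultimately show False by order
qed

lemma spans_unique: "X \<in> sets M \<Longrightarrow> spans X x z \<Longrightarrow> spans X x z' \<Longrightarrow> z = z'"
  using spans_mono[of X x z x z'] spans_mono[of X x z' x z] by (metis N.order_antisym N.order_refl)

lemma infinite_tail:
  assumes "infinite_set X" "D1 (\<lambda>e. P (e 0))" "\<And>y. x \<prec> y \<Longrightarrow> P y"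
  shows "infinite_set {y \<in> X. P y}"
proof -
  have "{y. y \<in> X \<and> P y} \<in> sets M"
    by (intro D1_set D1_conj D1_mem assms(2) X_sets[OF assms(1)] F1_var)
  moreover have "\<exists>y\<in>{y. y \<in> X \<and> P y}. m \<prec> y" for m
  proof -
    obtain y where y: "y \<in> X" "m \<oplus> x \<prec> y" using X_unbounded[OF assms(1)] by blast
    moreover have "m \<prec> y" "x \<prec> y" using y(2) leq_add1[of m x] leq_add2[of x m] by order+
    ultimately show ?thesis using assms(3) by blast
  qed
  ultimately show ?thesis unfolding infinite_set_def infinite_class_def by simp
qed

lemma infinite_from: "infinite_set X \<Longrightarrow> infinite_set {y \<in> X. x \<preceq> y}"
  by (rule infinite_tail[where x = x]) (auto intro: N.less_imp_le simp: D1_leq F1_const F1_var)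

lemma spans_exists:
  assumes X: "infinite_set X" "X \<subseteq> base B" and x: "x \<in> X"
  obtains z where "spans X x z"
proof -
  let ?Y = "{y \<in> X. x \<preceq> y}"
  have "infinite_set ?Y" by (rule infinite_from[OF X(1)])
  then obtain s where s: "s \<in> B" "init_seg (elts s) ?Y"
    using B_init[of ?Y] X(2) unfolding infinite_set_def by blast
  \<comment> \<open>An empty member would be included in all others, so all of them would be empty
    and the base could not be infinite.\<close>
  have "elts s \<noteq> {}"
  proof
    assume "elts s = {}"
    then have "elts t = {}" if "t \<in> B" for t using B_antichain[OF s(1) that] by simp
    then show False using B_base unfolding infinite_class_def base_def by auto
  qed
  then obtain z where z: "z \<in> elts s" "\<And>y. y \<in> elts s \<Longrightarrow> y \<preceq> z" using coded_max by blast
  have "y \<in> elts s" if "y \<in> X" "x \<preceq> y" "y \<preceq> z" for y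
    using s(2) that z(1) unfolding init_seg_def leq_def[of y z] by blast
  moreover have "y \<in> X \<and> x \<preceq> y" if "y \<in> elts s" for y using s(2) that unfolding init_seg_def by blast
  ultimately have "elts s = {y. y \<prec> z \<oplus> \<one> \<and> y \<in> X \<and> x \<preceq> y}"
    unfolding less_succ_iff_leq using z(2) by blast
  then have "seg X x z = s" unfolding seg_def using cd_unique[OF B_fincode[OF s(1)]] by simp
  moreover have "z \<in> X" "x \<preceq> z" using s(2) z(1) unfolding init_seg_def by auto
  ultimately have "spans X x z" using x s(1) unfolding spans_def by blast
  then show thesis by (rule that)
qed

text \<open>The witness is X from x on; without its least element it starts at
  \<open>nx X x\<close>.\<close>

lemma spans_tri:
  assumes X: "infinite_set X" and "spans X x z" "spans X (nx X x) z'"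
  shows "seg X x z \<lhd> seg X (nx X x) z'"
proof -
  let ?Y = "{y \<in> X. x \<preceq> y}"
  have "infinite_set ?Y" by (rule infinite_from[OF X])
  moreover have x: "x \<in> X" using assms(2) unfolding spans_def by blast
  have Y: "y \<in> minus_least ?Y \<longleftrightarrow> y \<in> X \<and> nx X x \<preceq> y" for y
  proof
    assume "y \<in> minus_least ?Y"
    then obtain w where "y \<in> X" "x \<preceq> w" "w \<prec> y" unfolding minus_least_def by blast
    moreover from this have "x \<prec> y" by order
    ultimately show "y \<in> X \<and> nx X x \<preceq> y" using nx(3)[OF X] by blast
  next
    assume y: "y \<in> X \<and> nx X x \<preceq> y"
    then have "x \<prec> y" using nx(2)[OF X, of x] by (blast intro: N.less_le_trans)
    then show "y \<in> minus_least ?Y" using x y unfolding minus_least_def by (auto simp: N.less_imp_le)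
  qed
  have "init_seg (elts (seg X x z)) ?Y"
    unfolding init_seg_def elts_seg[OF X_sets[OF X]] using N.order_trans N.less_imp_le by blast
  moreover have "init_seg (elts (seg X (nx X x) z')) (minus_least ?Y)"
    unfolding init_seg_def elts_seg[OF X_sets[OF X]] Ball_def subset_eq Y using N.order_trans N.less_imp_le by blast
  ultimately show ?thesis unfolding tri_def infinite_set_def by blast
qed

lemma en_agree:
  assumes X: "infinite_set X" and Y: "infinite_set Y" and "agree X Y z" "en X i \<preceq> z"
  shows "en Y i = en X i"
proof -
  have "en X i \<preceq> z \<longrightarrow> en Y i = en X i"
  proof (rule D1_induct[where P = "\<lambda>i. en X i \<preceq> z \<longrightarrow> en Y i = en X i"])
    show "D1 (\<lambda>e. en X (e 0) \<preceq> z \<longrightarrow> en Y (e 0) = en X (e 0))"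
      by (intro D1_imp D1_leq D1_eq F1_en X Y F1_var F1_const)
    show "en X \<zero> \<preceq> z \<longrightarrow> en Y \<zero> = en X \<zero>"
    proof
      assume z: "en X \<zero> \<preceq> z"
      then have "en X \<zero> \<in> Y" using en_zero_in[OF X] assms(3) unfolding agree_def by blast
      then have le: "en Y \<zero> \<preceq> en X \<zero>" by (rule en_least[OF Y])
      then have "en Y \<zero> \<preceq> z" using z by order
      then have "en Y \<zero> \<in> X" using en_zero_in[OF Y] assms(3) unfolding agree_def by blast
      then have "en X \<zero> \<preceq> en Y \<zero>" by (rule en_least[OF X])
      with le show "en Y \<zero> = en X \<zero>" by order
    qed
    fix i assume IH: "en X i \<preceq> z \<longrightarrow> en Y i = en X i"
    show "en X (i \<oplus> \<one>) \<preceq> z \<longrightarrow> en Y (i \<oplus> \<one>) = en X (i \<oplus> \<one>)"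
      unfolding en_succ[OF X] en_succ[OF Y]
    proof
      let ?x = "en X i"
      assume z: "nx X ?x \<preceq> z"
      then have "?x \<preceq> z" using nx(2)[OF X, of ?x] by order
      then have eq: "en Y i = ?x" using IH by blast
      have "nx X ?x \<in> Y" using nx(1)[OF X] z assms(3) unfolding agree_def by blast
      then have le: "nx Y ?x \<preceq> nx X ?x" using nx(2)[OF X] by (rule nx(3)[OF Y])
      then have "nx Y ?x \<preceq> z" using z by order
      then have "nx Y ?x \<in> X" using nx(1)[OF Y] assms(3) unfolding agree_def by blast
      then have "nx X ?x \<preceq> nx Y ?x" using nx(2)[OF Y] by (rule nx(3)[OF X])
      with le show "nx Y (en Y i) = nx X ?x" unfolding eq by order
    qed
  qed
  then show ?thesis using assms(4) by blast
qed

text \<open>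
  The part of \<open>X\<close> up to \<open>z\<close> is a union \<open>s\<^sub>0 \<union> \<dots> \<union> s\<^sub>n\<close> of members of \<open>B\<close>, where \<open>s\<^sub>i\<close> starts at the
  \<open>i\<close>-th element of \<open>X\<close>.  The length \<open>n = g z0\<close> depends monotonically on the maximum \<open>z0\<close> of \<open>s\<^sub>0\<close>:
  this makes the resulting block a barrier.
\<close>

definition chain :: "'a set \<Rightarrow> 'a \<Rightarrow> 'a \<Rightarrow> bool" where
  "chain X z0 z \<longleftrightarrow> z0 \<preceq> z \<and> spans X (en X \<zero>) z0 \<and> spans X (en X (g z0)) z \<and>
    (\<forall>i. i \<prec> g z0 \<oplus> \<one> \<longrightarrow> (\<exists>z'. z' \<prec> z \<oplus> \<one> \<and> spans X (en X i) z'))"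

lemma chainD:
  assumes "chain X z0 z" "i \<preceq> g z0"
  obtains z' where "z' \<preceq> z" "spans X (en X i) z'"
  using assms unfolding chain_def less_succ_iff_leq by blast

lemma spans_leq: "spans X x z \<Longrightarrow> x \<preceq> z"
  unfolding spans_def by blast

lemma chain_agree:
  assumes X: "infinite_set X" and Y: "infinite_set Y" and XY: "agree X Y z" and chain: "chain X z0 z"
  shows "chain Y z0 z"
proof -
  have *: "spans Y (en Y i) z'" if "spans X (en X i) z'" "z' \<preceq> z" for i z'
  proof -
    have "en X i \<preceq> z" using spans_leq[OF that(1)] that(2) by order
    then have "en Y i = en X i" by (rule en_agree[OF X Y XY])
    then show ?thesis using spans_agree[OF agree_leq[OF XY that(2)] that(1)] by simp
  qed
  show ?thesis
    using chain unfolding chain_def less_succ_iff_leq using * by (metis N.order_refl)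
qed

lemma chain_exists:
  assumes X: "infinite_set X" "X \<subseteq> base B"
  obtains z0 z where "chain X z0 z"
proof -
  obtain z0 where z0: "spans X (en X \<zero>) z0" using spans_exists[OF X en_in[OF X(1)]] by blast
  obtain z where z: "spans X (en X (g z0)) z" using spans_exists[OF X en_in[OF X(1)]] by blast
  have "\<exists>z'. z' \<preceq> z \<and> spans X (en X i) z'" if "i \<preceq> g z0" for i
  proof -
    obtain z' where z': "spans X (en X i) z'" using spans_exists[OF X en_in[OF X(1)]] by blast
    then have "z' \<preceq> z" by (rule spans_mono[OF X_sets[OF X(1)] _ z en_mono[OF X(1) that]])
    then show ?thesis using z' by blast
  qed
  moreover have "z0 \<preceq> z" by (rule spans_mono[OF X_sets[OF X(1)] z0 z en_mono[OF X(1) leq_zero]])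
  ultimately show thesis using z0 z that unfolding chain_def less_succ_iff_leq by blast
qed

text \<open>The reason why unions of members form an antichain. If the X-part is included in the
  Y-part, the Y-chain has no more members than the X-chain. Its last member is compared with the
  X-member of the same index; these turn out equal, and from there the enumerations are matched
  downwards.\<close>

lemma chain_antichain:
  assumes X: "infinite_set X" and Y: "infinite_set Y"
    and cX: "chain X x0 x" and cY: "chain Y y0 y"
    and sub: "\<And>w. w \<in> X \<Longrightarrow> w \<preceq> x \<Longrightarrow> w \<in> Y \<and> w \<preceq> y"
    and w: "w \<in> Y" "w \<preceq> y"
  shows "w \<in> X \<and> w \<preceq> x"
proof -
  note sX = X_sets[OF X] and sY = X_sets[OF Y]
  have ends: "z' \<preceq> z" if "spans X (en X i) z" "spans Y (en Y i) z'" "en Y i \<preceq> en X i" "z \<preceq> x" for i z z'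
  proof (rule ccontr)
    assume "\<not> z' \<preceq> z"
    then have less: "z \<prec> z'" by order
    have "z = z'"
    proof (rule spans_antichain(2)[OF sX sY that(1,2)])
      fix v assume v: "v \<in> X" "en X i \<preceq> v" "v \<preceq> z"
      moreover have "v \<preceq> x" "en Y i \<preceq> v" "v \<preceq> z'" using v that(3,4) less by order+
      ultimately show "v \<in> Y \<and> en Y i \<preceq> v \<and> v \<preceq> z'" using sub by blast
    qed
    then show False using less by order
  qed
  have X0: "spans X (en X \<zero>) x0" "x0 \<preceq> x" and Y0: "spans Y (en Y \<zero>) y0"
    and Yn: "spans Y (en Y (g y0)) y"
    using cX cY unfolding chain_def by auto
  have "en X \<zero> \<preceq> x" using spans_leq[OF X0(1)] X0(2) by order
  then have base: "en Y \<zero> \<preceq> en X \<zero>" using sub en_in[OF X] en_least[OF Y] by blast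
  \<comment> \<open>The first member in Y starts no later than that in X, so it ends no later. Here
    monotonicity of \<open>g\<close> enters: the X-chain is at least as long.\<close>
  then have "y0 \<preceq> x0" using ends[OF X0(1) Y0 _ X0(2)] by blast
  then have n: "g y0 \<preceq> g x0" by (rule g_mono)
  have inX: "\<exists>z. spans X (en X i) z \<and> z \<preceq> x" if "i \<preceq> g y0" for i
  proof -
    have "i \<preceq> g x0" using that n by order
    then show ?thesis using chainD[OF cX] by blast
  qed
  have en_leq: "i \<preceq> g y0 \<longrightarrow> en Y i \<preceq> en X i" for i
  proof (rule D1_induct[where P = "\<lambda>i. i \<preceq> g y0 \<longrightarrow> en Y i \<preceq> en X i"])
    show "D1 (\<lambda>e. e 0 \<preceq> g y0 \<longrightarrow> en Y (e 0) \<preceq> en X (e 0))"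
      by (intro D1_imp D1_leq F1_en X Y F1_var F1_const)
    fix i assume IH: "i \<preceq> g y0 \<longrightarrow> en Y i \<preceq> en X i"
    show "i \<oplus> \<one> \<preceq> g y0 \<longrightarrow> en Y (i \<oplus> \<one>) \<preceq> en X (i \<oplus> \<one>)"
    proof
      assume i: "i \<oplus> \<one> \<preceq> g y0"
      then have "i \<preceq> g y0" unfolding succ_leq_iff_less by order
      then have "en Y i \<preceq> en X i" using IH by blast
      moreover have "en X i \<prec> en X (i \<oplus> \<one>)" by (rule en_less[OF X]) (simp add: less_succ)
      ultimately have less: "en Y i \<prec> en X (i \<oplus> \<one>)" by order
      obtain z where "spans X (en X (i \<oplus> \<one>)) z" "z \<preceq> x" using inX[OF i] by blast
      moreover from this have "en X (i \<oplus> \<one>) \<preceq> x" using spans_leq by (blast intro: N.order_trans)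
      ultimately have "en X (i \<oplus> \<one>) \<in> Y" using sub en_in[OF X] by blast
      then show "en Y (i \<oplus> \<one>) \<preceq> en X (i \<oplus> \<one>)" unfolding en_succ[OF Y] using less by (rule nx(3)[OF Y])
    qed
  qed (use base in blast)
  \<comment> \<open>One inequality between the endpoints comes from \<open>ends\<close>, the other
    from the inclusion. The antichain property then identifies this member with the last one of Y,
    including the starting points.\<close>
  obtain z where z: "spans X (en X (g y0)) z" "z \<preceq> x" using inX by blast
  then have "y \<preceq> z" using ends[OF z(1) Yn _ z(2)] en_leq by blast
  moreover have "z \<preceq> y" using sub z unfolding spans_def by blast
  ultimately have zy: "z = y" by order
  have last: "v \<in> Y \<and> en Y (g y0) \<preceq> v \<and> v \<preceq> y" if "v \<in> X" "en X (g y0) \<preceq> v" "v \<preceq> z" for v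
  proof -
    have "en Y (g y0) \<preceq> en X (g y0)" using en_leq by blast
    then have "v \<preceq> x" "en Y (g y0) \<preceq> v" using that z(2) by order+
    then show ?thesis using sub that zy by blast
  qed
  note last = spans_antichain(1,3)[OF sX sY z(1) Yn last]
  show ?thesis
  proof (cases "en Y (g y0) \<preceq> w")
    case True
    then have "w \<in> {v \<in> Y. en Y (g y0) \<preceq> v \<and> v \<preceq> y}" using w by blast
    then have "w \<in> {v \<in> X. en X (g y0) \<preceq> v \<and> v \<preceq> z}" by (simp only: last(2))
    then show ?thesis using z(2) by (auto intro: N.order_trans)
  next
    case False
    obtain i where i: "w = en Y i" using en_surj[OF Y w(1)] by blast
    have "\<not> g y0 \<preceq> i" using False en_mono[OF Y] unfolding i by blast
    then have "i \<preceq> g y0" by order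
    then obtain k where k: "g y0 = i \<oplus> k" unfolding leq_iff_add by blast
    \<comment> \<open>Downward induction from index \<open>g y0\<close>, phrased through the
      distance k to it. The i-th point of X lies in Y before the (i + 1)-st point of Y, so it is at
      most the i-th point of Y; \<open>en_leq\<close> gives the converse.\<close>
    let ?P = "\<lambda>k. \<forall>i. i \<prec> g y0 \<oplus> \<one> \<longrightarrow> i \<oplus> k = g y0 \<longrightarrow> en X i = en Y i"
    have P: "?P k"
    proof (rule D1_induct[where P = ?P])
      show "D1 (\<lambda>e. ?P (e 0))"
        by (intro D1_ball D1_imp D1_eq F1_en X Y F1_add F1_var F1_const)
      show "?P \<zero>" using last(1) by (simp add: add_zero)
      fix k assume IH: "?P k"
      show "?P (k \<oplus> \<one>)"
      proof (intro allI impI)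
        fix i assume i: "i \<prec> g y0 \<oplus> \<one>" "i \<oplus> (k \<oplus> \<one>) = g y0"
        then have i1: "i \<oplus> \<one> \<oplus> k = g y0" by (simp only: add_succ succ_add)
        then have "i \<oplus> \<one> \<preceq> g y0" unfolding leq_iff_add by metis
        then have eq: "en X (i \<oplus> \<one>) = en Y (i \<oplus> \<one>)" using IH i1 unfolding less_succ_iff_leq by blast
        have i': "i \<preceq> g y0" using i(1) unfolding less_succ_iff_leq .
        then obtain v where "spans X (en X i) v" "v \<preceq> x" using inX by blast
        then have "en X i \<preceq> x" using spans_leq by (blast intro: N.order_trans)
        then have XY: "en X i \<in> Y" using sub en_in[OF X] by blast
        have "en X i \<prec> nx Y (en Y i)"
          using en_less[OF X, of i "i \<oplus> \<one>"] unfolding eq en_succ[OF Y, symmetric] by (simp add: less_succ)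
        then have "\<not> en Y i \<prec> en X i" using nx(3)[OF Y XY] N.not_le by blast
        moreover have "en Y i \<preceq> en X i" using en_leq i' by blast
        ultimately show "en X i = en Y i" by order
      qed
    qed
    have "i \<prec> g y0 \<oplus> \<one>" unfolding less_succ_iff_leq by fact
    then have "en X i = w" unfolding i using P k[symmetric] by simp
    moreover obtain v where "spans X (en X i) v" "v \<preceq> x" using inX[OF \<open>i \<preceq> g y0\<close>] by blast
    moreover from this have "en X i \<preceq> x" using spans_leq by (blast intro: N.order_trans)
    ultimately show ?thesis using en_in[OF X, of i] by simp
  qed
qed

text \<open>
  Every coded finite set is completed to an infinite set of which it is an initial segment, using
  that its elements are smaller than its code.
\<close>

definition ext :: "'a \<Rightarrow> 'a set" where
  "ext u = {x. x \<in> elts u \<or> u \<preceq> x}"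

lemma D1_ext: "F1 f \<Longrightarrow> F1 h \<Longrightarrow> D1 (\<lambda>e. f e \<in> ext (h e))"
  unfolding ext_def mem_Collect_eq by (intro D1_disj D1_elts D1_leq)

lemma ext_unbounded: "\<exists>y. y \<in> ext u \<and> x \<prec> y"
  unfolding ext_def using leq_add1[of u "x \<oplus> \<one>"] less_sum2[of x u] by (auto simp: add_succ)

lemma ext_infinite: "infinite_set (ext u)"
proof -
  have "{x. x \<in> ext u} \<in> sets M" by (intro D1_set D1_ext F1_var F1_const)
  then show ?thesis unfolding infinite_set_def infinite_class_def using ext_unbounded[of u] by auto
qed

lemmas ext_sets = X_sets[OF ext_infinite]

lemma F1_seg_ext: "F1 f \<Longrightarrow> F1 h \<Longrightarrow> F1 k \<Longrightarrow> F1 (\<lambda>e. seg (ext (f e)) (h e) (k e))"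
  by (rule F1_comp3[where k = "\<lambda>u. seg (ext u)"])
    (unfold seg_def, intro F1_cd D1_conj D1_ext D1_leq F1_add F1_var F1_const)

lemma D1_spans_ext: "F1 f \<Longrightarrow> F1 h \<Longrightarrow> F1 k \<Longrightarrow> D1 (\<lambda>e. spans (ext (f e)) (h e) (k e))"
  unfolding spans_def by (intro D1_conj D1_ext D1_leq D1_mem B_sets F1_seg_ext)

lemma F1_en_ext: "F1 f \<Longrightarrow> F1 h \<Longrightarrow> F1 (\<lambda>e. en (ext (f e)) (h e))"
proof (rule F1_comp2[where k = "\<lambda>u. en (ext u)"])
  have "\<exists>y. y \<in> ext u" for u using ext_unbounded by blast
  then show "F1 (\<lambda>e. en (ext (e 0)) (e 1))"
    unfolding en_def nx_def
    by (intro F1_prec[of "\<lambda>u. mu (\<lambda>y. y \<in> ext u)" "\<lambda>u _ x. mu (\<lambda>y. y \<in> ext u \<and> x \<prec> y)"]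
        F1_mu D1_conj D1_ext D1_less ext_unbounded F1_var)
qed

text \<open>A quantifier over the sets containing \<open>u\<close> as an initial segment would not
  be Delta_1. By \<open>chain_agree\<close> all of them give the same answer, so the canonical
  \<open>ext u\<close> stands for them. The bounds by \<open>u\<close> lose nothing, since the
  endpoints are at most the maximum of \<open>u\<close>.\<close>

definition B' :: "'a set" where
  "B' = {u. fincode u \<and> (\<exists>z0. z0 \<prec> u \<and> (\<exists>z. z \<prec> u \<and> chain (ext u) z0 z \<and> (\<forall>y\<in>elts u. y \<preceq> z)))}"

lemma B'_sets: "B' \<in> sets M"
  unfolding B'_def chain_def
  by (intro D1_set D1_conj D1_fincode D1_bex D1_ball D1_ball_elts D1_spans_ext D1_leq
      F1_en_ext F1_comp1[OF F1_g] F1_add F1_var F1_const)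

lemma B'E:
  assumes "u \<in> B'"
  obtains z0 z where "chain (ext u) z0 z" "z \<prec> u" "z \<in> elts u" "elts u = {y \<in> ext u. y \<preceq> z}"
proof -
  obtain z0 z where z: "z \<prec> u" "chain (ext u) z0 z" "\<forall>y\<in>elts u. y \<preceq> z"
    using assms unfolding B'_def by blast
  have *: "y \<in> elts u" if "y \<in> ext u" "y \<preceq> z" for y
  proof -
    have "\<not> u \<preceq> y" using that(2) z(1) by order
    then show ?thesis using that(1) unfolding ext_def by blast
  qed
  then have "elts u = {y \<in> ext u. y \<preceq> z}" using z(3) unfolding ext_def by blast
  moreover have "z \<in> elts u" using * z(2) unfolding chain_def spans_def by blast
  ultimately show thesis using that z by blast
qed

text \<open>The points that \<open>ext\<close> adds are at least \<open>u\<close>, hence above every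
  element of \<open>u\<close>.\<close>

lemma init_seg_agree:
  assumes "init_seg (elts u) X" "z \<in> elts u"
  shows "agree (ext u) X z"
proof -
  have "z \<prec> u" by (rule elts_less[OF assms(2)])
  then have "\<not> u \<preceq> y" if "y \<preceq> z" for y using that by order
  moreover have "y \<in> elts u" if "y \<in> X" "y \<preceq> z" for y
    using assms that unfolding init_seg_def leq_def by blast
  ultimately show ?thesis using assms(1) unfolding agree_def ext_def init_seg_def by blast
qed

lemma B'_init_seg:
  assumes "u \<in> B'" "infinite_set X" "init_seg (elts u) X"
  obtains z0 z where "chain X z0 z" "z \<in> elts u" "agree (ext u) X z" "elts u = {y \<in> X. y \<preceq> z}"
proof -
  obtain z0 z where z: "chain (ext u) z0 z" "z \<prec> u" "z \<in> elts u" "elts u = {y \<in> ext u. y \<preceq> z}"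
    using B'E[OF assms(1)] by blast
  have a: "agree (ext u) X z" by (rule init_seg_agree[OF assms(3) z(3)])
  then have "elts u = {y \<in> X. y \<preceq> z}" unfolding z(4) agree_def by blast
  then show thesis using that chain_agree[OF ext_infinite assms(2) a z(1)] z(3) a by blast
qed

lemma initial_code:
  assumes X: "infinite_set X" and z: "z \<in> X"
  defines "u \<equiv> cd {y. y \<prec> z \<oplus> \<one> \<and> y \<in> X}"
  shows "fincode u" "elts u = {y \<in> X. y \<preceq> z}" "z \<in> elts u" "init_seg (elts u) X" "agree X (ext u) z"
proof -
  have *: "coded {y. y \<prec> z \<oplus> \<one> \<and> y \<in> X}" by (rule coded_subset[OF X_sets[OF X] refl])
  show "fincode u" unfolding u_def by (rule coded_cd(1)[OF *])
  show e: "elts u = {y \<in> X. y \<preceq> z}" unfolding u_def coded_cd(2)[OF *] by (auto simp: less_succ_iff_leq)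
  show zu: "z \<in> elts u" unfolding e using z by simp
  show i: "init_seg (elts u) X" unfolding e init_seg_def by (auto intro: N.order_trans N.less_imp_le)
  show "agree X (ext u) z" by (rule agree_sym[OF init_seg_agree[OF i zu]])
qed

lemma B'_exists:
  assumes X: "infinite_set X" and chain: "chain X z0 z"
  obtains u where "u \<in> B'" "elts u = {y \<in> X. y \<preceq> z}" "init_seg (elts u) X" "z \<in> elts u"
proof -
  have z: "z \<in> X" using chain unfolding chain_def spans_def by blast
  define u where "u = cd {y. y \<prec> z \<oplus> \<one> \<and> y \<in> X}"
  note u = initial_code[OF X z, folded u_def]
  have "chain (ext u) z0 z" by (rule chain_agree[OF X ext_infinite u(5) chain])
  moreover have "z \<prec> u" by (rule elts_less[OF u(3)])
  moreover have "z0 \<prec> u" using \<open>z \<prec> u\<close> chain unfolding chain_def by (blast intro: N.le_less_trans)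
  ultimately have "u \<in> B'" unfolding B'_def using u(1,2) by blast
  then show thesis using that u(2-4) by blast
qed

text \<open>A point with index at most \<open>g z0\<close> starts a member of the chain, and a later
  one lies in the last member. The inclusion lets the block property of \<open>B\<close> act on sets
  inside the new base.\<close>

lemma base_B': "base B' \<subseteq> base B"
proof
  fix x assume "x \<in> base B'"
  then obtain u where "u \<in> B'" "x \<in> elts u" unfolding base_def by blast
  then obtain z0 z where z: "chain (ext u) z0 z" "x \<in> ext u" "x \<preceq> z" using B'E by blast
  obtain i where i: "x = en (ext u) i" using en_surj[OF ext_infinite z(2)] by blast
  obtain x' z' where "spans (ext u) x' z'" "x' \<preceq> x" "x \<preceq> z'"
  proof (cases "i \<preceq> g z0")
    case True
    then obtain z' where "spans (ext u) x z'" using chainD[OF z(1)] i by blast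
    then show thesis using that spans_leq by blast
  next
    case False
    then have "g z0 \<preceq> i" by order
    then have "en (ext u) (g z0) \<preceq> x" unfolding i by (rule en_mono[OF ext_infinite])
    then show thesis using that z unfolding chain_def by blast
  qed
  then have "x \<in> elts (seg (ext u) x' z')" "seg (ext u) x' z' \<in> B"
    unfolding elts_seg[OF ext_sets] spans_def using z(2) by blast+
  then show "x \<in> base B" unfolding base_def by blast
qed

lemma B'_antichain:
  assumes "u \<in> B'" "v \<in> B'" "elts u \<subseteq> elts v" shows "elts u = elts v"
proof
  obtain x0 x where x: "chain (ext u) x0 x" "elts u = {y \<in> ext u. y \<preceq> x}" using B'E[OF assms(1)] by blast
  obtain y0 y where y: "chain (ext v) y0 y" "elts v = {w \<in> ext v. w \<preceq> y}" using B'E[OF assms(2)] by blast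
  show "elts v \<subseteq> elts u"
  proof
    fix w assume "w \<in> elts v"
    then have "w \<in> ext u \<and> w \<preceq> x"
      using assms(3) unfolding x(2) y(2) by (intro chain_antichain[OF ext_infinite ext_infinite x(1) y(1)]) blast+
    then show "w \<in> elts u" unfolding x(2) by blast
  qed
qed (rule assms(3))

lemma barrier_B': "barrier B'"
  unfolding barrier_def block_def
proof (intro conjI)
  show "B' \<in> sets M" by (rule B'_sets)
  show "\<forall>s\<in>B'. fincode s" unfolding B'_def by blast
  show "infinite_class (base B')"
    unfolding infinite_class_def
  proof
    fix m
    \<comment> \<open>Chains exist only in sets of the model, so the class \<open>base B\<close> is
      first thinned out to a set; a chain in its tail above m supplies an element beyond m.\<close>
    obtain X where X: "infinite_set X" "X \<subseteq> base B"
      using infinite_subset_of_base[OF B_sets B_base] by blast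
    let ?Y = "{y \<in> X. m \<prec> y}"
    have Y: "infinite_set ?Y" by (rule infinite_tail[OF X(1) D1_less[OF F1_const F1_var]])
    obtain z0 z where z: "chain ?Y z0 z" using chain_exists[OF Y] X(2) by blast
    obtain u where "u \<in> B'" "elts u = {y \<in> ?Y. y \<preceq> z}" "z \<in> elts u" using B'_exists[OF Y z] by blast
    then show "\<exists>n\<in>base B'. m \<prec> n" unfolding base_def by blast
  qed
  show "\<forall>X\<in>sets M. infinite_class X \<and> X \<subseteq> base B' \<longrightarrow> (\<exists>s\<in>B'. init_seg (elts s) X)"
  proof (intro ballI impI)
    fix X assume "X \<in> sets M" and X: "infinite_class X \<and> X \<subseteq> base B'"
    then have inf: "infinite_set X" unfolding infinite_set_def by blast
    obtain z0 z where z: "chain X z0 z" using chain_exists[OF inf] X base_B' by blast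
    then show "\<exists>s\<in>B'. init_seg (elts s) X" using B'_exists[OF inf z] by blast
  qed
  show "\<forall>s\<in>B'. \<forall>t\<in>B'. \<not> (init_seg (elts s) (elts t) \<and> elts s \<noteq> elts t)"
    using B'_antichain unfolding init_seg_def by blast
  show "\<forall>s\<in>B'. \<forall>t\<in>B'. \<not> elts s \<subset> elts t"
    using B'_antichain by blast
qed

end

section \<open>The bad array on \<open>Q\<close>\<close>

locale bad_array = Hf +
  fixes B F
  assumes B: "barrier B" and F: "function_from_to F B H"
    and bad: "s \<in> B \<Longrightarrow> t \<in> B \<Longrightarrow> s \<lhd> t \<Longrightarrow> pair s p \<in> F \<Longrightarrow> pair t q \<in> F \<Longrightarrow> pair p q \<notin> L"
begin

text \<open>The value zero outside \<open>B\<close> makes the function total while its graph stays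
  Delta_1.\<close>

definition fv :: "'a \<Rightarrow> 'a" where
  "fv s = (if s \<in> B then THE v. pair s v \<in> F else \<zero>)"

lemma F_sets: "F \<in> sets M"
  using F unfolding function_from_to_def by blast

lemma fv_iff: "s \<in> B \<Longrightarrow> v = fv s \<longleftrightarrow> pair s v \<in> F"
proof -
  assume s: "s \<in> B"
  then have "\<exists>!v. pair s v \<in> F" using F unfolding function_from_to_def by blast
  then show ?thesis unfolding fv_def using s the1_equality theI' by (metis (mono_tags, lifting))
qed

lemma fv_H: "s \<in> B \<Longrightarrow> fv s \<in> H"
proof -
  assume "s \<in> B"
  then have "pair s (fv s) \<in> F" using fv_iff by blast
  then show ?thesis using F unfolding function_from_to_def by (auto simp: pair_inject)
qed

lemma fv_bad: "s \<in> B \<Longrightarrow> t \<in> B \<Longrightarrow> s \<lhd> t \<Longrightarrow> pair (fv s) (fv t) \<notin> L"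
  using bad fv_iff by blast

lemma F1_fv: "F1 f \<Longrightarrow> F1 (\<lambda>e. fv (f e))"
proof (rule F1_comp1[where k = fv], rule F1I, rule D1_S1)
  have B: "B \<in> sets M" using B unfolding barrier_def block_def by blast
  have "z = fv s \<longleftrightarrow> (if s \<in> B then pair s z \<in> F else z = \<zero>)" for z s
    using fv_iff by (simp add: fv_def)
  then show "D1 (\<lambda>e. e 0 = fv (e (Suc 0)))"
    by (simp only:) (intro D1_if D1_mem B F_sets D1_eq F1_pair F1_var F1_const)
qed

end

locale bad_array_bound = bad_array + refinement +
  assumes g_bound: "fincode s \<Longrightarrow> \<forall>i\<in>elts s. i \<preceq> m \<Longrightarrow> fv s \<prec> g m"
begin

text \<open>The bound \<open>u\<close> suffices because the members in a chain for \<open>u\<close>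
  end at most at the maximum of \<open>u\<close>.\<close>

definition endpoint :: "'a \<Rightarrow> 'a \<Rightarrow> 'a" where
  "endpoint u i = bmu u (\<lambda>z. spans (ext u) (en (ext u) i) z)"

definition start :: "'a \<Rightarrow> 'a \<Rightarrow> 'a" where
  "start u i = fv (seg (ext u) (en (ext u) i) (endpoint u i))"

lemma F1_endpoint: "F1 f \<Longrightarrow> F1 h \<Longrightarrow> F1 (\<lambda>e. endpoint (f e) (h e))"
  by (rule F1_comp2[where k = endpoint])
    (unfold endpoint_def, intro F1_bmu D1_spans_ext F1_en_ext F1_var)

lemma F1_start: "F1 f \<Longrightarrow> F1 h \<Longrightarrow> F1 (\<lambda>e. start (f e) (h e))"
  by (rule F1_comp2[where k = start])
    (unfold start_def, intro F1_fv F1_seg_ext F1_en_ext F1_endpoint F1_var)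

lemma endpoint_eq:
  assumes "spans (ext u) (en (ext u) i) z" "z \<prec> u" shows "endpoint u i = z"
proof -
  have "D1 (\<lambda>e. spans (ext u) (en (ext u) i) (e 0))" by (intro D1_spans_ext F1_var F1_const)
  then have "spans (ext u) (en (ext u) i) (endpoint u i)"
    unfolding endpoint_def by (rule bmu(1)[where P = "\<lambda>z. spans (ext u) (en (ext u) i) z", OF _ assms(2,1)])
  then show ?thesis by (rule spans_unique[OF ext_sets _ assms(1)])
qed

lemma start_eq:
  assumes "spans (ext u) (en (ext u) i) z" "z \<prec> u"
  shows "start u i = fv (seg (ext u) (en (ext u) i) z)"
  unfolding start_def endpoint_eq[OF assms] ..

text \<open>The least bound by \<open>mu\<close> only provides the explicit bound under which a set
  can be coded.\<close>

definition code :: "'a \<Rightarrow> 'a \<Rightarrow> 'a" where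
  "code u n = cd {z. z \<prec> mu (\<lambda>b. \<forall>i. i \<prec> n \<longrightarrow> pair i (start u i) \<prec> b) \<and>
    (\<exists>i. i \<prec> n \<and> z = pair i (start u i))}"

lemma D1_code1: "F1 f \<Longrightarrow> F1 h \<Longrightarrow> F1 k \<Longrightarrow> D1 (\<lambda>e. \<forall>i. i \<prec> f e \<longrightarrow> pair i (start (h e) i) \<prec> k e)"
  by (rule D1_comp3[where r = "\<lambda>n u b. \<forall>i. i \<prec> n \<longrightarrow> pair i (start u i) \<prec> b"])
    (intro D1_ball D1_less F1_pair F1_start F1_var)

lemma D1_code2: "F1 f \<Longrightarrow> F1 h \<Longrightarrow> F1 k \<Longrightarrow> D1 (\<lambda>e. \<exists>i. i \<prec> f e \<and> k e = pair i (start (h e) i))"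
  by (rule D1_comp3[where r = "\<lambda>n u z. \<exists>i. i \<prec> n \<and> z = pair i (start u i)"])
    (intro D1_bex D1_eq F1_pair F1_start F1_var)

lemma code_bound: "\<exists>b. \<forall>i. i \<prec> n \<longrightarrow> pair i (start u i) \<prec> b"
  by (rule F1_bounded[of "\<lambda>i. pair i (start u i)" n]) (intro F1_pair F1_start F1_var F1_const, blast)

lemma F1_code: "F1 f \<Longrightarrow> F1 h \<Longrightarrow> F1 (\<lambda>e. code (f e) (h e))"
  by (rule F1_comp2[where k = code])
    (unfold code_def, intro F1_cd F1_mu D1_code1 D1_code2 code_bound F1_var)

lemma app_code:
  assumes "i \<prec> n" shows "app (code u n) i = start u i" "pair i (app (code u n) i) \<in> elts (code u n)"
proof -
  let ?b = "mu (\<lambda>b. \<forall>i. i \<prec> n \<longrightarrow> pair i (start u i) \<prec> b)"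
  have "\<forall>i. i \<prec> n \<longrightarrow> pair i (start u i) \<prec> ?b"
    by (rule mu(1)[OF D1_code1[OF F1_const F1_const F1_var] code_bound])
  moreover have e: "elts (code u n) = {z. z \<prec> ?b \<and> (\<exists>i. i \<prec> n \<and> z = pair i (start u i))}"
    unfolding code_def by (intro coded_cd(2) coded_Collect D1_code2 F1_var F1_const)
  ultimately have *: "pair i (start u i) \<in> elts (code u n)" unfolding e using assms by blast
  then show "app (code u n) i = start u i" by (rule app_eq) (auto simp: e pair_inject)
  then show "pair i (app (code u n) i) \<in> elts (code u n)" using * by simp
qed

lemma bad_code:
  assumes u: "\<And>i. i \<prec> n \<Longrightarrow> \<exists>z. z \<prec> u \<and> spans (ext u) (en (ext u) i) z"
  shows "bad_code (code u n) n"
  unfolding bad_code_def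
proof (intro conjI allI impI)
  fix i assume i: "i \<prec> n"
  show "pair i (app (code u n) i) \<in> elts (code u n)" by (rule app_code(2)[OF i])
  obtain z where z: "z \<prec> u" "spans (ext u) (en (ext u) i) z" using u[OF i] by blast
  then show "app (code u n) i \<in> H"
    unfolding app_code(1)[OF i] start_eq[OF z(2,1)] spans_def by (intro fv_H) blast
next
  fix i assume i: "i \<oplus> \<one> \<prec> n"
  obtain z where z: "z \<prec> u" "spans (ext u) (en (ext u) i) z" using u[OF less_succD[OF i]] by blast
  obtain z' where z': "z' \<prec> u" "spans (ext u) (en (ext u) (i \<oplus> \<one>)) z'" using u[OF i] by blast
  have "seg (ext u) (en (ext u) i) z \<lhd> seg (ext u) (en (ext u) (i \<oplus> \<one>)) z'"
    using z(2) z'(2) unfolding en_succ[OF ext_infinite] by (rule spans_tri[OF ext_infinite])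
  then show "pair (app (code u n) i) (app (code u n) (i \<oplus> \<one>)) \<notin> L"
    using z(2) z'(2)
    unfolding app_code(1)[OF i] app_code(1)[OF less_succD[OF i]] start_eq[OF z(2,1)] start_eq[OF z'(2,1)]
      spans_def by (intro fv_bad) blast+
qed

definition rounds :: "'a \<Rightarrow> 'a" where
  "rounds u = g (endpoint u \<zero>)"

text \<open>Round k at place zero uses the places zero to k, hence the length
  \<open>rounds u \<oplus> \<one>\<close>.\<close>

definition result :: "'a \<Rightarrow> 'a" where
  "result u = entry (code u (rounds u \<oplus> \<one>)) \<zero> (rounds u)"

lemma F1_result: "F1 f \<Longrightarrow> F1 (\<lambda>e. result (f e))"
  by (rule F1_comp1[where k = result])
    (unfold result_def rounds_def,
      intro F1_entry F1_code F1_add F1_comp1[OF F1_g] F1_endpoint F1_var F1_const)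

lemma start_zero_less:
  assumes "spans (ext u) (en (ext u) \<zero>) z" "z \<prec> u"
  shows "start u \<zero> \<prec> g z"
  unfolding start_eq[OF assms]
proof (rule g_bound)
  show "fincode (seg (ext u) (en (ext u) \<zero>) z)"
    using assms(1) B_fincode unfolding spans_def by blast
qed (simp add: elts_seg[OF ext_sets])

lemma rounds_eq: "chain (ext u) z0 z \<Longrightarrow> z \<prec> u \<Longrightarrow> rounds u = g z0"
proof -
  assume "chain (ext u) z0 z" "z \<prec> u"
  then have "spans (ext u) (en (ext u) \<zero>) z0" "z0 \<prec> u" unfolding chain_def by (auto intro: N.le_less_trans)
  then show ?thesis unfolding rounds_def by (simp add: endpoint_eq)
qed

text \<open>The value at the first member is below \<open>g z0\<close>, which is the number of
  rounds, so no set is left at place zero.\<close>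

lemma result_ur:
  assumes "u \<in> B'" obtains q where "q \<in> Q" "result u = ur q"
proof -
  obtain z0 z where z: "chain (ext u) z0 z" "z \<prec> u" using B'E[OF assms] by blast
  let ?n = "g z0"
  have z0: "spans (ext u) (en (ext u) \<zero>) z0" "z0 \<prec> u"
    using z unfolding chain_def by (auto intro: N.le_less_trans)
  have "\<exists>z. z \<prec> u \<and> spans (ext u) (en (ext u) i) z" if "i \<prec> ?n \<oplus> \<one>" for i
  proof -
    have "i \<preceq> ?n" using that unfolding less_succ_iff_leq .
    then obtain z' where "z' \<preceq> z" "spans (ext u) (en (ext u) i) z'" using chainD[OF z(1)] by blast
    then show ?thesis using z(2) by (blast intro: N.le_less_trans)
  qed
  then have "bad_code (code u (?n \<oplus> \<one>)) (?n \<oplus> \<one>)" by (rule bad_code)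
  moreover have "app (code u (?n \<oplus> \<one>)) \<zero> \<prec> ?n"
    using start_zero_less[OF z0] leq_zero[of ?n] by (simp add: app_code(1) less_succ_iff_leq)
  moreover have "?n \<prec> ?n \<oplus> \<one>" by (simp add: less_succ)
  ultimately obtain q where "q \<in> Q" "entry (code u (?n \<oplus> \<one>)) \<zero> ?n = ur q" by (rule entry_ur)
  then show thesis using that unfolding result_def rounds_eq[OF z] by blast
qed

definition F' :: "'a set" where
  "F' = {p. \<exists>u. u \<prec> p \<oplus> \<one> \<and> (\<exists>q. q \<prec> p \<oplus> \<one> \<and> p = pair u q \<and> u \<in> B' \<and> result u = ur q)}"

lemma pair_F': "pair u q \<in> F' \<longleftrightarrow> u \<in> B' \<and> result u = ur q"
  unfolding F'_def less_succ_iff_leq using leq_pair by (auto simp: pair_inject)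

lemma function_F': "function_from_to F' B' Q"
  unfolding function_from_to_def
proof (intro conjI ballI)
  show "F' \<in> sets M"
    unfolding F'_def by (intro D1_set D1_bex D1_conj D1_eq D1_mem B'_sets F1_result F1_ur F1_pair F1_add F1_var F1_const)
  show "\<exists>x\<in>B'. \<exists>y\<in>Q. z = pair x y" if z: "z \<in> F'" for z
  proof -
    obtain u q where uq: "z = pair u q" "u \<in> B'" "result u = ur q" using z unfolding F'_def by blast
    then have "q \<in> Q" using result_ur[OF uq(2)] by (metis ur_inject)
    then show ?thesis using uq by blast
  qed
  show "\<exists>!q. pair u q \<in> F'" if u: "u \<in> B'" for u
    using result_ur[OF u] u unfolding pair_F' by (metis ur_inject)
qed

text \<open>
  Both \<open>result u\<close> and \<open>result v\<close> are entries of the descent on one long initial segment of the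
  witness \<open>X\<close> of \<open>u \<lhd> v\<close>, in the first and in the second column.
\<close>

lemma result_bad:
  assumes u: "u \<in> B'" and v: "v \<in> B'" and tri: "u \<lhd> v"
  shows "pair (result u) (result v) \<notin> L"
proof -
  obtain X where X: "infinite_set X" "init_seg (elts u) X" and v_init: "init_seg (elts v) (minus_least X)"
    using tri unfolding tri_def infinite_set_def by blast
  let ?Y = "minus_least X"
  have Y_eq: "?Y = {y \<in> X. en X \<zero> \<prec> y}"
  proof -
    have "en X \<zero> \<prec> y" if "w \<in> X" "w \<prec> y" for w y using en_least[OF X(1) that(1)] that(2) by order
    then show ?thesis unfolding minus_least_def using en_zero_in[OF X(1)] by blast
  qed
  have Y: "infinite_set ?Y"
    unfolding Y_eq by (rule infinite_tail[OF X(1) D1_less[OF F1_const F1_var]])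
  have nx_Y: "nx ?Y x = nx X x" if "x \<in> X" for x
  proof -
    have "en X \<zero> \<prec> y" if "x \<prec> y" for y using en_least[OF X(1) \<open>x \<in> X\<close>] that by order
    then have "(\<lambda>y. y \<in> ?Y \<and> x \<prec> y) = (\<lambda>y. y \<in> X \<and> x \<prec> y)" unfolding Y_eq by auto
    then show ?thesis unfolding nx_def by simp
  qed
  have en_Y: "en ?Y i = en X (i \<oplus> \<one>)" for i
  proof (rule D1_induct[where P = "\<lambda>i. en ?Y i = en X (i \<oplus> \<one>)"])
    show "D1 (\<lambda>e. en ?Y (e 0) = en X (e 0 \<oplus> \<one>))"
      by (intro D1_eq F1_en X Y F1_add F1_var F1_const)
    have "(\<lambda>y. y \<in> ?Y) = (\<lambda>y. y \<in> X \<and> en X \<zero> \<prec> y)" unfolding Y_eq by auto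
    then show "en ?Y \<zero> = en X (\<zero> \<oplus> \<one>)" unfolding en_succ[OF X(1)] en_zero[OF Y] nx_def by simp
    show "en ?Y (n \<oplus> \<one>) = en X (n \<oplus> \<one> \<oplus> \<one>)" if "en ?Y n = en X (n \<oplus> \<one>)" for n
      unfolding en_succ[OF Y] en_succ[OF X(1), of "n \<oplus> \<one>"] that by (rule nx_Y[OF en_in[OF X(1)]])
  qed
  have seg_Y: "seg ?Y x z = seg X x z" if "x \<in> ?Y" for x z
  proof -
    have "en X \<zero> \<prec> y" if "x \<preceq> y" for y using \<open>x \<in> ?Y\<close> that unfolding Y_eq by (blast intro: N.less_le_trans)
    then show ?thesis unfolding seg_def by (intro arg_cong[of _ _ cd]) (auto simp: Y_eq)
  qed
  have spans_Y: "spans X x z" if "spans ?Y x z" for x z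
    using that seg_Y[of x z] unfolding spans_def minus_least_def by auto
  obtain x0 x where cX: "chain X x0 x" "x \<in> elts u" "agree (ext u) X x"
    using B'_init_seg[OF u X] by blast
  obtain y0 y where cY: "chain ?Y y0 y" "y \<in> elts v" "agree (ext v) ?Y y"
    using B'_init_seg[OF v Y v_init] by blast
  let ?m = "g x0" and ?n = "g y0"
  have X_spans: "\<exists>z. z \<preceq> x \<and> spans X (en X i) z" if "i \<preceq> ?m" for i
    using chainD[OF cX(1) that] by blast
  have Y_spans: "\<exists>z. z \<preceq> y \<and> spans ?Y (en ?Y i) z" if "i \<preceq> ?n" for i
    using chainD[OF cY(1) that] by blast
  have x0: "spans X (en X \<zero>) x0" "x0 \<preceq> x" and y0: "spans ?Y (en ?Y \<zero>) y0" "y0 \<preceq> y"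
    and xm: "spans X (en X ?m) x" and yn: "spans ?Y (en ?Y ?n) y"
    using cX(1) cY(1) unfolding chain_def by auto
  note sX = X_sets[OF X(1)]
  \<comment> \<open>The first member of u starts before that of v and so ends no later; u therefore
    needs no more rounds than v.\<close>
  have "x0 \<preceq> y0"
    using spans_mono[OF sX x0(1) spans_Y[OF y0(1)] en_least[OF X(1)]] y0(1)
    unfolding spans_def minus_least_def by blast
  then have mn: "?m \<preceq> ?n" by (rule g_mono)
  have yX: "spans X (en X (?n \<oplus> \<one>)) y" using spans_Y[OF yn] unfolding en_Y .
  have "?m \<preceq> ?n \<oplus> \<one>" using mn leq_add1[of ?n \<one>] by order
  then have xy: "x \<preceq> y" using spans_mono[OF sX xm yX en_mono[OF X(1)]] by blast
  have y_in: "y \<in> X" using yX unfolding spans_def by blast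
  \<comment> \<open>The part of X up to the maximum of v includes u and v. It need not be coded in
    \<open>B'\<close>; it carries the common sequence in which the members for v are shifted by one
    place.\<close>
  define w where "w = cd {z. z \<prec> y \<oplus> \<one> \<and> z \<in> X}"
  note w = initial_code[OF X(1) y_in, folded w_def]
  have y_w: "y \<prec> w" by (rule elts_less[OF w(3)])
  have w_spans: "spans (ext w) (en (ext w) i) z \<and> z \<prec> w \<and>
      seg (ext w) (en (ext w) i) z = seg X (en X i) z"
    if "spans X (en X i) z" "z \<preceq> y" for i z
  proof -
    have "en X i \<preceq> y" using spans_leq[OF that(1)] that(2) by order
    then have "en (ext w) i = en X i" by (rule en_agree[OF X(1) ext_infinite w(5)])
    moreover have a: "agree X (ext w) z" by (rule agree_leq[OF w(5) that(2)])
    moreover have "z \<prec> w" using that(2) y_w by order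
    ultimately show ?thesis using spans_agree[OF a that(1)] seg_agree[OF a] by simp
  qed
  \<comment> \<open>The values computed from the canonical completion of \<open>t\<close> equal
    those computed from any set with the same initial segment.\<close>
  have transfer: "start t i = fv (seg Z (en Z i) z)"
    if "infinite_set Z" "agree (ext t) Z b" "b \<in> elts t" "spans Z (en Z i) z" "z \<preceq> b" for t Z b i z
  proof -
    have "en Z i \<preceq> b" using spans_leq[OF that(4)] that(5) by order
    then have e: "en (ext t) i = en Z i" by (rule en_agree[OF that(1) ext_infinite agree_sym[OF that(2)]])
    have a: "agree Z (ext t) z" by (rule agree_leq[OF agree_sym[OF that(2)] that(5)])
    have "spans (ext t) (en (ext t) i) z" unfolding e by (rule spans_agree[OF a that(4)])
    moreover have "z \<prec> t" using elts_less[OF that(3)] that(5) by order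
    ultimately show ?thesis using start_eq seg_agree[OF a, of "en Z i"] e by simp
  qed
  note start_w = transfer[OF X(1) agree_sym[OF w(5)] w(3)]
  have ext_spans: "\<exists>z. z \<prec> w \<and> spans (ext w) (en (ext w) i) z" if "i \<prec> ?n \<oplus> \<one> \<oplus> \<one>" for i
  proof (cases i rule: zero_or_succ)
    case 1
    have "x0 \<preceq> y" using x0(2) xy by order
    then show ?thesis using w_spans[OF x0(1)] unfolding 1 by blast
  next
    case (2 k)
    then have "k \<preceq> ?n" using that[unfolded 2] by (simp only: less_succ_iff_leq succ_leq_iff_less)
    then obtain z where "z \<preceq> y" "spans ?Y (en ?Y k) z" using Y_spans by blast
    then show ?thesis using w_spans[OF spans_Y[OF \<open>spans ?Y (en ?Y k) z\<close>, unfolded en_Y]] unfolding 2 by blast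
  qed
  \<comment> \<open>The n + 1 places for v, shifted by one, together with place zero for the first
    member of u.\<close>
  let ?N = "?n \<oplus> \<one> \<oplus> \<one>"
  let ?w = "code w ?N"
  have bad: "bad_code ?w ?N" by (rule bad_code[OF ext_spans])
  have less_N: "i \<prec> ?N" "\<one> \<oplus> i \<prec> ?N" if "i \<prec> ?n \<oplus> \<one>" for i
  proof -
    show "i \<prec> ?N" using that unfolding less_succ[of i "?n \<oplus> \<one>"] by (rule disjI1)
    show "\<one> \<oplus> i \<prec> ?N"
      using that unfolding add_commutes[of \<one> i] less_succ_iff_leq succ_leq_iff_less .
  qed
  have start_u: "start u i = start w i" if i: "i \<prec> ?m \<oplus> \<one>" for i
  proof -
    obtain z where z: "z \<preceq> x" "spans X (en X i) z" using X_spans i unfolding less_succ_iff_leq by blast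
    then have "z \<preceq> y" using xy by order
    then show ?thesis using transfer[OF X(1) cX(3,2) z(2,1)] start_w[OF z(2)] by simp
  qed
  have start_v: "start v i = start w (\<one> \<oplus> i)" if i: "i \<prec> ?n \<oplus> \<one>" for i
  proof -
    obtain z where z: "z \<preceq> y" "spans ?Y (en ?Y i) z" using Y_spans i unfolding less_succ_iff_leq by blast
    have "start v i = fv (seg ?Y (en ?Y i) z)" by (rule transfer[OF Y cY(3,2) z(2,1)])
    also have "\<dots> = fv (seg X (en X (i \<oplus> \<one>)) z)" by (simp only: seg_Y[OF en_in[OF Y, of i]] flip: en_Y)
    also have "\<dots> = start w (i \<oplus> \<one>)"
      by (rule start_w[OF spans_Y[OF z(2), unfolded en_Y] z(1), symmetric])
    finally show ?thesis unfolding add_commutes[of \<one> i] .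
  qed
  have rounds: "rounds u = ?m" "rounds v = ?n"
  proof -
    have "chain (ext u) x0 x" by (rule chain_agree[OF X(1) ext_infinite agree_sym[OF cX(3)] cX(1)])
    then show "rounds u = ?m" using rounds_eq elts_less[OF cX(2)] by blast
    have "chain (ext v) y0 y" by (rule chain_agree[OF Y ext_infinite agree_sym[OF cY(3)] cY(1)])
    then show "rounds v = ?n" using rounds_eq elts_less[OF cY(2)] by blast
  qed
  have mN: "i \<prec> ?n \<oplus> \<one>" if "i \<prec> ?m \<oplus> \<one>" for i
    using that mn unfolding less_succ_iff_leq by order
  have "result u = entry ?w (\<zero> \<oplus> \<zero>) ?m"
    unfolding result_def rounds
  proof (rule entry_shift[where n = "?m \<oplus> \<one>"])
    fix i assume i: "i \<prec> ?m \<oplus> \<one>"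
    show "pair i (app (code u (?m \<oplus> \<one>)) i) \<in> elts (code u (?m \<oplus> \<one>))" by (rule app_code(2)[OF i])
    show "pair (\<zero> \<oplus> i) (app ?w (\<zero> \<oplus> i)) \<in> elts ?w"
      unfolding zero_add by (rule app_code(2)[OF less_N(1)[OF mN[OF i]]])
    show "app (code u (?m \<oplus> \<one>)) i = app ?w (\<zero> \<oplus> i)"
      unfolding zero_add app_code(1)[OF i] app_code(1)[OF less_N(1)[OF mN[OF i]]] by (rule start_u[OF i])
  qed (simp add: zero_add less_succ)
  then have ru: "result u = entry ?w \<zero> ?m" by (simp add: zero_add)
  have "result v = entry ?w (\<one> \<oplus> \<zero>) ?n"
    unfolding result_def rounds
  proof (rule entry_shift[where n = "?n \<oplus> \<one>"])
    fix i assume i: "i \<prec> ?n \<oplus> \<one>"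
    show "pair i (app (code v (?n \<oplus> \<one>)) i) \<in> elts (code v (?n \<oplus> \<one>))" by (rule app_code(2)[OF i])
    show "pair (\<one> \<oplus> i) (app ?w (\<one> \<oplus> i)) \<in> elts ?w" by (rule app_code(2)[OF less_N(2)[OF i]])
    show "app (code v (?n \<oplus> \<one>)) i = app ?w (\<one> \<oplus> i)"
      unfolding app_code(1)[OF i] app_code(1)[OF less_N(2)[OF i]] by (rule start_v[OF i])
  qed (simp add: zero_add less_succ)
  then have rv: "result v = entry ?w (\<zero> \<oplus> \<one>) ?n" by (simp add: zero_add add_zero)
  obtain q where "result u = ur q" using result_ur[OF u] by blast
  moreover have n: "?n \<prec> ?n \<oplus> \<one>" by (simp add: less_succ)
  \<comment> \<open>The result of u appears in round \<open>?m\<close> already. Being a urelement it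
    persists to round \<open>?n\<close>, where it is the left neighbour of the result of v.\<close>
  ultimately have "entry ?w \<zero> ?n = result u"
    using entry_stable[OF bad _ mn less_N(1)[OF n], of q] ru by simp
  moreover have "pair (entry ?w \<zero> ?n) (entry ?w (\<zero> \<oplus> \<one>) ?n) \<notin> L"
    by (rule entry_invariant(3)[OF bad]) (unfold zero_add, rule less_N(1)[OF n], rule less_N(2)[OF n])
  ultimately show ?thesis using rv by simp
qed

end

context Hf
begin

lemma bqo_H:
  assumes bqo: "bqo Q R" shows "bqo H L"
  unfolding bqo_def
proof (intro conjI ballI impI)
  show "quasi_order H L" by (rule quasi_order_H)
  fix B F assume "barrier B \<and> function_from_to F B H"
  then have B: "barrier B" and F: "function_from_to F B H" by blast+
  show "\<exists>s\<in>B. \<exists>t\<in>B. s \<lhd> t \<and> (\<exists>p q. pair s p \<in> F \<and> pair t q \<in> F \<and> pair p q \<in> L)"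
  proof (rule ccontr)
    assume contra: "\<not> ?thesis"
    interpret bad_array M Q R H L B F
    proof unfold_locales
      show "pair p q \<notin> L" if "s \<in> B" "t \<in> B" "s \<lhd> t" "pair s p \<in> F" "pair t q \<in> F" for s t p q
        using contra that by blast
    qed (rule B F)+
    obtain g where g: "F1 (\<lambda>e. g (e 0))" "\<And>m m'. m \<preceq> m' \<Longrightarrow> g m \<preceq> g m'"
      "\<And>m s. fincode s \<Longrightarrow> \<forall>i\<in>elts s. i \<preceq> m \<Longrightarrow> fv s \<prec> g m"
      by (rule finite_sets_function_bound[OF F1_fv[OF F1_var]]) (rule that)
    interpret bad_array_bound M Q R H L B F g
      by (unfold_locales; (rule B g; assumption))
    have "barrier B'" "function_from_to F' B' Q" by (rule barrier_B', rule function_F')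
    moreover have "B' \<in> sets M" "F' \<in> sets M"
      using function_F' B'_sets unfolding function_from_to_def by blast+
    ultimately obtain s t p q where st: "s \<in> B'" "t \<in> B'" "s \<lhd> t" "pair s p \<in> F'" "pair t q \<in> F'" "pair p q \<in> R"
      using bqo unfolding bqo_def by blast
    have "result s = ur p" "result t = ur q" using st(4,5) unfolding pair_F' by blast+
    moreover from this have "p \<in> Q" "q \<in> Q"
      using result_ur[OF st(1)] result_ur[OF st(2)] by (metis ur_inject)+
    ultimately show False using result_bad[OF st(1-3)] st(6) by (simp add: L_ur_ur)
  qed
qed

end

text \<open>The existence part ensures that the statement about all \<open>H\<close> and
  \<open>L\<close> is not vacuous.\<close>

theorem theorem3p2:
  fixes M :: "'a l2_structure" and Q R :: "'a set"
  assumes "rca0 M"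
    and "l2.quasi_order M Q R"
    and "l2.bqo M Q R"
  shows "(\<exists>H L. l2.is_Hf M Q R H L) \<and> (\<forall>H L. l2.is_Hf M Q R H L \<longrightarrow> l2.bqo M H L)"
proof (intro conjI allI impI)
  interpret rca0 M by fact
  show "\<exists>H L. is_Hf Q R H L" by (rule is_Hf_exists) fact
  fix H L assume "is_Hf Q R H L"
  then interpret Hf M Q R H L using assms(2) by unfold_locales
  show "bqo H L" by (rule bqo_H) fact
qed

end
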